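(* Let $0<m<p<\infty$, $1<p$ and $0<q<p<\infty$. Define $r=\frac{pq}{p-q}$. If $q=1$, define $\frac r{q'}=0$. For weights $u,w,v$ such that the pair $(u,w)$ is admissible with respect to $(m,q)$, let $$C=\sup_{h\in\mathfrak M_+}\frac{\left(\int_0^{\infty}\left(\int_t^\infty \left(\int_s^{\infty}h(y)\,dy\right)^m u(s)\,ds\right)^{\frac{q}{m}}w(t)\,dt\right)^{\frac{1}{q}}}{\left(\int_0^{\infty}h(t)^pv(t)\,dt\right)^{\frac{1}{p}}},$$ $$A_1=\sup_{t\in(0,\infty)}\left(\int_0^t w(s)\left(\int_s^t u(y)\,dy\right)^{\frac qm}ds\right)^{\frac1q}\left(\int_t^{\infty}v(s)^{1-p'}ds\right)^{\frac1{p'}},$$ $$A_5=\left(\int_0^{\infty}\left(\int_0^t w(s)\,ds\right)^{\frac rp}w(t)\left(\int_t^{\infty}\left(\int_t^s u(y)\,dy\right)^{\frac p{p-m}}\left(\int_s^{\infty}v(\tau)^{1-p'}d\tau\right)^{\frac{p(m-1)}{p-m}}v(s)^{1-p'}ds\right)^{\frac{q(p-m)}{m(p-q)}}dt\right)^{\frac1r},$$ $$A_6=\left(\int_0^{\infty}\left(\int_0^t w(s)\left(\int_s^{t}u(y)\,dy\right)^{\frac qm}ds\right)^{\frac rq}\left(\int_t^{\infty}v(y)^{1-p'}dy\right)^{\frac r{q'}}v(t)^{1-p'}dt\right)^{\frac1r}.$$ Then $C\lesssim A_1+A_5+A_6$. However, the estimate $A_6\lesssim C$ is valid (that is, there is a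 constant $\beta\in(0,\infty)$ depending only on $m,p,q$ such that $A_6\le\beta C$ for all weights $u,w,v$ with $(u,w)$ admissible with respect to $(m,q)$) if and only if $m\le q$.
   Context: $\mathfrak M_+$ is the cone of all non-negative measurable functions on $(0,\infty)$. A weight is a measurable non-negative function on $(0,\infty)$. For an exponent $q\in(0,1)\cup(1,\infty)$, $q'=\frac{q}{q-1}$ (negative if $q<1$); likewise $p'=\frac{p}{p-1}$. The pair of weights $(u,w)$ is admissible with respect to $(m,q)$ if the function $$\varphi(t)=\left(\int_0^{t}\left(\int_s^t u(y)\,dy\right)^{\frac{q}{m}}w(s)\,ds\right)^{\frac1q}$$ satisfies $0<\varphi(t)<\infty$ for every $t\in(0,\infty)$. $A\lesssim B$ means $A\le cB$ with a constant $c\in(0,\infty)$ that may depend only on the exponents $m,p,q$ (not on the weights). All quantities take values in $[0,\infty]$. Conventions: $0\cdot\infty=0$, $\frac00=0$, $a^0=1$ for all $a\in[0,\infty]$ (and, as usual, $0$ to a negative power is $\infty$, $\infty$ to a negative power is $0$). The number $C\in[0,\infty]$ is the optimal (least) constant in the inequality "numerator $\le C\cdot$ denominator" required for all $h\in\mathfrak M_+$. *)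

theory Defs
  imports "HOL-Analysis.Analysis"
begin

text \<open>
  Real powers on \<open>[0,\<infinity>]\<close>, total: \<open>a\<^sup>0 = 1\<close> for every \<open>a\<close> (including \<open>0\<close> and \<open>\<infinity>\<close>), \<open>0\<close> to a
  negative power is \<open>\<infinity>\<close>, and \<open>\<infinity>\<close> to a negative power is \<open>0\<close>.  The convention \<open>0 \<cdot> \<infinity> = 0\<close> is
  that of the type \<open>ennreal\<close>.
\<close>

definition epow :: "ennreal \<Rightarrow> real \<Rightarrow> ennreal" (infixr "\<up>" 80) where
  "x \<up> a =
    (if a = 0 then 1
     else if x = 0 then (if a > 0 then 0 else \<infinity>)
     else if x = \<infinity> then (if a > 0 then \<infinity> else 0)
     else ennreal (enn2real x powr a))"

text \<open>
  Non-negative (Lebesgue) measurable functions on \<open>(0,\<infinity>)\<close>, with values in \<open>[0,\<infinity>]\<close>, represented by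
  functions on \<open>real\<close>; the values outside \<open>(0,\<infinity>)\<close> are unconstrained and never used below.
  Weights are the members of the same set.
\<close>

definition M_plus :: "(real \<Rightarrow> ennreal) set" where
  "M_plus = borel_measurable (lebesgue_on {0<..})"

definition weight :: "(real \<Rightarrow> ennreal) \<Rightarrow> bool" where
  "weight f \<longleftrightarrow> f \<in> M_plus"

definition conj_exp :: "real \<Rightarrow> real" where
  "conj_exp q = q / (q - 1)"

definition r_exp :: "real \<Rightarrow> real \<Rightarrow> real" where
  "r_exp p q = p * q / (p - q)"

text \<open>The exponent \<open>r/q'\<close>, which is set to \<open>0\<close> for \<open>q = 1\<close>.\<close>

definition r_over_conj :: "real \<Rightarrow> real \<Rightarrow> real" where
  "r_over_conj p q = (if q = 1 then 0 else r_exp p q / conj_exp q)"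

definition phi :: "real \<Rightarrow> real \<Rightarrow> (real \<Rightarrow> ennreal) \<Rightarrow> (real \<Rightarrow> ennreal) \<Rightarrow> real \<Rightarrow> ennreal" where
  "phi m q u w t =
    (\<integral>\<^sup>+ s\<in>{0<..<t}. (\<integral>\<^sup>+ y\<in>{s<..<t}. u y \<partial>lebesgue) \<up> (q / m) * w s \<partial>lebesgue) \<up> (1 / q)"

definition admissible :: "real \<Rightarrow> real \<Rightarrow> (real \<Rightarrow> ennreal) \<Rightarrow> (real \<Rightarrow> ennreal) \<Rightarrow> bool" where
  "admissible m q u w \<longleftrightarrow> (\<forall>t>0. 0 < phi m q u w t \<and> phi m q u w t < \<infinity>)"

definition numer ::
    "real \<Rightarrow> real \<Rightarrow> (real \<Rightarrow> ennreal) \<Rightarrow> (real \<Rightarrow> ennreal) \<Rightarrow> (real \<Rightarrow> ennreal) \<Rightarrow> ennreal" where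
  "numer m q u w h =
    (\<integral>\<^sup>+ t\<in>{0<..}.
       (\<integral>\<^sup>+ s\<in>{t<..}. (\<integral>\<^sup>+ y\<in>{s<..}. h y \<partial>lebesgue) \<up> m * u s \<partial>lebesgue) \<up> (q / m) * w t
     \<partial>lebesgue) \<up> (1 / q)"

definition denom :: "real \<Rightarrow> (real \<Rightarrow> ennreal) \<Rightarrow> (real \<Rightarrow> ennreal) \<Rightarrow> ennreal" where
  "denom p v h = (\<integral>\<^sup>+ t\<in>{0<..}. h t \<up> p * v t \<partial>lebesgue) \<up> (1 / p)"

text \<open>
  Division on \<open>ennreal\<close> satisfies \<open>0/0 = 0\<close>, \<open>a/0 = \<infinity>\<close> for \<open>a > 0\<close> and \<open>a/\<infinity> = 0\<close> for all \<open>a\<close>,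
  including \<open>\<infinity>/\<infinity> = 0\<close>: functions \<open>h\<close> with infinite denominator impose no condition.  The lemma
  below the definition confirms that this supremum is the optimal constant of the inequality.
\<close>

definition C_opt ::
    "real \<Rightarrow> real \<Rightarrow> real \<Rightarrow> (real \<Rightarrow> ennreal) \<Rightarrow> (real \<Rightarrow> ennreal) \<Rightarrow> (real \<Rightarrow> ennreal) \<Rightarrow> ennreal" where
  "C_opt m p q u w v = (SUP h\<in>M_plus. numer m q u w h / denom p v h)"

lemma C_opt_eq_Inf:
  "C_opt m p q u w v = Inf {K. \<forall>h\<in>M_plus. numer m q u w h \<le> K * denom p v h}"
proof (rule antisym)
  show "C_opt m p q u w v \<le> Inf {K. \<forall>h\<in>M_plus. numer m q u w h \<le> K * denom p v h}"
  proof (rule Inf_greatest)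
    fix K assume "K \<in> {K. \<forall>h\<in>M_plus. numer m q u w h \<le> K * denom p v h}"
    then have K: "numer m q u w h \<le> K * denom p v h" if "h \<in> M_plus" for h
      using that by blast
    show "C_opt m p q u w v \<le> K"
      unfolding C_opt_def
    proof (rule SUP_least)
      fix h assume "h \<in> M_plus"
      then show "numer m q u w h / denom p v h \<le> K"
        using K[of h] divide_right_mono_ennreal[OF K[of h], of "denom p v h"]
        by (cases "denom p v h = 0"; cases "denom p v h = top")
           (auto simp: mult_divide_eq_ennreal)
    qed
  qed
  show "Inf {K. \<forall>h\<in>M_plus. numer m q u w h \<le> K * denom p v h} \<le> C_opt m p q u w v"
  proof (rule dense_ge)
    fix K assume K: "C_opt m p q u w v < K"
    have "numer m q u w h \<le> K * denom p v h" if "h \<in> M_plus" for h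
    proof -
      have "numer m q u w h / denom p v h \<le> C_opt m p q u w v"
        unfolding C_opt_def using that by (rule SUP_upper)
      then have less: "numer m q u w h / denom p v h < K"
        using K by (rule le_less_trans)
      consider "denom p v h = 0" | "denom p v h = top" | "denom p v h \<noteq> 0" "denom p v h < top"
        using top.not_eq_extremum by blast
      then show ?thesis
      proof cases
        case 1
        then show ?thesis using less by (auto split: if_splits)
      next
        case 2
        then show ?thesis using less by (auto simp: ennreal_mult_top)
      next
        case 3
        then show ?thesis using less divide_less_ennreal by (auto intro: less_imp_le)
      qed
    qed
    then show "Inf {K. \<forall>h\<in>M_plus. numer m q u w h \<le> K * denom p v h} \<le> K"
      by (intro Inf_lower) blast
  qed
qed

definition A1 ::
    "real \<Rightarrow> real \<Rightarrow> real \<Rightarrow> (real \<Rightarrow> ennreal) \<Rightarrow> (real \<Rightarrow> ennreal) \<Rightarrow> (real \<Rightarrow> ennreal) \<Rightarrow> ennreal" where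
  "A1 m p q u w v =
    (SUP t\<in>{0<..}.
       (\<integral>\<^sup>+ s\<in>{0<..<t}. w s * (\<integral>\<^sup>+ y\<in>{s<..<t}. u y \<partial>lebesgue) \<up> (q / m) \<partial>lebesgue) \<up> (1 / q)
       * (\<integral>\<^sup>+ s\<in>{t<..}. v s \<up> (1 - conj_exp p) \<partial>lebesgue) \<up> (1 / conj_exp p))"

definition A5 ::
    "real \<Rightarrow> real \<Rightarrow> real \<Rightarrow> (real \<Rightarrow> ennreal) \<Rightarrow> (real \<Rightarrow> ennreal) \<Rightarrow> (real \<Rightarrow> ennreal) \<Rightarrow> ennreal" where
  "A5 m p q u w v =
    (\<integral>\<^sup>+ t\<in>{0<..}.
       (\<integral>\<^sup>+ s\<in>{0<..<t}. w s \<partial>lebesgue) \<up> (r_exp p q / p) * w t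
       * (\<integral>\<^sup>+ s\<in>{t<..}.
            (\<integral>\<^sup>+ y\<in>{t<..<s}. u y \<partial>lebesgue) \<up> (p / (p - m))
            * (\<integral>\<^sup>+ \<tau>\<in>{s<..}. v \<tau> \<up> (1 - conj_exp p) \<partial>lebesgue) \<up> (p * (m - 1) / (p - m))
            * v s \<up> (1 - conj_exp p)
          \<partial>lebesgue) \<up> (q * (p - m) / (m * (p - q)))
     \<partial>lebesgue) \<up> (1 / r_exp p q)"

definition A6 ::
    "real \<Rightarrow> real \<Rightarrow> real \<Rightarrow> (real \<Rightarrow> ennreal) \<Rightarrow> (real \<Rightarrow> ennreal) \<Rightarrow> (real \<Rightarrow> ennreal) \<Rightarrow> ennreal" where
  "A6 m p q u w v =
    (\<integral>\<^sup>+ t\<in>{0<..}.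
       (\<integral>\<^sup>+ s\<in>{0<..<t}. w s * (\<integral>\<^sup>+ y\<in>{s<..<t}. u y \<partial>lebesgue) \<up> (q / m) \<partial>lebesgue) \<up> (r_exp p q / q)
       * (\<integral>\<^sup>+ y\<in>{t<..}. v y \<up> (1 - conj_exp p) \<partial>lebesgue) \<up> r_over_conj p q
       * v t \<up> (1 - conj_exp p)
     \<partial>lebesgue) \<up> (1 / r_exp p q)"

end

theory Submission
  imports Defs "HOL-Probability.Distribution_Functions"
begin

text \<open>
  Write \<open>\<sigma> = v\<^sup>1\<^sup>-\<^sup>p\<^sup>'\<close>, \<open>V(t) = \<integral>\<^sub>t\<^sup>\<infinity> \<sigma>\<close>, \<open>U(s,t) = \<integral>\<^sub>s\<^sup>t u\<close>, \<open>W(t) = \<integral>\<^sub>0\<^sup>t w\<close> and \<open>H(t) = \<integral>\<^sub>t\<^sup>\<infinity> h\<close>.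

  Upper bound. \<open>A1\<close> only serves to make \<open>V\<close> finite. Then \<open>H\<^sup>p \<le> c V\<^sup>p P\<close> for a nondecreasing \<open>P\<close> with
  \<open>\<integral> P \<sigma> \<le> c \<integral> h\<^sup>p v\<close>. In the inner integral of the numerator, the points \<open>s\<close> at which \<open>W(s)\<close> exceeds a
  large multiple of \<open>W(t)\<close> can be absorbed. For a remaining point \<open>s\<close> the monotonicity of \<open>P\<close> bounds
  \<open>P(s)\<^sup>m\<^sup>/\<^sup>p V(s)\<^sup>m\<close> by integrals over \<open>\<tau> > s\<close>: the contribution of the near \<open>\<tau>\<close> is estimated by \<open>A5\<close>, using
  Hoelder's inequality twice, and that of the far \<open>\<tau>\<close> by \<open>A6\<close>, exchanging the order of integration.

  Necessity for \<open>m \<le> q\<close>. Test with \<open>h = \<sigma> V\<^sup>(\<^sup>q\<^sup>-\<^sup>1\<^sup>)\<^sup>/\<^sup>(\<^sup>p\<^sup>-\<^sup>q\<^sup>) \<phi>\<^sup>q\<^sup>/\<^sup>(\<^sup>p\<^sup>-\<^sup>q\<^sup>)\<close>, with \<open>\<sigma>\<close> truncated. The function \<open>\<phi>\<^sup>q\<close> has a density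
  \<open>\<rho>\<close>, and \<open>\<integral> H\<^sup>q \<rho>\<close> is at most a multiple of the numerator to the power \<open>q\<close>, because
  \<open>U(t,x) H(x)\<^sup>m \<le> \<integral>\<^sub>t\<^sup>\<infinity> H\<^sup>m u\<close> may be raised to the power \<open>q/m - 1 \<ge> 0\<close>.

  Failure for \<open>q < m\<close>. With \<open>\<sigma>(s) = e\<^sup>-\<^sup>s\<close>, \<open>w\<close> the indicator of \<open>(0,1)\<close> and \<open>u(y) = e\<^sup>m\<^sup>y\<^sup>/\<^sup>p\<^sup>'\<close> on \<open>(0,N)\<close>, the
  number \<open>A6\<close> grows at least like \<open>N\<close> to the power \<open>1/q - 1/p\<close>, but \<open>C\<close> at most like \<open>N\<close> to the power \<open>1/m - 1/p\<close>.
\<close>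

section \<open>Real powers on \<open>[0,\<infinity>]\<close> and Hoelder's inequality\<close>

text \<open>The weight W^(q/(p-q)) w of \<open>A5\<close> arises from Hoelder's inequality in t, at
  the price of the measure w/W dt on the other factor, whose mass may diverge like a logarithm.
  Restricted to pairs with W(z) <= L W(t), the integral of w(t)/W(t) over t < z is at most L. This
  is why the far points s have to be removed first. For a far \<tau> every near s lies to its left,
  so the u-mass of the near points is at most U(t,\<tau>), and integration in t gives
  \<phi>(\<tau>)^q, the factor of \<open>A6\<close>.

  The test function is suggested by equality in Hoelder's inequality: h^p v reproduces the integrand
  of D = A6^r, and D is at most a multiple of the numerator to the power q. Hence D^(1/q) <= c C
  D^(1/p). Division by D^(1/p) needs D finite, which is the reason for truncating \<sigma>.

  In the counterexample the exponentials cancel: the integrand of A6^r stays above a positive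
  constant on (2,N), the inner integrand of \<open>A5\<close> stays bounded on (0,N), and only the
  outer exponents 1/q - 1/p and 1/m - 1/p differ.\<close>

lemma epow_0_left: "a > 0 \<Longrightarrow> 0 \<up> a = 0"
  by (simp add: epow_def)

lemma epow_ennreal: "x > 0 \<Longrightarrow> ennreal x \<up> a = ennreal (x powr a)"
  by (simp add: epow_def)

lemma epow_zero [simp]: "x \<up> 0 = 1"
  by (simp add: epow_def)

lemma epow_one [simp]: "x \<up> 1 = x"
  by (cases x) (auto simp: epow_def)

lemma one_epow [simp]: "1 \<up> a = 1"
  using epow_ennreal[of 1 a] by simp

lemma ennreal_cases3 [case_names zero top real]:
  fixes x :: ennreal
  obtains "x = 0" | "x = \<infinity>" | r where "r > 0" "x = ennreal r"
proof (cases x)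
  case (real r)
  then show ?thesis using that by (cases "r = 0") auto
qed (use that in auto)

lemma measurable_epow [measurable (raw)]:
  assumes [measurable]: "f \<in> borel_measurable M"
  shows "(\<lambda>x. f x \<up> a) \<in> borel_measurable M"
  unfolding epow_def by measurable

lemma epow_mult_exp: "x \<up> (a * b) = (x \<up> a) \<up> b"
proof (cases "a = 0 \<or> b = 0")
  case False
  then show ?thesis
    by (cases x rule: ennreal_cases3)
      (auto simp: epow_ennreal powr_powr, auto simp: epow_def zero_less_mult_iff)
qed auto

lemma epow_mult:
  assumes "a \<ge> 0"
  shows "(x * y) \<up> a = x \<up> a * y \<up> a"
proof (cases "a = 0")
  case False
  then have a: "a > 0" using assms by simp
  show ?thesis
    by (cases x rule: ennreal_cases3; cases y rule: ennreal_cases3)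
      (use a in \<open>auto simp: epow_ennreal powr_mult ennreal_mult[symmetric] epow_0_left ennreal_top_mult
         ennreal_mult_top\<close>, (auto simp: epow_def ennreal_mult_top ennreal_top_mult)?)
qed auto

lemma epow_add:
  assumes "a \<ge> 0" "b \<ge> 0"
  shows "x \<up> (a + b) = x \<up> a * x \<up> b"
  by (cases x rule: ennreal_cases3; cases "a = 0"; cases "b = 0")
     (use assms in \<open>auto simp: epow_ennreal powr_add ennreal_mult[symmetric]\<close>, auto simp: epow_def)

text \<open>Exponents of opposite sign require a finite positive base: for x = \<infinity> the
  product of the powers 1 and -1 is \<infinity> * 0 = 0, whereas the power 0 is 1. Hence the
  recurring case \<open>tail \<sigma> = 0\<close> below.\<close>

lemma epow_add_finite:
  assumes "0 < x" "x < \<infinity>"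
  shows "x \<up> (a + b) = x \<up> a * x \<up> b"
  using assms
  by (cases x rule: ennreal_cases3) (auto simp: epow_ennreal powr_add ennreal_mult[symmetric])

lemma epow_mono:
  assumes "x \<le> y" "a \<ge> 0"
  shows "x \<up> a \<le> y \<up> a"
proof (cases "a = 0")
  case False
  then have a: "a > 0" using assms by simp
  show ?thesis
    by (cases x rule: ennreal_cases3; cases y rule: ennreal_cases3)
      (use a assms in \<open>auto simp: epow_ennreal epow_0_left powr_mono2 top_unique\<close>,
       auto simp: epow_def)
qed auto

lemma epow_antimono:
  assumes "x \<le> y" "a \<le> 0"
  shows "y \<up> a \<le> x \<up> a"
proof (cases "a = 0")
  case False
  then have a: "a < 0" using assms by simp
  show ?thesis
    by (cases x rule: ennreal_cases3; cases y rule: ennreal_cases3)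
      (use a assms in \<open>auto simp: epow_ennreal powr_mono2' top_unique\<close>, auto simp: epow_def)
qed auto

lemma epow_inverse:
  assumes "a \<noteq> 0"
  shows "(x \<up> a) \<up> (1 / a) = x" "(x \<up> (1 / a)) \<up> a = x"
  using epow_mult_exp[of x a "1 / a"] epow_mult_exp[of x "1 / a" a] assms by auto

lemma epow_eq_0_iff: "a > 0 \<Longrightarrow> x \<up> a = 0 \<longleftrightarrow> x = 0"
  using epow_inverse(1)[of a x] by (auto simp: epow_0_left)

lemma epow_top: "a > 0 \<Longrightarrow> top \<up> a = top"
  by (simp add: epow_def)

lemma epow_eq_top_iff: "a > 0 \<Longrightarrow> x \<up> a = top \<longleftrightarrow> x = top"
  using epow_inverse(1)[of a x] epow_top[of a] epow_top[of "1 / a"] by (metis less_numeral_extra(3) zero_less_divide_1_iff)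

lemma epow_less_top: "x < \<infinity> \<Longrightarrow> a \<ge> 0 \<Longrightarrow> x \<up> a < \<infinity>"
  using epow_eq_top_iff[of a x] by (cases "a = 0") (auto simp: less_top[symmetric])

lemma epow_le_iff: "a > 0 \<Longrightarrow> x \<up> a \<le> y \<up> a \<longleftrightarrow> x \<le> y"
  using epow_mono[of x y a] epow_mono[of "x \<up> a" "y \<up> a" "1 / a"] by (auto simp: epow_inverse)

lemma epow_le_swap: "a > 0 \<Longrightarrow> x \<up> a \<le> y \<longleftrightarrow> x \<le> y \<up> (1 / a)"
  using epow_le_iff[of a x "y \<up> (1 / a)"] by (simp add: epow_inverse)

text \<open>Powers with exponents a and 1/a are mutually inverse order isomorphisms
  (\<open>epow_le_swap\<close>), and these preserve suprema.\<close>

lemma epow_SUP: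
  assumes "a > 0"
  shows "(SUP i\<in>I. f i) \<up> a = (SUP i\<in>I. f i \<up> a)"
proof (rule antisym)
  show "(SUP i\<in>I. f i \<up> a) \<le> (SUP i\<in>I. f i) \<up> a"
    using assms by (intro SUP_least epow_mono SUP_upper) auto
  show "(SUP i\<in>I. f i) \<up> a \<le> (SUP i\<in>I. f i \<up> a)"
    unfolding epow_le_swap[OF assms]
    by (intro SUP_least, subst epow_le_swap[OF assms, symmetric]) (rule SUP_upper)
qed

lemma epow_add_le:
  assumes "a > 0"
  shows "(x + y) \<up> a \<le> 2 \<up> a * (x \<up> a + y \<up> a)"
proof -
  have "(x + y) \<up> a \<le> (2 * max x y) \<up> a"
    using assms by (intro epow_mono) (auto simp: mult_2 max_def intro: add_mono)
  also have "\<dots> = 2 \<up> a * max x y \<up> a" using assms by (simp add: epow_mult)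
  also have "max x y \<up> a \<le> x \<up> a + y \<up> a" by (simp add: max_def)
  finally show ?thesis by (simp add: mult_left_mono)
qed

text \<open>Equality fails exactly at 0 and \<infinity>, where the product is 0.\<close>

lemma epow_pow_minus_one: "x \<up> (-1) * x \<le> 1"
  by (cases x rule: ennreal_cases3)
    (auto simp: epow_ennreal powr_minus ennreal_mult[symmetric], auto simp: epow_def)

lemma epow_weighted_AM_GM:
  assumes "0 < a" "0 < b" "a + b = 1"
  shows "x \<up> a * y \<up> b \<le> ennreal a * x + ennreal b * y"
proof (cases x rule: ennreal_cases3)
  case zero then show ?thesis using assms by (simp add: epow_0_left)
next
  case top then show ?thesis using assms by (simp add: ennreal_mult_top)
next
  case x: (real r)
  show ?thesis
  proof (cases y rule: ennreal_cases3)
    case zero then show ?thesis using assms by (simp add: epow_0_left)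
  next
    case top then show ?thesis using assms by (simp add: ennreal_mult_top)
  next
    case y: (real s)
    have "r powr a * s powr b \<le> a * r + b * s"
      using Youngs_inequality_0[of a b r s] x y assms by simp
    then show ?thesis
      using x y assms by (simp add: epow_ennreal ennreal_mult[symmetric] ennreal_plus[symmetric] del: ennreal_plus)
  qed
qed

text \<open>Weighted AM-GM for f/F and g/G, where F and G are the two integrals. If one of them is
  0, the integrand on the left vanishes almost everywhere; if one is infinite and the other is not
  0, the right side is infinite.\<close>

lemma nn_integral_Holder:
  assumes [measurable]: "f \<in> borel_measurable M" "g \<in> borel_measurable M"
    and ab: "0 < a" "0 < b" "a + b = 1"
  shows "(\<integral>\<^sup>+ x. f x \<up> a * g x \<up> b \<partial>M) \<le> (\<integral>\<^sup>+ x. f x \<partial>M) \<up> a * (\<integral>\<^sup>+ x. g x \<partial>M) \<up> b"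
proof -
  define F where "F = (\<integral>\<^sup>+ x. f x \<partial>M)"
  define G where "G = (\<integral>\<^sup>+ x. g x \<partial>M)"
  consider "F = 0 \<or> G = 0" | "F \<noteq> 0" "G \<noteq> 0" "F = \<infinity> \<or> G = \<infinity>"
    | r s where "r > 0" "s > 0" "F = ennreal r" "G = ennreal s"
    by (cases F rule: ennreal_cases3; cases G rule: ennreal_cases3) auto
  then show ?thesis
  proof cases
    case 1
    then have "(\<integral>\<^sup>+ x. f x \<up> a * g x \<up> b \<partial>M) = (\<integral>\<^sup>+ x. 0 \<partial>M)"
      unfolding F_def G_def
      by (intro nn_integral_cong_AE) (auto simp: nn_integral_0_iff_AE ab epow_0_left)
    then show ?thesis by simp
  next
    case 2
    then have "F \<up> a * G \<up> b = \<infinity>"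
      using ab epow_eq_0_iff[of a F] epow_eq_0_iff[of b G]
      by (auto simp: epow_top ennreal_mult_top ennreal_top_mult)
    then show ?thesis by (simp add: F_def G_def)
  next
    case (3 r s)
    have inv: "ennreal (c powr - e) * ennreal (c powr e) = 1" if "c > 0" for c e :: real
      using that by (simp add: ennreal_mult[symmetric] powr_add[symmetric])
    have "(\<integral>\<^sup>+ x. f x \<up> a * g x \<up> b \<partial>M)
        = (\<integral>\<^sup>+ x. (F \<up> a * G \<up> b) * ((f x * ennreal (1/r)) \<up> a * (g x * ennreal (1/s)) \<up> b) \<partial>M)"
    proof (rule nn_integral_cong, goal_cases)
      case (1 x)
      have "(F \<up> a * G \<up> b) * ((f x * ennreal (1/r)) \<up> a * (g x * ennreal (1/s)) \<up> b)
         = f x \<up> a * g x \<up> b * ((F * ennreal (1/r)) \<up> a * (G * ennreal (1/s)) \<up> b)"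
        using ab by (simp add: epow_mult mult_ac)
      also have "F * ennreal (1/r) = 1"
        using 3 by (auto simp: ennreal_mult[symmetric])
      also have "G * ennreal (1/s) = 1"
        using 3 by (auto simp: ennreal_mult[symmetric])
      finally show ?case
        by simp
    qed
    also have "\<dots> \<le> (\<integral>\<^sup>+ x. (F \<up> a * G \<up> b) * (ennreal a * (f x * ennreal (1/r)) + ennreal b * (g x * ennreal (1/s))) \<partial>M)"
      by (intro nn_integral_mono mult_left_mono epow_weighted_AM_GM ab) auto
    also have "\<dots> = (F \<up> a * G \<up> b) * (ennreal a * (F * ennreal (1/r)) + ennreal b * (G * ennreal (1/s)))"
      unfolding F_def G_def
      by (subst nn_integral_cmult, measurable, subst nn_integral_add, measurable)
        (simp add: nn_integral_cmult nn_integral_multc)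
    also have "F * ennreal (1/r) = 1" using 3 by (auto simp: ennreal_mult[symmetric])
    also have "G * ennreal (1/s) = 1" using 3 by (auto simp: ennreal_mult[symmetric])
    also have "ennreal a * 1 + ennreal b * 1 = 1"
      using ab by (simp add: ennreal_plus[symmetric] del: ennreal_plus)
    finally show ?thesis by (simp add: F_def G_def)
  qed
qed

section \<open>Change of variables by a primitive\<close>

text \<open>Without atoms the cdf is continuous, so it takes the value x at the last point
  \<open>t0\<close> of its sublevel set, and the superlevel set is the ray beyond \<open>t0\<close>.
  The sublevel set can be empty only for x = 0, because the cdf tends to 0.\<close>

lemma (in finite_borel_measure) emeasure_cdf_greaterThan:
  assumes no_atoms: "\<And>x. measure M {x} = 0" and "0 \<le> x"
  shows "emeasure M {t. x < cdf M t} = ennreal (measure M (space M) - x)"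
proof -
  define S where "S = {t. cdf M t \<le> x}"
  have cont: "isCont (cdf M) t" for t using no_atoms by (simp add: isCont_cdf)
  have meas: "emeasure M {t<..} = ennreal (measure M (space M) - cdf M t)" for t
  proof -
    have "{t<..} = space M - {..t}" by (auto simp: borel_UNIV)
    moreover have "measure M (space M - {..t}) = measure M (space M) - cdf M t"
      unfolding cdf_def2 by (intro finite_measure_compl) auto
    ultimately show ?thesis by (simp add: emeasure_eq_measure)
  qed
  consider "measure M (space M) \<le> x" | "x < measure M (space M)" "S = {}"
    | "x < measure M (space M)" "S \<noteq> {}" by linarith
  then show ?thesis
  proof cases
    case 1
    then have "{t. x < cdf M t} = {}"
      using cdf_bounded by (auto simp: not_less intro: order.trans)
    then show ?thesis using 1 by (simp add: ennreal_neg)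
  next
    case 2
    then have gt: "x < cdf M t" for t by (auto simp: S_def not_le)
    then have "x \<le> 0"
      using cdf_lim_at_bot by (intro tendsto_lowerbound[of "cdf M" 0 at_bot]) (auto intro: always_eventually less_imp_le)
    then have "x = 0" using \<open>0 \<le> x\<close> by simp
    moreover have "{t. x < cdf M t} = space M" using gt by (auto simp: borel_UNIV)
    ultimately show ?thesis by (simp add: emeasure_eq_measure)
  next
    case 3
    obtain T where T: "cdf M T > x"
      using order_tendstoD(1)[OF cdf_lim_at_top 3(1)] by (auto simp: eventually_at_top_linorder)
    have bdd: "bdd_above S"
    proof (rule bdd_aboveI)
      show "t \<le> T" if "t \<in> S" for t
      proof (rule ccontr)
        assume "\<not> t \<le> T"
        then have "cdf M T \<le> cdf M t" by (intro cdf_nondecreasing) simp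
        with T that show False by (simp add: S_def)
      qed
    qed
    define t0 where "t0 = Sup S"
    have closed: "closed S"
      unfolding S_def using cont
      by (intro closed_Collect_le) (auto simp: continuous_at_imp_continuous_on)
    have "t0 \<in> S" unfolding t0_def using closed_contains_Sup[OF 3(2) bdd closed] .
    then have le: "cdf M t0 \<le> x" by (simp add: S_def)
    have gt: "x < cdf M t" if "t > t0" for t
    proof (rule ccontr)
      assume "\<not> x < cdf M t"
      then have "t \<in> S" by (simp add: S_def)
      then have "t \<le> t0" unfolding t0_def by (rule cSup_upper[OF _ bdd])
      with that show False by simp
    qed
    have "x \<le> cdf M t0"
    proof (rule tendsto_lowerbound)
      show "(cdf M \<longlongrightarrow> cdf M t0) (at_right t0)"
        using cdf_is_right_cont by (simp add: continuous_within)
      show "\<forall>\<^sub>F t in at_right t0. x \<le> cdf M t"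
        unfolding eventually_at_right_field using gt by (intro exI[of _ "t0 + 1"]) (simp add: less_imp_le)
    qed auto
    with le have eq: "cdf M t0 = x" by simp
    have "{t. x < cdf M t} = {t0<..}"
    proof (intro set_eqI iffI)
      fix t assume "t \<in> {t. x < cdf M t}"
      then show "t \<in> {t0<..}" using eq cdf_nondecreasing[of t t0] by (cases "t \<le> t0") auto
    qed (use gt in auto)
    then show ?thesis using meas[of t0] eq by simp
  qed
qed

text \<open>The probability integral transform for arbitrary finite mass. A measure is determined by
  the masses of the rays {x<..}; for negative x the ray has full mass, whence
  \<open>max 0 x\<close>.\<close>

lemma (in finite_borel_measure) distr_cdf:
  assumes no_atoms: "\<And>x. measure M {x} = 0"
  shows "distr M borel (cdf M) = density lborel (indicator {0<..<measure M (space M)})"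
proof (rule measure_eqI_lessThan)
  have [measurable]: "cdf M \<in> borel_measurable borel"
    by (intro borel_measurable_mono) (auto simp: mono_def cdf_nondecreasing)
  have [measurable]: "cdf M \<in> borel_measurable M"
    by (simp cong: measurable_cong_sets add: M_is_borel)
  have *: "emeasure (distr M borel (cdf M)) {x<..} = ennreal (measure M (space M) - max 0 x)" for x
  proof (cases "x \<ge> 0")
    case True
    then show ?thesis
      using emeasure_cdf_greaterThan[OF no_atoms True]
      by (subst emeasure_distr) (auto simp: vimage_def borel_UNIV greaterThan_def max_def)
  next
    case False
    then have "cdf M -` {x<..} \<inter> space M = space M"
      using cdf_nonneg by (auto simp: not_le intro: less_le_trans)
    then show ?thesis using False
      by (subst emeasure_distr) (auto simp: emeasure_eq_measure)
  qed
  show "emeasure (distr M borel (cdf M)) {x<..} < \<infinity>" for x unfolding * by simp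
  show "emeasure (distr M borel (cdf M)) {x<..}
    = emeasure (density lborel (indicator {0<..<measure M (space M)})) {x<..}" for x
  proof -
    let ?m = "measure M (space M)"
    have "emeasure (density lborel (indicator {0<..<?m})) {x<..}
        = (\<integral>\<^sup>+ t. indicator {0<..<?m} t * indicator {x<..} t \<partial>lborel)"
      by (subst emeasure_density) auto
    also have "\<dots> = (\<integral>\<^sup>+ t. indicator {max 0 x<..<?m} t \<partial>lborel)"
      by (intro nn_integral_cong) (auto split: split_indicator)
    also have "\<dots> = ennreal (?m - max 0 x)"
    proof (cases "max 0 x \<le> ?m")
      case False
      then have "{max 0 x<..<?m} = {}" "?m - max 0 x \<le> 0" by auto
      then show ?thesis by (simp only: ennreal_neg) simp
    qed (simp del: max.bounded_iff)
    finally show ?thesis unfolding * ..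
  qed
qed auto

text \<open>Moving end points: integrals over rays and intervals become measurable in their end
  points, as the later exchanges of integration require.\<close>

lemma measurable_indicator_var [measurable (raw)]:
  fixes f g h :: "'a \<Rightarrow> real"
  assumes [measurable]: "f \<in> borel_measurable M" "g \<in> borel_measurable M" "h \<in> borel_measurable M"
  shows "(\<lambda>x. indicator {f x<..} (h x) :: ennreal) \<in> borel_measurable M"
    and "(\<lambda>x. indicator {..<g x} (h x) :: ennreal) \<in> borel_measurable M"
    and "(\<lambda>x. indicator {f x<..<g x} (h x) :: ennreal) \<in> borel_measurable M"
  unfolding indicator_def greaterThan_iff lessThan_iff greaterThanLessThan_iff by measurable

text \<open>With M the measure of density g, head and tail of g at s are x and M(UNIV) - x for x the
  cdf of M at s. The cdf carries M to Lebesgue measure on an interval, and the reflection of this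
  interval preserves Lebesgue measure, so both substitutions have the same value. No regularity of g
  is involved.\<close>

lemma
  fixes g :: "real \<Rightarrow> ennreal" and \<psi> :: "ennreal \<Rightarrow> ennreal"
  assumes [measurable]: "g \<in> borel_measurable borel" and fin: "(\<integral>\<^sup>+ s. g s \<partial>lborel) < \<infinity>"
    and [measurable]: "\<psi> \<in> borel_measurable borel"
  shows nn_integral_subst_left: "(\<integral>\<^sup>+ s. \<psi> (\<integral>\<^sup>+ y. g y * indicator {..<s} y \<partial>lborel) * g s \<partial>lborel)
      = (\<integral>\<^sup>+ x. \<psi> (ennreal x) * indicator {0<..<enn2real (\<integral>\<^sup>+ s. g s \<partial>lborel)} x \<partial>lborel)" (is "?L = ?I")
    and nn_integral_subst_right: "(\<integral>\<^sup>+ s. \<psi> (\<integral>\<^sup>+ y. g y * indicator {s<..} y \<partial>lborel) * g s \<partial>lborel)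
      = (\<integral>\<^sup>+ x. \<psi> (ennreal x) * indicator {0<..<enn2real (\<integral>\<^sup>+ s. g s \<partial>lborel)} x \<partial>lborel)" (is "?R = ?I")
proof -
  define M where "M = density lborel g"
  define m where "m = enn2real (\<integral>\<^sup>+ s. g s \<partial>lborel)"
  have em: "emeasure M A = (\<integral>\<^sup>+ s. g s * indicator A s \<partial>lborel)" if "A \<in> sets borel" for A
    using that unfolding M_def by (subst emeasure_density) auto
  have fin': "emeasure M A < \<infinity>" if "A \<in> sets borel" for A
  proof -
    have "emeasure M A \<le> (\<integral>\<^sup>+ s. g s \<partial>lborel)"
      unfolding em[OF that] by (intro nn_integral_mono) (simp add: indicator_def)
    then show ?thesis using fin by (rule le_less_trans)
  qed
  interpret finite_measure M
    using fin'[of UNIV] by (intro finite_measureI) (simp add: M_def)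
  interpret finite_borel_measure M
    by standard (simp add: M_def)
  have m: "measure M (space M) = m"
    using em[of UNIV] by (simp add: measure_def m_def M_def)
  have atoms: "measure M {x} = 0" for x
  proof -
    have "emeasure M {x} = 0"
      using AE_lborel_singleton[of x] by (subst em) (auto simp: nn_integral_0_iff_AE indicator_def)
    then show ?thesis by (simp add: measure_def)
  qed
  have [measurable]: "cdf M \<in> borel_measurable borel"
    by (intro borel_measurable_mono) (auto simp: mono_def cdf_nondecreasing)
  have left: "(\<integral>\<^sup>+ y. g y * indicator {..<s} y \<partial>lborel) = ennreal (cdf M s)" for s
  proof -
    have "(\<integral>\<^sup>+ y. g y * indicator {..<s} y \<partial>lborel) = (\<integral>\<^sup>+ y. g y * indicator {..s} y \<partial>lborel)"
      using AE_lborel_singleton[of s] by (intro nn_integral_cong_AE) (auto simp: indicator_def)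
    then show ?thesis using em[of "{..s}"] by (simp add: cdf_def emeasure_eq_measure)
  qed
  have right: "(\<integral>\<^sup>+ y. g y * indicator {s<..} y \<partial>lborel) = ennreal (m - cdf M s)" for s
  proof -
    have "{s<..} = space M - {..s}" by (auto simp: borel_UNIV)
    moreover have "measure M (space M - {..s}) = m - cdf M s"
      unfolding cdf_def2 m[symmetric] by (intro finite_measure_compl) auto
    ultimately have "measure M {s<..} = m - cdf M s" by simp
    then show ?thesis using em[of "{s<..}"] by (simp add: emeasure_eq_measure)
  qed
  have key: "(\<integral>\<^sup>+ s. \<theta> (cdf M s) * g s \<partial>lborel) = (\<integral>\<^sup>+ x. \<theta> x * indicator {0<..<m} x \<partial>lborel)"
    if [measurable]: "\<theta> \<in> borel_measurable borel" for \<theta> :: "real \<Rightarrow> ennreal"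
  proof -
    have [measurable]: "cdf M \<in> borel_measurable M"
      by (simp cong: measurable_cong_sets add: M_is_borel)
    have "(\<integral>\<^sup>+ s. \<theta> (cdf M s) * g s \<partial>lborel) = (\<integral>\<^sup>+ s. \<theta> (cdf M s) \<partial>M)"
      by (subst (2) M_def, subst nn_integral_density) (auto simp: mult.commute)
    also have "\<dots> = (\<integral>\<^sup>+ x. \<theta> x \<partial>distr M borel (cdf M))"
      by (subst nn_integral_distr) auto
    also have "\<dots> = (\<integral>\<^sup>+ x. \<theta> x * indicator {0<..<m} x \<partial>lborel)"
      unfolding distr_cdf[OF atoms] m by (subst nn_integral_density) (auto intro!: nn_integral_cong mult.commute)
    finally show ?thesis .
  qed
  show "?L = ?I"
    unfolding left m_def[symmetric] by (rule key[of "\<lambda>x. \<psi> (ennreal x)"]) measurable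
  have "?R = (\<integral>\<^sup>+ x. \<psi> (ennreal (m - x)) * indicator {0<..<m} x \<partial>lborel)"
    unfolding right by (rule key[of "\<lambda>x. \<psi> (ennreal (m - x))"]) measurable
  also have "\<dots> = ?I"
    unfolding m_def[symmetric]
    by (subst nn_integral_real_affine[where c="-1" and t="m"])
       (auto intro!: nn_integral_cong simp: indicator_def)
  finally show "?R = ?I" .
qed

lemma nn_integral_power_0:
  assumes "b > 0" "0 \<le> m"
  shows "(\<integral>\<^sup>+ x. ennreal x \<up> (b - 1) * indicator {0<..<m} x \<partial>lborel) = ennreal (1 / b) * ennreal m \<up> b"
proof -
  have "((\<lambda>x. x powr (b - 1)) has_integral (m powr b / b)) {0..m}"
    using has_integral_powr_from_0[of "b - 1" m] assms by simp
  then have "(\<integral>\<^sup>+ x. ennreal (x powr (b - 1) * indicator {0..m} x) \<partial>lborel) = ennreal (m powr b / b)"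
    by (intro nn_integral_has_integral_lebesgue[of "{0..m}" "\<lambda>x. x powr (b - 1)", unfolded mult.commute[of "indicator _ _"]]) simp
  moreover have "(\<integral>\<^sup>+ x. ennreal x \<up> (b - 1) * indicator {0<..<m} x \<partial>lborel)
     = (\<integral>\<^sup>+ x. ennreal (x powr (b - 1) * indicator {0..m} x) \<partial>lborel)"
  proof (rule nn_integral_cong_AE, goal_cases)
    case 1
    show ?case
      using AE_lborel_singleton[of 0] AE_lborel_singleton[of m]
      by eventually_elim (auto simp: epow_ennreal indicator_def)
  qed
  ultimately show ?thesis
    using assms by (cases "m = 0") (simp_all add: epow_0_left epow_ennreal ennreal_mult[symmetric])
qed

lemma nn_integral_power_tail:
  assumes "d > 0" "0 < c"
  shows "(\<integral>\<^sup>+ x. ennreal x \<up> (- 1 - d) * indicator {c..} x \<partial>lborel) = ennreal (1 / d) * ennreal c \<up> (- d)"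
proof -
  have "(\<integral>\<^sup>+ x. ennreal x \<up> (- 1 - d) * indicator {c..} x \<partial>lborel)
      = (\<integral>\<^sup>+ x. ennreal (x powr (- 1 - d)) * indicator {c..} x \<partial>lborel)"
    using assms by (intro nn_integral_cong) (auto simp: epow_ennreal indicator_def)
  also have "\<dots> = ennreal (0 - (- (c powr (- d)) / d))"
  proof (rule nn_integral_FTC_atLeast)
    show "((\<lambda>x. - (x powr (- d)) / d) has_real_derivative x powr (- 1 - d)) (at x)" if "c \<le> x" for x
      using that assms
      by (auto intro!: derivative_eq_intros arg_cong[where f="(powr) x"])
    have "((\<lambda>x. - (x powr (- d)) / d) \<longlongrightarrow> - 0 / d) at_top"
      using assms by (intro tendsto_intros tendsto_neg_powr filterlim_ident) auto
    then show "((\<lambda>x. - (x powr (- d)) / d) \<longlongrightarrow> 0) at_top" by simp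
  qed auto
  finally show ?thesis using assms by (simp add: epow_ennreal ennreal_mult[symmetric])
qed

section \<open>Cumulative integrals and their powers\<close>

definition head :: "(real \<Rightarrow> ennreal) \<Rightarrow> real \<Rightarrow> ennreal" where
  "head f t = (\<integral>\<^sup>+ y. f y * indicator {..<t} y \<partial>lborel)"

definition tail :: "(real \<Rightarrow> ennreal) \<Rightarrow> real \<Rightarrow> ennreal" where
  "tail f t = (\<integral>\<^sup>+ y. f y * indicator {t<..} y \<partial>lborel)"

definition mid :: "(real \<Rightarrow> ennreal) \<Rightarrow> real \<Rightarrow> real \<Rightarrow> ennreal" where
  "mid f s t = (\<integral>\<^sup>+ y. f y * indicator {s<..<t} y \<partial>lborel)"

lemma measurable_head [measurable (raw)]:
  assumes [measurable]: "f \<in> borel_measurable borel" "g \<in> borel_measurable M"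
  shows "(\<lambda>x. head f (g x)) \<in> borel_measurable M"
  unfolding head_def by measurable

lemma measurable_tail [measurable (raw)]:
  assumes [measurable]: "f \<in> borel_measurable borel" "g \<in> borel_measurable M"
  shows "(\<lambda>x. tail f (g x)) \<in> borel_measurable M"
  unfolding tail_def by measurable

lemma measurable_mid [measurable (raw)]:
  assumes [measurable]: "f \<in> borel_measurable borel" "g \<in> borel_measurable M" "h \<in> borel_measurable M"
  shows "(\<lambda>x. mid f (g x) (h x)) \<in> borel_measurable M"
  unfolding mid_def by measurable

lemma measurable_tail2:
  assumes [measurable]: "(\<lambda>z. f (fst z) (snd z)) \<in> borel_measurable (M \<Otimes>\<^sub>M borel)" "g \<in> borel_measurable M"
  shows "(\<lambda>x. tail (f x) (g x)) \<in> borel_measurable M"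
proof -
  have "(\<lambda>z. f (fst z) (snd z)) \<in> borel_measurable (M \<Otimes>\<^sub>M lborel)"
    using assms(1) by (simp cong: measurable_cong_sets)
  then show ?thesis
    unfolding tail_def by measurable
qed

lemma measurable_head2:
  assumes [measurable]: "(\<lambda>z. f (fst z) (snd z)) \<in> borel_measurable (M \<Otimes>\<^sub>M borel)" "g \<in> borel_measurable M"
  shows "(\<lambda>x. head (f x) (g x)) \<in> borel_measurable M"
proof -
  have "(\<lambda>z. f (fst z) (snd z)) \<in> borel_measurable (M \<Otimes>\<^sub>M lborel)"
    using assms(1) by (simp cong: measurable_cong_sets)
  then show ?thesis
    unfolding head_def by measurable
qed

lemma head_mono: "s \<le> t \<Longrightarrow> head f s \<le> head f t"
  unfolding head_def by (intro nn_integral_mono) (auto simp: indicator_def)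

lemma tail_antimono: "s \<le> t \<Longrightarrow> tail f t \<le> tail f s"
  unfolding tail_def by (intro nn_integral_mono) (auto simp: indicator_def)

lemma mid_mono: "s' \<le> s \<Longrightarrow> t \<le> t' \<Longrightarrow> mid f s t \<le> mid f s' t'"
  unfolding mid_def by (intro nn_integral_mono) (auto simp: indicator_def)

lemma tail_mono_fun: "(\<And>x. x > t \<Longrightarrow> f x \<le> g x) \<Longrightarrow> tail f t \<le> tail g t"
  unfolding tail_def by (intro nn_integral_mono) (auto simp: indicator_def)

lemma tail_cong: "(\<And>x. x > t \<Longrightarrow> f x = g x) \<Longrightarrow> tail f t = tail g t"
  unfolding tail_def by (intro nn_integral_cong) (auto simp: indicator_def)

lemma head_restrict: "head (\<lambda>y. f y * indicator {s<..} y) t = mid f s t"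
  unfolding head_def mid_def by (intro nn_integral_cong) (auto simp: indicator_def)

text \<open>The weights will be replaced by Borel functions that vanish on the nonpositive axis. For
  those, \<open>head\<close> is the integral from 0.\<close>

lemma head_eq_mid:
  assumes "\<And>s. s \<le> 0 \<Longrightarrow> f s = 0"
  shows "head f t = mid f 0 t"
  unfolding head_def mid_def using assms by (intro nn_integral_cong) (auto simp: indicator_def not_less)

text \<open>Only the mass of f beyond t is known to be finite, so f is cut off at t. The cut-off
  function has total mass \<open>tail f t\<close> and the same tails beyond t.\<close>

lemma tail_subst:
  assumes [measurable]: "f \<in> borel_measurable borel" and fin: "tail f t < \<infinity>"
    and [measurable]: "\<psi> \<in> borel_measurable borel"
  shows "tail (\<lambda>s. \<psi> (tail f s) * f s) t
    = (\<integral>\<^sup>+ x. \<psi> (ennreal x) * indicator {0<..<enn2real (tail f t)} x \<partial>lborel)"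
proof -
  define g where "g = (\<lambda>s. f s * indicator {t<..} s)"
  have [measurable]: "g \<in> borel_measurable borel" unfolding g_def by measurable
  have int: "(\<integral>\<^sup>+ s. g s \<partial>lborel) = tail f t" by (simp add: g_def tail_def)
  have eq: "tail g s = tail f s" if "s > t" for s
    unfolding tail_def g_def using that by (intro nn_integral_cong) (auto simp: indicator_def)
  have "tail (\<lambda>s. \<psi> (tail f s) * f s) t = (\<integral>\<^sup>+ s. \<psi> (tail g s) * g s \<partial>lborel)"
    unfolding tail_def[of _ t] using eq by (intro nn_integral_cong) (auto simp: g_def indicator_def)
  also have "\<dots> = (\<integral>\<^sup>+ x. \<psi> (ennreal x) * indicator {0<..<enn2real (tail f t)} x \<partial>lborel)"
    unfolding int[symmetric] tail_def[of g]
    by (rule nn_integral_subst_right) (use fin int in auto)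
  finally show ?thesis .
qed

lemma head_subst:
  assumes [measurable]: "f \<in> borel_measurable borel" and fin: "head f t < \<infinity>"
    and [measurable]: "\<psi> \<in> borel_measurable borel"
  shows "head (\<lambda>s. \<psi> (head f s) * f s) t
    = (\<integral>\<^sup>+ x. \<psi> (ennreal x) * indicator {0<..<enn2real (head f t)} x \<partial>lborel)"
proof -
  define g where "g = (\<lambda>s. f s * indicator {..<t} s)"
  have [measurable]: "g \<in> borel_measurable borel" unfolding g_def by measurable
  have int: "(\<integral>\<^sup>+ s. g s \<partial>lborel) = head f t" by (simp add: g_def head_def)
  have eq: "head g s = head f s" if "s < t" for s
    unfolding head_def g_def using that by (intro nn_integral_cong) (auto simp: indicator_def)
  have "head (\<lambda>s. \<psi> (head f s) * f s) t = (\<integral>\<^sup>+ s. \<psi> (head g s) * g s \<partial>lborel)"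
    unfolding head_def[of _ t] using eq by (intro nn_integral_cong) (auto simp: g_def indicator_def)
  also have "\<dots> = (\<integral>\<^sup>+ x. \<psi> (ennreal x) * indicator {0<..<enn2real (head f t)} x \<partial>lborel)"
    unfolding int[symmetric] head_def[of g]
    by (rule nn_integral_subst_left) (use fin int in auto)
  finally show ?thesis .
qed

text \<open>The chain rule for the power b of \<open>tail f\<close>. Exponents b < 1 are covered
  because x^(b-1) is integrable at 0.\<close>

lemma tail_power:
  assumes [measurable]: "f \<in> borel_measurable borel" and fin: "tail f t < \<infinity>" and b: "b > 0"
  shows "tail (\<lambda>s. tail f s \<up> (b - 1) * f s) t = ennreal (1 / b) * tail f t \<up> b"
  using tail_subst[OF assms(1,2), of "\<lambda>x. x \<up> (b - 1)"] fin
    nn_integral_power_0[OF b, of "enn2real (tail f t)"] by (simp add: ennreal_enn2real)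

lemma head_power:
  assumes [measurable]: "f \<in> borel_measurable borel" and fin: "head f t < \<infinity>" and b: "b > 0"
  shows "head (\<lambda>s. head f s \<up> (b - 1) * f s) t = ennreal (1 / b) * head f t \<up> b"
  using head_subst[OF assms(1,2), of "\<lambda>x. x \<up> (b - 1)"] fin
    nn_integral_power_0[OF b, of "enn2real (head f t)"] by (simp add: ennreal_enn2real)

lemma mid_power:
  assumes [measurable]: "f \<in> borel_measurable borel" and fin: "mid f r t < \<infinity>" and b: "b > 0"
  shows "mid (\<lambda>s. mid f r s \<up> (b - 1) * f s) r t = ennreal (1 / b) * mid f r t \<up> b"
proof -
  have "head (\<lambda>s. head (\<lambda>y. f y * indicator {r<..} y) s \<up> (b - 1) * (f s * indicator {r<..} s)) t
    = ennreal (1 / b) * head (\<lambda>y. f y * indicator {r<..} y) t \<up> b"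
    by (rule head_power) (use fin b in \<open>auto simp: head_restrict\<close>)
  then show ?thesis
    unfolding head_restrict mult.assoc[symmetric] .
qed

text \<open>Substitution with the indicator of 0: the value x = 0 lies outside the open range of
  integration. The points discarded here are those at which powers of the tail with opposite
  exponents fail to cancel.\<close>

lemma AE_tail_eq_0:
  assumes [measurable]: "f \<in> borel_measurable borel" and fin: "tail f t < \<infinity>"
  shows "AE s in lborel. s > t \<longrightarrow> tail f s = 0 \<longrightarrow> f s = 0"
proof -
  have "tail (\<lambda>s. indicator {0} (tail f s) * f s) t
      = (\<integral>\<^sup>+ x. indicator {0} (ennreal x) * indicator {0<..<enn2real (tail f t)} x \<partial>lborel)"
    by (rule tail_subst) (use fin in auto)
  also have "\<dots> = (\<integral>\<^sup>+ (x :: real). 0 \<partial>lborel)"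
    by (intro nn_integral_cong) (auto simp: indicator_def)
  finally have "tail (\<lambda>s. indicator {0} (tail f s) * f s) t = 0" by simp
  then have "(\<integral>\<^sup>+ s. indicator {0} (tail f s) * f s * indicator {t<..} s \<partial>lborel) = 0"
    unfolding tail_def[of _ t] .
  moreover have "(\<lambda>s. indicator {0} (tail f s) * f s * indicator {t<..} s) \<in> borel_measurable lborel"
    by measurable
  ultimately have "AE s in lborel. indicator {0} (tail f s) * f s * indicator {t<..} s = 0"
    using nn_integral_0_iff_AE by blast
  then show ?thesis by eventually_elim (auto simp: indicator_def split: if_splits)
qed

text \<open>Tails are known to be finite only at positive points, so integrals down to 0 are
  approached from 1/(n+1).\<close>

lemma nn_integral_restrict_SUP:
  assumes [measurable]: "f \<in> borel_measurable borel"
  shows "(\<integral>\<^sup>+ s. f s * indicator {0<..<x} s \<partial>lborel)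
    = (SUP n. \<integral>\<^sup>+ s. f s * indicator {1 / real (Suc n)<..<x} s \<partial>lborel)"
proof -
  have inc: "incseq (\<lambda>n s. f s * indicator {1 / real (Suc n)<..<x} s)"
  proof (intro incseq_SucI le_funI mult_left_mono)
    fix n and s :: real
    have "1 / real (Suc (Suc n)) \<le> 1 / real (Suc n)" by (intro divide_left_mono) auto
    then show "indicator {1 / real (Suc n)<..<x} s \<le> (indicator {1 / real (Suc (Suc n))<..<x} s :: ennreal)"
      by (auto simp: indicator_def)
  qed simp
  have "(\<integral>\<^sup>+ s. f s * indicator {0<..<x} s \<partial>lborel)
      = (\<integral>\<^sup>+ s. (SUP n. f s * indicator {1 / real (Suc n)<..<x} s) \<partial>lborel)"
  proof (intro nn_integral_cong antisym SUP_least)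
    fix s :: real
    show "f s * indicator {0<..<x} s \<le> (SUP n. f s * indicator {1 / real (Suc n)<..<x} s)"
    proof (cases "0 < s \<and> s < x")
      case True
      then obtain n where "1 / real (Suc n) < s" using nat_approx_posE by blast
      then show ?thesis using True by (intro SUP_upper2[of n]) auto
    qed auto
    show "f s * indicator {1 / real (Suc n)<..<x} s \<le> f s * indicator {0<..<x} s" for n
      by (auto simp: indicator_def intro: less_trans[of 0 "1 / real (Suc n)"])
  qed
  also have "\<dots> = (SUP n. \<integral>\<^sup>+ s. f s * indicator {1 / real (Suc n)<..<x} s \<partial>lborel)"
    by (rule nn_integral_monotone_convergence_SUP[OF inc]) measurable
  finally show ?thesis .
qed

text \<open>In the variable y = \<open>tail f s\<close>, points s < x satisfy y >=
  \<open>tail f x\<close>. Integrating y^(-1-d) over this whole half-line gives the right side and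
  avoids the value of the tail at 0, which may be infinite.\<close>

lemma tail_negative_power:
  assumes [measurable]: "f \<in> borel_measurable borel" and fin: "\<And>t. t > 0 \<Longrightarrow> tail f t < \<infinity>" and d: "d > 0"
  shows "(\<integral>\<^sup>+ s. tail f s \<up> (- 1 - d) * f s * indicator {0<..<x} s \<partial>lborel) \<le> ennreal (1 / d) * tail f x \<up> (- d)"
proof (cases "x > 0 \<and> tail f x \<noteq> 0")
  case False
  then show ?thesis
  proof (cases "x > 0")
    case True
    with False have "tail f x = 0" by simp
    then show ?thesis using d by (simp add: epow_def ennreal_mult_top)
  qed (auto simp: indicator_def)
next
  case True
  define c where "c = enn2real (tail f x)"
  have c: "tail f x = ennreal c" "c > 0"
    using True fin[of x] by (auto simp: c_def ennreal_enn2real enn2real_positive_iff less_top[symmetric] zero_less_iff_neq_zero)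
  have "(\<integral>\<^sup>+ s. tail f s \<up> (- 1 - d) * f s * indicator {e<..<x} s \<partial>lborel) \<le> ennreal (1 / d) * tail f x \<up> (- d)"
    if e: "e > 0" for e
  proof -
    have "(\<integral>\<^sup>+ s. tail f s \<up> (- 1 - d) * f s * indicator {e<..<x} s \<partial>lborel)
       \<le> tail (\<lambda>s. (tail f s \<up> (- 1 - d) * indicator {ennreal c..} (tail f s)) * f s) e"
      unfolding tail_def[of _ e] c(1)[symmetric]
      by (intro nn_integral_mono) (use tail_antimono[of _ x f] in \<open>auto simp: indicator_def\<close>)
    also have "\<dots> = (\<integral>\<^sup>+ y. (ennreal y \<up> (- 1 - d) * indicator {ennreal c..} (ennreal y))
        * indicator {0<..<enn2real (tail f e)} y \<partial>lborel)"
      by (rule tail_subst) (use fin e in auto)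
    also have "\<dots> \<le> (\<integral>\<^sup>+ y. ennreal y \<up> (- 1 - d) * indicator {c..} y \<partial>lborel)"
      using c by (intro nn_integral_mono) (auto simp: indicator_def)
    also have "\<dots> = ennreal (1 / d) * tail f x \<up> (- d)"
      using nn_integral_power_tail[OF d c(2)] c by simp
    finally show ?thesis .
  qed
  then show ?thesis
    by (subst nn_integral_restrict_SUP) (auto intro!: SUP_least)
qed

lemma ennreal_quarter_le:
  assumes "ennreal v \<le> 2 * (x + ennreal (v/4))" "v > 0"
  shows "ennreal (v/4) \<le> x"
proof (cases x)
  case (real r)
  then have "2 * (x + ennreal (v/4)) = ennreal 2 * (ennreal r + ennreal (v/4))" by simp
  also have "\<dots> = ennreal 2 * ennreal (r + v/4)"
    using assms real by (subst ennreal_plus) auto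
  also have "\<dots> = ennreal (2 * (r + v/4))"
    using assms real by (subst ennreal_mult[symmetric]) auto
  finally have "2 * (x + ennreal (v/4)) = ennreal (2 * (r + v/4))" .
  then have "ennreal v \<le> ennreal (2 * (r + v/4))" using assms(1) by metis
  then have "v \<le> 2 * (r + v/4)" using real assms(2) by (subst (asm) ennreal_le_iff) auto
  then show ?thesis using real by (simp add: ennreal_leI)
qed simp

text \<open>Let v = \<open>tail f t\<close>. The set A where the tail is below v/4 has mass v/4. As
  E has mass at least v/2 beyond t, at least v/4 remains in E - A, and there the tail lies between
  v/4 and v, so its power b - 1 is comparable to v^(b-1). The factor 4 comes from the mass, the
  maximum from this comparison for b >= 1 and b < 1.\<close>

lemma tail_power_le_restrict:
  assumes [measurable]: "f \<in> borel_measurable borel" "E \<in> sets borel" and fin: "tail f t < \<infinity>" and b: "b > 0"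
    and half: "tail f t \<le> 2 * tail (\<lambda>s. f s * indicator E s) t"
  shows "tail f t \<up> b \<le> ennreal (4 * max 1 (4 powr (b - 1))) * tail (\<lambda>s. tail f s \<up> (b - 1) * f s * indicator E s) t"
proof (cases "tail f t = 0")
  case True
  then show ?thesis using b by (simp add: epow_0_left)
next
  case False
  define v where "v = enn2real (tail f t)"
  have v: "tail f t = ennreal v" "v > 0"
    using False fin by (auto simp: v_def ennreal_enn2real enn2real_positive_iff less_top[symmetric] zero_less_iff_neq_zero)
  define A where "A = {s. tail f s < ennreal (v/4)}"
  have [measurable]: "A \<in> sets borel" unfolding A_def by measurable
  define \<kappa> where "\<kappa> = max 1 (4 powr (b - 1))"
  have \<kappa>: "\<kappa> > 0" by (simp add: \<kappa>_def)
  have "tail (\<lambda>s. indicator {..<ennreal (v/4)} (tail f s) * f s) t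
      = (\<integral>\<^sup>+ x. indicator {..<ennreal (v/4)} (ennreal x) * indicator {0<..<v} x \<partial>lborel)"
    unfolding v_def by (rule tail_subst) (use fin in auto)
  also have "\<dots> = (\<integral>\<^sup>+ x. indicator {0<..<v/4} x \<partial>lborel)"
    using v by (intro nn_integral_cong) (auto simp: indicator_def ennreal_less_iff)
  also have "\<dots> = ennreal (v/4)" using v by simp
  finally have A: "tail (\<lambda>s. indicator A s * f s) t = ennreal (v/4)"
    by (simp add: A_def indicator_def)
  define X where "X = tail (\<lambda>s. f s * indicator (E - A) s) t"
  have "tail (\<lambda>s. f s * indicator E s) t \<le> X + tail (\<lambda>s. indicator A s * f s) t"
    unfolding X_def tail_def
    by (subst nn_integral_add[symmetric]) (auto intro!: nn_integral_mono simp: indicator_def)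
  then have "ennreal v \<le> 2 * (X + ennreal (v/4))"
    using half v A by (auto intro!: order.trans[OF half[unfolded v(1)]] mult_left_mono simp del: distrib_left_numeral)
  then have X: "ennreal (v/4) \<le> X" using v(2) by (rule ennreal_quarter_le)
  have low: "ennreal (v powr (b - 1)) \<le> ennreal \<kappa> * tail f s \<up> (b - 1)" if s: "s > t" "s \<notin> A" for s
  proof -
    have "tail f s \<le> ennreal v" using s tail_antimono[of t s f] v by simp
    then obtain y where y: "tail f s = ennreal y" "0 \<le> y" "y \<le> v"
      using v by (cases "tail f s") (auto simp: top_unique)
    have y4: "v / 4 \<le> y" using s y v by (simp add: A_def not_less)
    have "v powr (b - 1) \<le> \<kappa> * y powr (b - 1)"
    proof (cases "b \<ge> 1")
      case True
      have "v powr (b - 1) \<le> (4 * y) powr (b - 1)" using y4 v True by (intro powr_mono2) auto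
      also have "\<dots> = 4 powr (b - 1) * y powr (b - 1)" using y by (simp add: powr_mult)
      also have "\<dots> \<le> \<kappa> * y powr (b - 1)" unfolding \<kappa>_def by (intro mult_right_mono) auto
      finally show ?thesis .
    next
      case False
      have "v powr (b - 1) \<le> y powr (b - 1)" using y y4 v False by (intro powr_mono2') auto
      also have "\<dots> \<le> \<kappa> * y powr (b - 1)"
        using mult_right_mono[of 1 \<kappa> "y powr (b - 1)"] by (simp add: \<kappa>_def)
      finally show ?thesis .
    qed
    then show ?thesis using y y4 v \<kappa> by (simp add: epow_ennreal ennreal_mult[symmetric])
  qed
  have "tail f t \<up> b = ennreal (v powr b)" using v by (simp add: epow_ennreal)
  also have "v powr b = v powr (b - 1) * v" using v powr_mult_base[of v "b - 1"] by (simp add: mult.commute)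
  also have "ennreal \<dots> = 4 * (ennreal (v powr (b - 1)) * ennreal (v / 4))"
    using v by (simp add: ennreal_mult[symmetric] ennreal_numeral[symmetric] del: ennreal_numeral)
  also have "\<dots> \<le> 4 * (ennreal (v powr (b - 1)) * X)" using X by (intro mult_left_mono) auto
  also have "ennreal (v powr (b - 1)) * X \<le> ennreal \<kappa> * tail (\<lambda>s. tail f s \<up> (b - 1) * f s * indicator E s) t"
  proof -
    have "ennreal (v powr (b - 1)) * X = (\<integral>\<^sup>+ s. ennreal (v powr (b - 1)) * (f s * indicator (E - A) s * indicator {t<..} s) \<partial>lborel)"
      unfolding X_def tail_def by (subst nn_integral_cmult) auto
    also have "\<dots> \<le> (\<integral>\<^sup>+ s. ennreal \<kappa> * (tail f s \<up> (b - 1) * f s * indicator E s * indicator {t<..} s) \<partial>lborel)"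
      using low by (intro nn_integral_mono) (auto simp: indicator_def mult.assoc[symmetric] intro!: mult_right_mono)
    also have "\<dots> = ennreal \<kappa> * tail (\<lambda>s. tail f s \<up> (b - 1) * f s * indicator E s) t"
      unfolding tail_def[of _ t] by (subst nn_integral_cmult) auto
    finally show ?thesis .
  qed
  finally show ?thesis
    using \<kappa> by (simp add: \<kappa>_def ennreal_mult mult.assoc mult_left_mono)
qed

section \<open>Absorbing the far part\<close>

lemma SUP_min_of_nat:
  fixes x :: ennreal
  assumes "eventually P sequentially"
  shows "(SUP n. min x (of_nat n) * of_bool (P n)) = x"
proof (rule antisym)
  show "(SUP n. min x (of_nat n) * of_bool (P n)) \<le> x"
    by (intro SUP_least) auto
  obtain k where k: "P n" if "n \<ge> k" for n
    using assms by (auto simp: eventually_sequentially)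
  have le: "min x (of_nat n) \<le> (SUP n. min x (of_nat n) * of_bool (P n))" for n
    using k[of "max n k"]
    by (intro SUP_upper2[of "max n k"]) (auto simp: min_le_iff_disj of_nat_max max.coboundedI1)
  show "x \<le> (SUP n. min x (of_nat n) * of_bool (P n))"
  proof (cases "x = \<infinity>")
    case True
    then have "of_nat n \<le> (SUP n. min x (of_nat n) * of_bool (P n))" for n
      using le[of n] by (simp add: min_def top_unique split: if_splits)
    then have "top \<le> (SUP n. min x (of_nat n) * of_bool (P n))"
      unfolding ennreal_SUP_of_nat_eq_top[symmetric] by (intro SUP_least)
    then show ?thesis using order.trans[OF top_greatest] by blast
  next
    case False
    then obtain n where "x < of_nat n" using ennreal_Ex_less_of_nat less_top by auto
    then show ?thesis using le[of n] by (simp add: min_def less_imp_le)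
  qed
qed

lemma ennreal_half_absorb:
  fixes x y :: ennreal
  assumes "x \<le> ennreal (1/2) * x + y" "x < \<infinity>"
  shows "x \<le> 2 * y"
proof (cases y)
  case (real s)
  obtain r where "x = ennreal r" "r \<ge> 0" using assms(2) by (cases x) auto
  moreover have "ennreal (1/2) * ennreal r + ennreal s = ennreal (1/2 * r + s)"
    using \<open>r \<ge> 0\<close> real by (subst ennreal_plus) (auto simp: ennreal_mult[symmetric] simp del: ennreal_half)
  ultimately have "ennreal r \<le> ennreal (1/2 * r + s)" using assms(1) real by metis
  then have "r \<le> 2 * s" using \<open>r \<ge> 0\<close> real by (subst (asm) ennreal_le_iff) auto
  then have "ennreal r \<le> ennreal (2 * s)" by (rule ennreal_leI)
  then show ?thesis using \<open>x = ennreal r\<close> real by (simp add: ennreal_mult'')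
qed (simp add: ennreal_mult_top)

text \<open>The sublevel set S is an initial segment of the line whose right end may be infinite and
  need not belong to S. It is exhausted, up to a null set, by rays ending at points of S; the
  supremum is taken in \<open>ereal\<close> to cover an unbounded S.\<close>

lemma nn_integral_head_sublevel:
  assumes [measurable]: "w \<in> borel_measurable borel"
  shows "(\<integral>\<^sup>+ t. w t * indicator {t. head w t \<le> c} t \<partial>lborel) \<le> c"
proof (cases "{t. head w t \<le> c} = {}")
  case True
  then show ?thesis by simp
next
  case False
  define S where "S = {t. head w t \<le> c}"
  obtain f :: "nat \<Rightarrow> ereal" where f: "incseq f" "range f \<subseteq> ereal ` S" "Sup (ereal ` S) = (SUP i. f i)"
    using Sup_countable_SUP[of "ereal ` S"] False by (auto simp: S_def)
  define s where "s i = real_of_ereal (f i)" for i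
  have s: "f i = ereal (s i)" "s i \<in> S" for i
  proof -
    obtain z where "z \<in> S" "f i = ereal z" using f(2) by (auto simp: image_subset_iff image_iff)
    then show "f i = ereal (s i)" "s i \<in> S" by (simp_all add: s_def)
  qed
  have inc: "incseq s" using f(1) s by (simp add: incseq_def)
  have "AE t in lborel. w t * indicator S t \<le> (SUP i. w t * indicator {..<s i} t)"
  proof -
    have "AE t in lborel. ereal t \<noteq> Sup (ereal ` S)"
      using AE_lborel_singleton[of "real_of_ereal (Sup (ereal ` S))"] by eventually_elim (metis real_of_ereal.simps(1))
    then show ?thesis
    proof eventually_elim
      case (elim t)
      show ?case
      proof (cases "t \<in> S")
        case True
        then have "ereal t \<le> Sup (ereal ` S)" by (intro Sup_upper) auto
        with elim have "ereal t < (SUP i. f i)" using f(3) by auto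
        then obtain i where "t < s i" using s by (auto simp: less_SUP_iff)
        then show ?thesis by (intro SUP_upper2[of i]) (auto simp: indicator_def)
      qed auto
    qed
  qed
  then have "(\<integral>\<^sup>+ t. w t * indicator S t \<partial>lborel) \<le> (\<integral>\<^sup>+ t. (SUP i. w t * indicator {..<s i} t) \<partial>lborel)"
    by (rule nn_integral_mono_AE)
  also have "\<dots> = (SUP i. \<integral>\<^sup>+ t. w t * indicator {..<s i} t \<partial>lborel)"
    using inc by (intro nn_integral_monotone_convergence_SUP)
      (auto simp: incseq_def le_fun_def indicator_def intro: less_le_trans)
  also have "\<dots> \<le> c"
    using s(2) by (intro SUP_least) (simp add: S_def head_def)
  finally show ?thesis by (simp add: S_def)
qed

text \<open>The far part at \<open>t\<close> depends on \<open>t\<close> only through \<open>L * head w t\<close>, and \<open>w\<close> is carried to Lebesgue measure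
  by \<open>head w\<close>; scaling this measure yields the factor \<open>1 / L\<close>.\<close>

lemma far_part_le:
  fixes f w :: "real \<Rightarrow> ennreal"
  assumes [measurable]: "f \<in> borel_measurable borel" "w \<in> borel_measurable borel"
    and a: "a > 0" and L: "L \<ge> (1::real)" and n: "n < \<infinity>"
    and supp: "\<And>s. head w s > n \<Longrightarrow> f s = 0"
  shows "(\<integral>\<^sup>+ t. w t * tail (\<lambda>s. f s * indicator {y. ennreal L * head w t < y} (head w s)) t \<up> a \<partial>lborel)
    \<le> ennreal (1 / L) * (\<integral>\<^sup>+ t. w t * tail f t \<up> a \<partial>lborel)"
proof -
  \<comment> \<open>Since f lives on the set where \<open>head w\<close> is at most n, only this
    part of w matters. Its mass is at most n, hence finite, as the substitution requires.\<close>
  define g where "g = (\<lambda>t. w t * indicator {t. head w t \<le> n} t)"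
  have [measurable]: "g \<in> borel_measurable borel" unfolding g_def by measurable
  have fin: "(\<integral>\<^sup>+ t. g t \<partial>lborel) < \<infinity>"
    unfolding g_def using nn_integral_head_sublevel[of w n] n by (auto intro: le_less_trans)
  define M where "M = enn2real (\<integral>\<^sup>+ t. g t \<partial>lborel)"
  have M: "(\<integral>\<^sup>+ t. g t \<partial>lborel) = ennreal M" "M \<ge> 0"
    using fin by (simp_all add: M_def ennreal_enn2real)
  have head_eq: "head g t = head w t" if "head w t \<le> n" for t
    unfolding head_def[of _ t] g_def using that head_mono[of _ t w]
    by (intro nn_integral_cong) (auto simp: indicator_def dest: less_imp_le intro: order.trans)
  have head_le: "head g t \<le> ennreal M" for t
    unfolding M(1)[symmetric] head_def by (intro nn_integral_mono) (auto simp: indicator_def)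
  \<comment> \<open>The integral of f over the points whose level \<open>head w\<close> exceeds y
    depends on y alone. The strict inequality is split into two conditions, from which joint
    measurability in s and y follows.\<close>
  define \<psi> where "\<psi> y = (\<integral>\<^sup>+ s. f s * indicator {y..} (head w s) * indicator {z. z \<noteq> y} (head w s) \<partial>lborel) \<up> a" for y
  have ind: "indicator {y<..} z = (indicator {y..} z * indicator {z. z \<noteq> y} z :: ennreal)" for y z :: ennreal
    by (auto simp: indicator_def)
  have \<psi>_alt: "\<psi> y = (\<integral>\<^sup>+ s. f s * indicator {y<..} (head w s) \<partial>lborel) \<up> a" for y
    unfolding \<psi>_def ind by (simp add: mult.assoc)
  have [measurable]: "\<psi> \<in> borel_measurable borel"
    unfolding \<psi>_def indicator_def mem_Collect_eq atLeast_iff by measurable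
  have zero: "\<psi> y = 0" if "y \<ge> ennreal M" for y
  proof -
    have "f s * indicator {y<..} (head w s) = 0" for s
    proof (cases "head w s \<le> n")
      case True
      then have "head w s \<le> y" using head_le[of s] head_eq that by auto
      then show ?thesis by (simp add: indicator_def not_less)
    next
      case False
      then show ?thesis using supp[of s] by simp
    qed
    then show ?thesis unfolding \<psi>_alt using a by (simp only: epow_0_left nn_integral_0_iff_AE nn_integral_const mult_zero_left)
  qed
  have subst: "(\<integral>\<^sup>+ t. \<theta> (head g t) * g t \<partial>lborel) = (\<integral>\<^sup>+ x. \<theta> (ennreal x) * indicator {0<..<M} x \<partial>lborel)"
    if "\<theta> \<in> borel_measurable borel" for \<theta> :: "ennreal \<Rightarrow> ennreal"
    unfolding M_def head_def[of g] by (rule nn_integral_subst_left) (use fin that in auto)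
  have "(\<integral>\<^sup>+ t. w t * tail (\<lambda>s. f s * indicator {y. ennreal L * head w t < y} (head w s)) t \<up> a \<partial>lborel)
      \<le> (\<integral>\<^sup>+ t. \<psi> (ennreal L * head g t) * g t \<partial>lborel)"
  proof (rule nn_integral_mono, goal_cases)
    case (1 t)
    have le: "tail (\<lambda>s. f s * indicator {y. ennreal L * head w t < y} (head w s)) t \<up> a \<le> \<psi> (ennreal L * head w t)"
      unfolding \<psi>_alt tail_def using a by (intro epow_mono nn_integral_mono) (auto simp: indicator_def)
    show ?case
    proof (cases "head w t \<le> n")
      case True
      then show ?thesis using mult_left_mono[OF le, of "w t"] head_eq[OF True] by (simp add: g_def mult.commute)
    next
      case False
      then have "f s = 0" if "s > t" for s
        using supp[of s] head_mono[of t s w] that by auto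
      then have "tail (\<lambda>s. f s * indicator {y. ennreal L * head w t < y} (head w s)) t = tail (\<lambda>s. 0) t"
        by (intro tail_cong) simp
      then show ?thesis using a by (simp add: tail_def epow_0_left)
    qed
  qed
  also have "\<dots> = (\<integral>\<^sup>+ x. \<psi> (ennreal L * ennreal x) * indicator {0<..<M} x \<partial>lborel)"
    by (rule subst) measurable
  \<comment> \<open>Where L x >= M the function \<psi> vanishes at L x, so the range can be cut at L
    x < M; a linear substitution then produces 1/L.\<close>
  also have "\<dots> \<le> (\<integral>\<^sup>+ x. \<psi> (ennreal (L * x)) * indicator {0<..<M} (L * x) \<partial>lborel)"
  proof (rule nn_integral_mono, goal_cases)
    case (1 x)
    show ?case
    proof (cases "0 < x \<and> \<not> L * x < M")
      case True
      then have "\<psi> (ennreal L * ennreal x) = 0"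
        using L by (intro zero) (simp add: ennreal_mult[symmetric])
      then show ?thesis by simp
    next
      case False
      then show ?thesis using L by (auto simp: indicator_def ennreal_mult)
    qed
  qed
  also have "\<dots> = ennreal (1 / L) * (\<integral>\<^sup>+ x. \<psi> (ennreal x) * indicator {0<..<M} x \<partial>lborel)"
    using L by (subst (2) nn_integral_real_affine[where c=L and t=0])
      (auto simp: mult.assoc[symmetric] ennreal_mult[symmetric])
  also have "(\<integral>\<^sup>+ x. \<psi> (ennreal x) * indicator {0<..<M} x \<partial>lborel) = (\<integral>\<^sup>+ t. \<psi> (head g t) * g t \<partial>lborel)"
    by (rule subst[symmetric]) measurable
  also have "\<dots> \<le> (\<integral>\<^sup>+ t. w t * tail f t \<up> a \<partial>lborel)"
  proof (rule nn_integral_mono, goal_cases)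
    case (1 t)
    show ?case
    proof (cases "head w t \<le> n")
      case True
      \<comment> \<open>A level above \<open>head w t\<close> is attained only to the right of
        t.\<close>
      have "\<psi> (head w t) \<le> tail f t \<up> a"
        unfolding \<psi>_alt tail_def using a head_mono[of _ t w]
        by (intro epow_mono nn_integral_mono) (auto simp: indicator_def not_less[symmetric])
      then show ?thesis using head_eq[OF True] True by (simp add: g_def mult.commute[of _ "w t"] mult_left_mono)
    qed (simp add: g_def)
  qed
  finally show ?thesis by (simp add: mult_left_mono)
qed

text \<open>By (x+y)^a <= 2^a (x^a + y^a) and \<open>far_part_le\<close>, the far part costs at most
  2^a / L = 1/2 of the left side, which is absorbed; this fixes L. Absorption needs a finite left
  side, so f is truncated in value, support and level of \<open>head w\<close>. The truncations
  increase to f almost everywhere because f vanishes where \<open>head w\<close> is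
  infinite.\<close>

lemma near_part_dominates:
  fixes f w :: "real \<Rightarrow> ennreal"
  assumes [measurable]: "f \<in> borel_measurable borel" "w \<in> borel_measurable borel"
    and a: "a > 0"
    and supp: "AE s in lborel. head w s = \<infinity> \<longrightarrow> f s = 0"
  defines "L \<equiv> 2 * 2 powr a"
  shows "(\<integral>\<^sup>+ t. w t * tail f t \<up> a \<partial>lborel)
    \<le> ennreal L * (\<integral>\<^sup>+ t. w t * tail (\<lambda>s. f s * indicator {y. y \<le> ennreal L * head w t} (head w s)) t \<up> a \<partial>lborel)"
    (is "_ \<le> ennreal L * ?N f")
proof -
  have two: "2 \<up> a = ennreal (2 powr a)" using epow_ennreal[of 2 a] by simp
  have L: "L \<ge> 1" using a ge_one_powr_ge_zero[of 2 a] by (simp add: L_def)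
  define F where "F = (\<lambda>n s. min (f s) (of_nat n) * indicator {- real n<..<real n} s * indicator {y. y \<le> of_nat n} (head w s))"
  have [measurable]: "F n \<in> borel_measurable borel" for n
    unfolding F_def indicator_def mem_Collect_eq by measurable
  have F_le: "F n s \<le> f s" for n s by (auto simp: F_def indicator_def)
  have bound: "(\<integral>\<^sup>+ t. w t * tail (F n) t \<up> a \<partial>lborel) \<le> ennreal L * ?N f" for n
  proof -
    define I where "I = (\<integral>\<^sup>+ t. w t * tail (F n) t \<up> a \<partial>lborel)"
    have F0: "F n s = 0" if "head w s > of_nat n" for s using that by (simp add: F_def indicator_def not_le)
    have "I \<le> (\<integral>\<^sup>+ t. (of_nat n * ennreal (2 * n)) \<up> a * (w t * indicator {t. head w t \<le> of_nat n} t) \<partial>lborel)"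
      unfolding I_def
    proof (rule nn_integral_mono, goal_cases)
      case (1 t)
      have "tail (F n) t \<le> (\<integral>\<^sup>+ s. of_nat n * indicator {- real n<..<real n} s \<partial>lborel)"
        unfolding tail_def F_def by (intro nn_integral_mono) (auto simp: indicator_def)
      also have "\<dots> = of_nat n * ennreal (2 * n)" by (subst nn_integral_cmult) auto
      finally have le: "tail (F n) t \<up> a \<le> (of_nat n * ennreal (2 * n)) \<up> a" using a by (intro epow_mono) auto
      show ?case
      proof (cases "head w t \<le> of_nat n")
        case True
        then show ?thesis using mult_right_mono[OF le, of "w t"] by (simp add: mult.commute)
      next
        case False
        then have "F n s = 0" if "s > t" for s
          using F0[of s] head_mono[of t s w] that by auto
        then have "tail (F n) t = tail (\<lambda>s. 0) t" by (intro tail_cong) simp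
        then show ?thesis using a by (simp add: tail_def epow_0_left)
      qed
    qed
    also have "\<dots> \<le> (of_nat n * ennreal (2 * n)) \<up> a * of_nat n"
      by (subst nn_integral_cmult) (auto intro!: mult_left_mono nn_integral_head_sublevel)
    also have "\<dots> < \<infinity>"
      using a by (auto simp: ennreal_mult_less_top less_top[symmetric] epow_eq_top_iff ennreal_mult_eq_top_iff of_nat_less_top)
    finally have fin: "I < \<infinity>" .
    define far where "far = (\<lambda>t. tail (\<lambda>s. F n s * indicator {y. ennreal L * head w t < y} (head w s)) t)"
    define near where "near = (\<lambda>t. tail (\<lambda>s. F n s * indicator {y. y \<le> ennreal L * head w t} (head w s)) t)"
    have [measurable]: "far \<in> borel_measurable borel" "near \<in> borel_measurable borel"
      unfolding far_def near_def tail_def indicator_def mem_Collect_eq greaterThan_iff by measurable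
    have split: "tail (F n) t = far t + near t" for t
      unfolding far_def near_def tail_def indicator_def mem_Collect_eq
      by (subst nn_integral_add[symmetric]) (auto intro!: nn_integral_cong)
    have "I \<le> (\<integral>\<^sup>+ t. ennreal (2 powr a) * (w t * far t \<up> a) + ennreal (2 powr a) * (w t * near t \<up> a) \<partial>lborel)"
      unfolding I_def split
    proof (rule nn_integral_mono, goal_cases)
      case (1 t)
      have "w t * (far t + near t) \<up> a \<le> w t * (ennreal (2 powr a) * (far t \<up> a + near t \<up> a))"
        using epow_add_le[OF a] unfolding two by (intro mult_left_mono) auto
      also have "\<dots> = ennreal (2 powr a) * (w t * far t \<up> a) + ennreal (2 powr a) * (w t * near t \<up> a)"
        by (simp add: distrib_left mult_ac)
      finally show ?case .
    qed
    also have "\<dots> = ennreal (2 powr a) * (\<integral>\<^sup>+ t. w t * far t \<up> a \<partial>lborel) + ennreal (2 powr a) * (\<integral>\<^sup>+ t. w t * near t \<up> a \<partial>lborel)"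
      by (subst nn_integral_add) (auto simp: nn_integral_cmult)
    also have "(\<integral>\<^sup>+ t. w t * far t \<up> a \<partial>lborel) \<le> ennreal (1 / L) * I"
      unfolding I_def far_def
      by (rule far_part_le[where n="of_nat n"]) (use a L F0 in \<open>auto simp: of_nat_less_top\<close>)
    also have "ennreal (2 powr a) * (ennreal (1 / L) * I) = ennreal (1/2) * I"
      by (simp add: L_def mult.assoc[symmetric] ennreal_mult[symmetric])
    finally have "I \<le> ennreal (1/2) * I + ennreal (2 powr a) * (\<integral>\<^sup>+ t. w t * near t \<up> a \<partial>lborel)"
      by (simp add: add_right_mono mult_left_mono)
    then have "I \<le> 2 * (ennreal (2 powr a) * (\<integral>\<^sup>+ t. w t * near t \<up> a \<partial>lborel))"
      using fin by (rule ennreal_half_absorb)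
    also have "\<dots> = ennreal L * (\<integral>\<^sup>+ t. w t * near t \<up> a \<partial>lborel)"
      by (simp add: L_def ennreal_mult mult.assoc)
    also have "\<dots> \<le> ennreal L * ?N f"
      unfolding near_def using a
      by (intro mult_left_mono nn_integral_mono epow_mono tail_mono_fun mult_right_mono F_le) auto
    finally show ?thesis by (simp add: I_def)
  qed
  have incF: "F n s \<le> F (Suc n) s" for n s
    unfolding F_def by (intro mult_mono min.mono) (auto simp: indicator_def intro: order.trans)
  have SUP_F: "AE s in lborel. (SUP n. F n s) = f s"
    using supp
  proof eventually_elim
    case (elim s)
    show ?case
    proof (cases "head w s = \<infinity>")
      case True
      then show ?thesis using elim F_le[of _ s] by (auto intro!: antisym SUP_least)
    next
      case False
      then obtain k where k: "head w s < of_nat k" using ennreal_Ex_less_of_nat less_top by auto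
      obtain l where l: "\<bar>s\<bar> < real l" using reals_Archimedean2 by blast
      have "eventually (\<lambda>n. (- real n < s \<and> s < real n) \<and> head w s \<le> of_nat n) sequentially"
        unfolding eventually_sequentially
      proof (intro exI allI impI)
        fix n assume n: "max k l \<le> n"
        then have "head w s \<le> of_nat n" using order.trans[OF less_imp_le[OF k], of "of_nat n"] by simp
        then show "(- real n < s \<and> s < real n) \<and> head w s \<le> of_nat n"
          using n l by (auto simp: abs_less_iff)
      qed
      from SUP_min_of_nat[OF this, of "f s"] show ?thesis
        by (simp add: F_def indicator_def of_bool_conj mult.assoc)
    qed
  qed
  have "tail f t = (SUP n. tail (F n) t)" for t
  proof -
    have "tail f t = (\<integral>\<^sup>+ s. (SUP n. F n s * indicator {t<..} s) \<partial>lborel)"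
      unfolding tail_def
    proof (rule nn_integral_cong_AE, goal_cases)
      case 1
      show ?case
        using SUP_F by eventually_elim (simp add: SUP_mult_right_ennreal[symmetric])
    qed
    also have "\<dots> = (SUP n. tail (F n) t)"
      unfolding tail_def using incF
      by (intro nn_integral_monotone_convergence_SUP) (auto intro!: incseq_SucI le_funI mult_right_mono)
    finally show ?thesis .
  qed
  then have "(\<integral>\<^sup>+ t. w t * tail f t \<up> a \<partial>lborel) = (\<integral>\<^sup>+ t. (SUP n. w t * tail (F n) t \<up> a) \<partial>lborel)"
    using a by (simp add: epow_SUP SUP_mult_left_ennreal)
  also have "\<dots> = (SUP n. \<integral>\<^sup>+ t. w t * tail (F n) t \<up> a \<partial>lborel)"
    using incF a by (intro nn_integral_monotone_convergence_SUP)
      (auto intro!: incseq_SucI le_funI mult_left_mono epow_mono tail_mono_fun)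
  also have "\<dots> \<le> ennreal L * ?N f" using bound by (intro SUP_least)
  finally show ?thesis .
qed

section \<open>The upper bound for Borel weights\<close>

text \<open>Replacing \<open>tail h / tail \<sigma>\<close> by a monotone function at bounded cost in \<open>L\<^sup>p\<close> allows to
  treat all exponents \<open>m\<close> and \<open>q\<close> alike, whether or not they exceed \<open>1\<close>.\<close>

lemma Hardy_monotone_majorant:
  fixes \<sigma> g h :: "real \<Rightarrow> ennreal"
  assumes p: "p > (1::real)"
    and [measurable]: "\<sigma> \<in> borel_measurable borel" "g \<in> borel_measurable borel" "h \<in> borel_measurable borel"
    and fin: "\<And>t. t > 0 \<Longrightarrow> tail \<sigma> t < \<infinity>"
    and h: "AE s in lborel. s > 0 \<longrightarrow> h s \<le> g s \<up> (1 / p) * \<sigma> s \<up> (1 - 1 / p)"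
  shows "\<exists>P\<in>borel_measurable borel. (\<forall>s t. 0 < s \<longrightarrow> s \<le> t \<longrightarrow> P s \<le> P t) \<and>
    (\<forall>t>0. tail h t \<up> p \<le> ennreal (2 powr (p - 1)) * (tail \<sigma> t \<up> p * P t)) \<and>
    tail (\<lambda>s. P s * \<sigma> s) 0 \<le> ennreal (1 + 2 / (p - 1)) * tail g 0"
proof -
  \<comment> \<open>With this d the powers of \<open>tail \<sigma>\<close> cancel in Hoelder's
    inequality: the factor with g carries the exponent d, the factor with \<sigma> the exponent
    -1/2, and d/p = (1 - 1/p)/2.\<close>
  define d where "d = (p - 1) / 2"
  have d: "d > 0" using p by (simp add: d_def)
  let ?V = "tail \<sigma>"
  \<comment> \<open>Write V = \<open>tail \<sigma>\<close>. For fixed x the kernel grows in s like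
    V(s)^(-1-d) up to s = x, where it reaches 1/V(x), and stays constant afterwards. The part s < x
    carries the Hardy estimate, the constant part makes the kernel monotone, and the integral
    against \<sigma> remains at most 1 + 1/d = 1 + 2/(p-1).\<close>
  define k where "k = (\<lambda>x s. ?V x \<up> (- 1) * indicator {x..} s + ?V x \<up> d * ?V s \<up> (- 1 - d) * (indicator {s<..} x :: ennreal))"
  have [measurable]: "(\<lambda>z. k (fst z) (snd z)) \<in> borel_measurable (lborel \<Otimes>\<^sub>M lborel)"
    unfolding k_def indicator_def atLeast_iff greaterThan_iff by measurable
  have [measurable]: "(\<lambda>z. k (snd z) (fst z)) \<in> borel_measurable (lborel \<Otimes>\<^sub>M lborel)"
    unfolding k_def indicator_def atLeast_iff greaterThan_iff by measurable
  have [measurable]: "k x \<in> borel_measurable borel" for x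
    unfolding k_def indicator_def atLeast_iff greaterThan_iff by measurable
  have [measurable]: "(\<lambda>x. k x s) \<in> borel_measurable borel" for s
    unfolding k_def indicator_def atLeast_iff greaterThan_iff by measurable
  define P where "P = (\<lambda>s. \<integral>\<^sup>+ x. g x * indicator {0<..} x * k x s \<partial>lborel)"
  have P_meas[measurable]: "P \<in> borel_measurable borel"
    unfolding P_def k_def indicator_def atLeast_iff greaterThan_iff by measurable
  have kmono: "k x s \<le> k x t" if "0 < s" "s \<le> t" "0 < x" for x s t
  proof -
    consider "x \<le> s" | "s < x" "x \<le> t" | "t < x" by linarith
    then show ?thesis
    proof cases
      case 2
      then have Vle: "?V x \<le> ?V s" by (intro tail_antimono) simp
      have "?V x \<up> d * ?V s \<up> (- 1 - d) \<le> ?V x \<up> d * ?V x \<up> (- 1 - d)"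
        using Vle d by (intro mult_left_mono epow_antimono) auto
      also have "\<dots> \<le> ?V x \<up> (- 1)"
      proof (cases "?V x = 0")
        case True
        then show ?thesis using d by (simp add: epow_0_left)
      next
        case False
        then show ?thesis using epow_add_finite[of "?V x" d "- 1 - d"] fin[OF that(3)]
          by (simp add: zero_less_iff_neq_zero)
      qed
      finally show ?thesis using 2 by (simp add: k_def indicator_def)
    next
      case 3
      then show ?thesis using that d
        by (auto simp: k_def indicator_def intro!: mult_left_mono epow_antimono tail_antimono)
    qed (use that in \<open>auto simp: k_def indicator_def\<close>)
  qed
  have P_mono: "P s \<le> P t" if "0 < s" "s \<le> t" for s t
    unfolding P_def using kmono[OF that]
    by (intro nn_integral_mono) (auto simp: indicator_def intro!: mult_left_mono)
  have P_low: "?V t \<up> (- 1 - d) * tail (\<lambda>s. g s * ?V s \<up> d) t \<le> P t" if "t > 0" for t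
  proof -
    have "?V t \<up> (- 1 - d) * tail (\<lambda>s. g s * ?V s \<up> d) t
        = (\<integral>\<^sup>+ s. ?V t \<up> (- 1 - d) * (g s * ?V s \<up> d * indicator {t<..} s) \<partial>lborel)"
      unfolding tail_def[of _ t] by (subst nn_integral_cmult) auto
    also have "\<dots> \<le> P t"
      unfolding P_def using that
      by (intro nn_integral_mono) (auto simp: k_def indicator_def mult_ac)
    finally show ?thesis .
  qed
  have H: "tail h t \<up> p \<le> ennreal (2 powr (p - 1)) * (?V t \<up> p * P t)" if t: "t > 0" for t
  proof -
    have q: "1 - 1 / p > 0" "1 / p > 0" "1 / p + (1 - 1 / p) = 1" using p by auto
    have "tail h t \<le> (\<integral>\<^sup>+ s. (g s * ?V s \<up> d * indicator {t<..} s) \<up> (1/p)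
        * (?V s \<up> (1/2 - 1) * \<sigma> s * indicator {t<..} s) \<up> (1 - 1/p) \<partial>lborel)"
      unfolding tail_def[of h]
    proof (rule nn_integral_mono_AE, goal_cases)
      case 1
      show ?case
        using h AE_tail_eq_0[OF assms(2) fin[OF t]]
      proof eventually_elim
        case (elim s)
        show ?case
        proof (cases "s > t")
          case s: True
          show ?thesis
          proof (cases "?V s = 0")
            case True
            then have "h s = 0" using elim s t q by (auto simp: epow_0_left)
            then show ?thesis by simp
          next
            case False
            have fin_s: "?V s < \<infinity>" using fin s t by auto
            have "(?V s \<up> d) \<up> (1/p) * (?V s \<up> (1/2 - 1)) \<up> (1 - 1/p) = ?V s \<up> (d * (1/p) + (1/2 - 1) * (1 - 1/p))"
              unfolding epow_mult_exp[symmetric]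
              by (rule epow_add_finite[symmetric]) (use False fin_s in \<open>auto simp: zero_less_iff_neq_zero\<close>)
            also have "d * (1/p) + (1/2 - 1) * (1 - 1/p) = 0" using p by (simp add: d_def field_simps)
            finally have one: "(?V s \<up> d) \<up> (1/p) * (?V s \<up> (1/2 - 1)) \<up> (1 - 1/p) = 1" by simp
            have "h s \<le> g s \<up> (1/p) * \<sigma> s \<up> (1 - 1/p) * ((?V s \<up> d) \<up> (1/p) * (?V s \<up> (1/2 - 1)) \<up> (1 - 1/p))"
              unfolding one using elim s t by simp
            then show ?thesis using s q by (simp add: epow_mult mult_ac)
          qed
        qed simp
      qed
    qed
    also have "\<dots> \<le> tail (\<lambda>s. g s * ?V s \<up> d) t \<up> (1/p) * tail (\<lambda>s. ?V s \<up> (1/2 - 1) * \<sigma> s) t \<up> (1 - 1/p)"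
      unfolding tail_def[of _ t] by (rule nn_integral_Holder) (use q in auto)
    also have "tail (\<lambda>s. ?V s \<up> (1/2 - 1) * \<sigma> s) t = ennreal 2 * ?V t \<up> (1/2)"
      by (subst tail_power) (use fin t in auto)
    finally have "tail h t \<up> p \<le> (tail (\<lambda>s. g s * ?V s \<up> d) t \<up> (1/p) * (ennreal 2 * ?V t \<up> (1/2)) \<up> (1 - 1/p)) \<up> p"
      using p by (intro epow_mono) auto
    also have "\<dots> = tail (\<lambda>s. g s * ?V s \<up> d) t * (ennreal 2 * ?V t \<up> (1/2)) \<up> (p - 1)"
      using p by (simp add: epow_mult epow_mult_exp[symmetric] left_diff_distrib)
    also have "\<dots> = ennreal (2 powr (p - 1)) * (?V t \<up> d * tail (\<lambda>s. g s * ?V s \<up> d) t)"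
      using p epow_ennreal[of 2 "p - 1"] by (simp add: epow_mult epow_mult_exp[symmetric] d_def mult_ac)
    also have "?V t \<up> d * tail (\<lambda>s. g s * ?V s \<up> d) t \<le> ?V t \<up> p * P t"
    proof (cases "?V t = 0")
      case True
      then show ?thesis using d by (simp add: epow_0_left)
    next
      case False
      then have "?V t \<up> d = ?V t \<up> (p + (- 1 - d))" by (simp add: d_def field_simps)
      also have "\<dots> = ?V t \<up> p * ?V t \<up> (- 1 - d)"
        using False fin[OF t] by (intro epow_add_finite) (auto simp: zero_less_iff_neq_zero)
      finally show ?thesis using P_low[OF t] by (simp add: mult.assoc mult_left_mono)
    qed
    finally show ?thesis by (simp add: mult_left_mono)
  qed
  have "tail (\<lambda>s. P s * \<sigma> s) 0 = (\<integral>\<^sup>+ s. (\<integral>\<^sup>+ x. g x * indicator {0<..} x * k x s * (\<sigma> s * indicator {0<..} s) \<partial>lborel) \<partial>lborel)"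
    unfolding tail_def[of _ 0] P_def by (intro nn_integral_cong) (simp add: nn_integral_multc[symmetric] mult.assoc)
  also have "\<dots> = (\<integral>\<^sup>+ x. (\<integral>\<^sup>+ s. g x * indicator {0<..} x * k x s * (\<sigma> s * indicator {0<..} s) \<partial>lborel) \<partial>lborel)"
    by (rule lborel_pair.Fubini') (simp add: case_prod_beta)
  also have "\<dots> = (\<integral>\<^sup>+ x. g x * indicator {0<..} x * (\<integral>\<^sup>+ s. k x s * (\<sigma> s * indicator {0<..} s) \<partial>lborel) \<partial>lborel)"
    by (intro nn_integral_cong) (simp add: nn_integral_cmult[symmetric] mult.assoc)
  also have "\<dots> \<le> (\<integral>\<^sup>+ x. g x * indicator {0<..} x * ennreal (1 + 1 / d) \<partial>lborel)"
  proof (rule nn_integral_mono, goal_cases)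
    case (1 x)
    show ?case
    proof (cases "x > 0")
      case x: True
      have "(\<integral>\<^sup>+ s. k x s * (\<sigma> s * indicator {0<..} s) \<partial>lborel)
        = (\<integral>\<^sup>+ s. ?V x \<up> (- 1) * (\<sigma> s * indicator {x<..} s) + ?V x \<up> d * (?V s \<up> (- 1 - d) * \<sigma> s * indicator {0<..<x} s) \<partial>lborel)"
      proof (rule nn_integral_cong_AE, goal_cases)
        case 1
        show ?case
          using AE_lborel_singleton[of x]
          by eventually_elim (use x in \<open>auto simp: k_def indicator_def mult_ac\<close>)
      qed
      also have "\<dots> = ?V x \<up> (- 1) * ?V x + ?V x \<up> d * (\<integral>\<^sup>+ s. ?V s \<up> (- 1 - d) * \<sigma> s * indicator {0<..<x} s \<partial>lborel)"
        unfolding tail_def[of \<sigma> x] by (subst nn_integral_add) (auto simp: nn_integral_cmult)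
      also have "\<dots> \<le> 1 + ?V x \<up> d * (ennreal (1 / d) * ?V x \<up> (- d))"
        using d by (intro add_mono mult_left_mono epow_pow_minus_one tail_negative_power fin) auto
      also have "?V x \<up> d * (ennreal (1 / d) * ?V x \<up> (- d)) \<le> ennreal (1 / d)"
      proof (cases "?V x = 0")
        case True
        then show ?thesis using d by (simp add: epow_0_left)
      next
        case False
        then have "?V x \<up> d * ?V x \<up> (- d) = 1"
          using epow_add_finite[of "?V x" d "- d"] fin[OF x] by (simp add: zero_less_iff_neq_zero)
        then show ?thesis by (metis mult.left_commute mult.right_neutral order_refl)
      qed
      also have "1 + ennreal (1 / d) = ennreal (1 + 1 / d)" using d by simp
      finally show ?thesis by (simp add: add_left_mono mult_left_mono)
    qed simp
  qed
  also have "\<dots> = ennreal (1 + 2 / (p - 1)) * tail g 0"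
    unfolding tail_def by (subst nn_integral_multc) (auto simp: d_def mult.commute)
  finally show ?thesis
    using P_meas P_mono H by blast
qed

section \<open>Splitting the inner integral along a set E\<close>

definition halving_const :: "real \<Rightarrow> real" where
  "halving_const b = 4 * max 1 (4 powr (b - 1))"

lemma halving_const_pos: "halving_const b > 0"
  by (simp add: halving_const_def)

definition split_const :: "real \<Rightarrow> real \<Rightarrow> real" where
  "split_const m q = max (halving_const m) (halving_const q powr (m / q))"

lemma split_const_pos: "split_const m q > 0"
  using halving_const_pos[of m] by (simp add: split_const_def)

text \<open>Up to sign and the factor b, this is the differential of V^b for V =
  \<open>tail \<sigma>\<close>, weighted by P^(b/p) and restricted to E. In the upper bound b = m on
  the near set and b = q on its complement.\<close>

abbreviation block :: "real \<Rightarrow> real \<Rightarrow> (real \<Rightarrow> ennreal) \<Rightarrow> (real \<Rightarrow> ennreal) \<Rightarrow> real set \<Rightarrow> real \<Rightarrow> ennreal" where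
  "block b p P \<sigma> E z \<equiv> P z \<up> (b / p) * (tail \<sigma> z \<up> (b - 1) * \<sigma> z * indicator E z)"

text \<open>The inner integral of \<open>A5\<close>.\<close>

abbreviation kernel_tail :: "real \<Rightarrow> real \<Rightarrow> (real \<Rightarrow> ennreal) \<Rightarrow> (real \<Rightarrow> ennreal) \<Rightarrow> real \<Rightarrow> ennreal" where
  "kernel_tail m p u \<sigma> t \<equiv> tail (\<lambda>s. mid u t s \<up> (p / (p - m)) * tail \<sigma> s \<up> (p * (m - 1) / (p - m)) * \<sigma> s) t"

abbreviation near_set :: "(real \<Rightarrow> ennreal) \<Rightarrow> real \<Rightarrow> real \<Rightarrow> real set" where
  "near_set w L t \<equiv> {s. head w s \<le> ennreal L * head w t}"

text \<open>Either E or its complement carries at least half of the mass of \<sigma> beyond s, and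
  the monotonicity of P moves P(s) under the integral. The complement is treated with exponent q and
  the result raised to m/q: the later power q/m then leaves a plain integral, which can be exchanged
  with the one in t.\<close>

lemma monotone_tail_split:
  fixes P \<sigma> :: "real \<Rightarrow> ennreal"
  assumes m: "m > 0" and q: "q > 0" and p: "p > 0"
    and [measurable]: "P \<in> borel_measurable borel" "\<sigma> \<in> borel_measurable borel" "E \<in> sets borel"
    and P_mono: "\<And>s t. 0 < s \<Longrightarrow> s \<le> t \<Longrightarrow> P s \<le> P t"
    and s: "s > 0" and fin: "tail \<sigma> s < \<infinity>"
  shows "P s \<up> (m / p) * tail \<sigma> s \<up> m \<le> ennreal (split_const m q) *
    (tail (block m p P \<sigma> E) s
     + tail (block q p P \<sigma> (- E)) s \<up> (m / q))"
proof -
  have step: "P s \<up> (b / p) * tail \<sigma> s \<up> b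
      \<le> ennreal (halving_const b) * tail (block b p P \<sigma> A) s"
    if b: "b > 0" and A[measurable]: "A \<in> sets borel" and half: "tail \<sigma> s \<le> 2 * tail (\<lambda>s. \<sigma> s * indicator A s) s" for b A
  proof -
    have "P s \<up> (b / p) * tail \<sigma> s \<up> b
        \<le> P s \<up> (b / p) * (ennreal (halving_const b) * tail (\<lambda>z. tail \<sigma> z \<up> (b - 1) * \<sigma> z * indicator A z) s)"
      unfolding halving_const_def using b half fin by (intro mult_left_mono tail_power_le_restrict) auto
    also have "\<dots> = ennreal (halving_const b) * tail (\<lambda>z. P s \<up> (b / p) * (tail \<sigma> z \<up> (b - 1) * \<sigma> z * indicator A z)) s"
      unfolding tail_def[of _ s] by (subst mult.left_commute, subst nn_integral_cmult[symmetric]) (auto simp: mult.assoc)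
    also have "\<dots> \<le> ennreal (halving_const b) * tail (block b p P \<sigma> A) s"
      using b p s P_mono by (intro mult_left_mono tail_mono_fun mult_right_mono epow_mono) auto
    finally show ?thesis .
  qed
  have sum: "tail \<sigma> s = tail (\<lambda>s. \<sigma> s * indicator E s) s + tail (\<lambda>s. \<sigma> s * indicator (- E) s) s"
    unfolding tail_def by (subst nn_integral_add[symmetric]) (auto intro!: nn_integral_cong simp: indicator_def)
  consider "tail \<sigma> s \<le> 2 * tail (\<lambda>s. \<sigma> s * indicator E s) s" | "tail \<sigma> s \<le> 2 * tail (\<lambda>s. \<sigma> s * indicator (- E) s) s"
    unfolding sum by (cases "tail (\<lambda>s. \<sigma> s * indicator E s) s \<le> tail (\<lambda>s. \<sigma> s * indicator (- E) s) s")
      (auto simp: mult_2 add_mono)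
  then show ?thesis
  proof cases
    case 1
    show ?thesis
      by (rule order.trans[OF step[OF m assms(6) 1]])
        (auto intro!: mult_mono ennreal_leI simp: split_const_def)
  next
    case 2
    have "P s \<up> (m / p) * tail \<sigma> s \<up> m = (P s \<up> (q / p) * tail \<sigma> s \<up> q) \<up> (m / q)"
      using m q by (simp add: epow_mult epow_mult_exp[symmetric])
    also have "\<dots> \<le> (ennreal (halving_const q) * tail (block q p P \<sigma> (- E)) s) \<up> (m / q)"
      using m q by (intro epow_mono step[OF q _ 2]) auto
    also have "\<dots> = ennreal (halving_const q powr (m / q)) * tail (block q p P \<sigma> (- E)) s \<up> (m / q)"
      using m q by (simp add: epow_mult epow_ennreal halving_const_pos)
    finally show ?thesis
      by (elim order.trans) (auto intro!: mult_mono ennreal_leI simp: split_const_def)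
  qed
qed

lemma tail_double_le:
  fixes X :: "real \<Rightarrow> ennreal" and u :: "real \<Rightarrow> ennreal"
  assumes [measurable]: "X \<in> borel_measurable borel" "u \<in> borel_measurable borel"
  shows "tail (\<lambda>s. u s * tail X s) t \<le> tail (\<lambda>z. X z * mid u t z) t"
proof -
  have "tail (\<lambda>s. u s * tail X s) t
      = (\<integral>\<^sup>+ s. (\<integral>\<^sup>+ z. u s * X z * indicator {s<..} z * indicator {t<..} s \<partial>lborel) \<partial>lborel)"
    unfolding tail_def by (intro nn_integral_cong) (simp add: nn_integral_cmult[symmetric] nn_integral_multc[symmetric] mult.assoc)
  also have "\<dots> = (\<integral>\<^sup>+ z. (\<integral>\<^sup>+ s. u s * X z * indicator {s<..} z * indicator {t<..} s \<partial>lborel) \<partial>lborel)"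
    by (rule lborel_pair.Fubini') (simp add: case_prod_beta)
  also have "\<dots> \<le> (\<integral>\<^sup>+ z. X z * mid u t z * indicator {t<..} z \<partial>lborel)"
  proof (rule nn_integral_mono, goal_cases)
    case (1 z)
    have "(\<integral>\<^sup>+ s. u s * X z * indicator {s<..} z * indicator {t<..} s \<partial>lborel)
        \<le> (\<integral>\<^sup>+ s. (X z * indicator {t<..} z) * (u s * indicator {t<..<z} s) \<partial>lborel)"
      by (intro nn_integral_mono) (auto simp: indicator_def mult.commute)
    also have "\<dots> = X z * mid u t z * indicator {t<..} z"
      unfolding mid_def by (subst nn_integral_cmult) (auto simp: mult_ac)
    finally show ?case .
  qed
  finally show ?thesis unfolding tail_def[of _ t] .
qed

text \<open>Integration of \<open>monotone_tail_split\<close> against u on E. In the first term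
  Fubini's theorem produces \<open>mid u t z\<close>; in the second the tail from s is enlarged to
  the tail from t and becomes a constant factor.\<close>

lemma kernel_split:
  fixes P \<sigma> u :: "real \<Rightarrow> ennreal"
  assumes m: "m > 0" and q: "q > 0" and p: "p > 0"
    and [measurable]: "P \<in> borel_measurable borel" "\<sigma> \<in> borel_measurable borel" "u \<in> borel_measurable borel" "E \<in> sets borel"
    and P_mono: "\<And>s t. 0 < s \<Longrightarrow> s \<le> t \<Longrightarrow> P s \<le> P t"
    and t: "t > 0" and fin: "\<And>s. s > 0 \<Longrightarrow> tail \<sigma> s < \<infinity>"
  shows "tail (\<lambda>s. P s \<up> (m / p) * tail \<sigma> s \<up> m * u s * indicator E s) t \<le> ennreal (split_const m q) *
    (tail (\<lambda>z. block m p P \<sigma> E z * mid u t z) t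
     + tail (\<lambda>s. u s * indicator E s) t
       * tail (block q p P \<sigma> (- E)) t \<up> (m / q))"
proof -
  define X where "X = (block m p P \<sigma> E)"
  define Y where "Y = (block q p P \<sigma> (- E))"
  define c where "c = ennreal (split_const m q)"
  have [measurable]: "X \<in> borel_measurable borel" "Y \<in> borel_measurable borel"
    unfolding X_def Y_def by measurable
  have "tail (\<lambda>s. P s \<up> (m / p) * tail \<sigma> s \<up> m * u s * indicator E s) t
      \<le> tail (\<lambda>s. c * (u s * tail X s + (u s * indicator E s) * tail Y t \<up> (m / q))) t"
  proof (rule tail_mono_fun, goal_cases)
    case (1 s)
    note s = 1
    have "P s \<up> (m / p) * tail \<sigma> s \<up> m \<le> c * (tail X s + tail Y s \<up> (m / q))"
      unfolding c_def X_def Y_def using assms s by (intro monotone_tail_split) auto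
    also have "\<dots> \<le> c * (tail X s + tail Y t \<up> (m / q))"
      using s m q by (intro mult_left_mono add_left_mono epow_mono tail_antimono) auto
    finally have "P s \<up> (m / p) * tail \<sigma> s \<up> m * (u s * indicator E s)
        \<le> c * (tail X s + tail Y t \<up> (m / q)) * (u s * indicator E s)" by (rule mult_right_mono) simp
    also have "\<dots> \<le> c * (u s * tail X s + (u s * indicator E s) * tail Y t \<up> (m / q))"
      by (auto simp: indicator_def algebra_simps)
    finally show ?case by (simp add: mult.assoc)
  qed
  also have "\<dots> = c * (tail (\<lambda>s. u s * tail X s) t + tail (\<lambda>s. u s * indicator E s) t * tail Y t \<up> (m / q))"
    unfolding tail_def[of _ t]
    by (simp add: nn_integral_cmult[symmetric] nn_integral_multc[symmetric] nn_integral_add[symmetric] algebra_simps)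
  also have "\<dots> \<le> c * (tail (\<lambda>z. X z * mid u t z) t + tail (\<lambda>s. u s * indicator E s) t * tail Y t \<up> (m / q))"
    by (intro mult_left_mono add_right_mono tail_double_le) auto
  finally show ?thesis unfolding X_def Y_def c_def .
qed

text \<open>Hoelder's inequality with exponents m/p and (p-m)/p separates P from the kernel. The
  density \<sigma> is shared between both factors, and the remaining power m - 1 of
  \<open>tail \<sigma>\<close> goes to the second, which explains the exponents of
  \<open>A5\<close>.\<close>

lemma tail_Holder_kernel:
  fixes P \<sigma> u :: "real \<Rightarrow> ennreal"
  assumes m: "0 < m" "m < p"
    and [measurable]: "P \<in> borel_measurable borel" "\<sigma> \<in> borel_measurable borel" "u \<in> borel_measurable borel" "E \<in> sets borel"
  shows "tail (\<lambda>z. block m p P \<sigma> E z * mid u t z) t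
    \<le> tail (\<lambda>z. P z * \<sigma> z * indicator E z) t \<up> (m / p)
      * tail (\<lambda>z. mid u t z \<up> (p / (p - m)) * tail \<sigma> z \<up> (p * (m - 1) / (p - m)) * \<sigma> z) t \<up> ((p - m) / p)"
proof -
  have ex: "0 < m / p" "0 < (p - m) / p" "m / p + (p - m) / p = 1" using m by (auto simp: field_simps)
  have "tail (\<lambda>z. block m p P \<sigma> E z * mid u t z) t
    = (\<integral>\<^sup>+ z. (P z * \<sigma> z * indicator E z * indicator {t<..} z) \<up> (m / p)
      * (mid u t z \<up> (p / (p - m)) * tail \<sigma> z \<up> (p * (m - 1) / (p - m)) * \<sigma> z * indicator {t<..} z) \<up> ((p - m) / p) \<partial>lborel)"
    unfolding tail_def[of _ t]
  proof (rule nn_integral_cong, goal_cases)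
    case (1 z)
    have "\<sigma> z = \<sigma> z \<up> (m / p) * \<sigma> z \<up> ((p - m) / p)"
      using epow_add[of "m / p" "(p - m) / p" "\<sigma> z"] ex by simp
    then have "block m p P \<sigma> E z * mid u t z * indicator {t<..} z
      = P z \<up> (m / p) * (tail \<sigma> z \<up> (m - 1) * (\<sigma> z \<up> (m / p) * \<sigma> z \<up> ((p - m) / p)) * indicator E z) * mid u t z * indicator {t<..} z"
      by simp
    also have "\<dots> = (P z * \<sigma> z * indicator E z * indicator {t<..} z) \<up> (m / p)
      * (mid u t z \<up> (p / (p - m)) * tail \<sigma> z \<up> (p * (m - 1) / (p - m)) * \<sigma> z * indicator {t<..} z) \<up> ((p - m) / p)"
      using m ex by (auto simp: epow_mult epow_mult_exp[symmetric] epow_0_left mult_ac indicator_def)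
    finally show ?case .
  qed
  also have "\<dots> \<le> tail (\<lambda>z. P z * \<sigma> z * indicator E z) t \<up> (m / p)
      * tail (\<lambda>z. mid u t z \<up> (p / (p - m)) * tail \<sigma> z \<up> (p * (m - 1) / (p - m)) * \<sigma> z) t \<up> ((p - m) / p)"
    unfolding tail_def[of _ t] by (rule nn_integral_Holder) (use ex in auto)
  finally show ?thesis .
qed

section \<open>The near term and the far term\<close>

lemma epow_minus_one_le:
  assumes "y \<le> ennreal L * x" "L \<ge> 1"
  shows "x \<up> (- 1) \<le> ennreal L * y \<up> (- 1)"
proof (cases x rule: ennreal_cases3)
  case zero
  then show ?thesis using assms by (auto simp: epow_def ennreal_mult_top)
next
  case top
  then show ?thesis by (simp add: epow_def)
next
  case (real r)
  show ?thesis
  proof (cases y rule: ennreal_cases3)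
    case zero
    then show ?thesis using assms by (auto simp: epow_def ennreal_mult_top)
  next
    case top
    then show ?thesis using assms real by (auto simp: top_unique ennreal_mult_eq_top_iff)
  next
    case y: (real s)
    then have "s \<le> L * r" using assms real by (simp add: ennreal_mult[symmetric])
    then show ?thesis using y real assms
      by (simp add: epow_ennreal ennreal_mult[symmetric] powr_minus field_simps)
  qed
qed

text \<open>Because \<Phi>(t) >= W(t0) U(t0,t)^a. Admissibility does not force W to be finite, but u
  must vanish almost everywhere once W is infinite.\<close>

lemma mid_eq_0_if_head_infinite:
  assumes [measurable]: "u \<in> borel_measurable borel" "w \<in> borel_measurable borel"
    and a: "a > 0" and \<Phi>: "head (\<lambda>s. w s * mid u s t \<up> a) t < \<infinity>"
    and inf: "head w t0 = \<infinity>" "t0 < t"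
  shows "mid u t0 t = 0"
proof (rule ccontr)
  assume "mid u t0 t \<noteq> 0"
  then have "mid u t0 t \<up> a \<noteq> 0" using a by (simp add: epow_eq_0_iff)
  then have "\<infinity> = head w t0 * mid u t0 t \<up> a" using inf by (simp add: ennreal_top_mult)
  also have "\<dots> = (\<integral>\<^sup>+ s. w s * indicator {..<t0} s * mid u t0 t \<up> a \<partial>lborel)"
    unfolding head_def by (subst nn_integral_multc) auto
  also have "\<dots> \<le> head (\<lambda>s. w s * mid u s t \<up> a) t"
    unfolding head_def using inf a
    by (intro nn_integral_mono) (auto simp: indicator_def intro!: mult_left_mono epow_mono mid_mono)
  finally show False using \<Phi> by (simp add: top_unique)
qed

text \<open>The set Z is closed upwards. Each of its points except possibly Inf Z lies beyond a
  rational point r of Z, and u vanishes almost everywhere on every interval (r,n); countably many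
  intervals suffice. This supplies the support condition of
  \<open>near_part_dominates\<close>.\<close>

lemma AE_eq_0_if_head_infinite:
  assumes [measurable]: "u \<in> borel_measurable borel" "w \<in> borel_measurable borel"
    and a: "a > 0" and \<Phi>: "\<And>t. t > 0 \<Longrightarrow> head (\<lambda>s. w s * mid u s t \<up> a) t < \<infinity>"
    and w0: "\<And>s. s \<le> 0 \<Longrightarrow> w s = 0"
  shows "AE s in lborel. head w s = \<infinity> \<longrightarrow> u s = 0"
proof -
  define Z where "Z = {s. head w s = \<infinity>}"
  have Z0: "s > 0" if "s \<in> Z" for s
  proof (rule ccontr)
    assume "\<not> s > 0"
    then have "head w s = head (\<lambda>_. 0) s" unfolding head_def
      using w0 by (intro nn_integral_cong) (auto simp: indicator_def)
    then show False using that by (simp add: Z_def head_def)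
  qed
  have Zup: "t \<in> Z" if "s \<in> Z" "s \<le> t" for s t
    using that head_mono[of s t w] by (simp add: Z_def top_unique)
  have "AE s in lborel. of_rat r \<in> Z \<longrightarrow> u s * indicator {of_rat r<..<real n} s = 0" for r :: rat and n :: nat
  proof (cases "of_rat r \<in> Z")
    case rZ: True
    have "mid u (of_rat r) (real n) = 0"
    proof (cases "of_rat r < real n")
      case True
      then show ?thesis using rZ less_trans[OF Z0[OF rZ] True]
        by (intro mid_eq_0_if_head_infinite[OF assms(1,2) a \<Phi>]) (auto simp: Z_def)
    next
      case False
      then have "{of_rat r<..<real n} = {}" by auto
      then show ?thesis by (simp add: mid_def)
    qed
    then have "AE s in lborel. u s * indicator {of_rat r<..<real n} s = 0"
      unfolding mid_def by (subst (asm) nn_integral_0_iff_AE) auto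
    then show ?thesis by eventually_elim simp
  qed simp
  then have "AE s in lborel. \<forall>r n. of_rat r \<in> Z \<longrightarrow> u s * indicator {of_rat r<..<real n} s = 0"
    by (simp only: AE_all_countable) simp
  then show ?thesis
    using AE_lborel_singleton[of "Inf Z"]
  proof eventually_elim
    case (elim s)
    show ?case
    proof
      assume "head w s = \<infinity>"
      then have s: "s \<in> Z" by (simp add: Z_def)
      have "\<exists>z\<in>Z. z < s"
      proof (rule ccontr)
        assume "\<not> (\<exists>z\<in>Z. z < s)"
        then have "Inf Z = s" using s by (intro cInf_eq_minimum) (auto simp: not_less)
        then show False using elim by simp
      qed
      then obtain z where z: "z \<in> Z" "z < s" by blast
      then obtain r where r: "z < of_rat r" "of_rat r < s" using of_rat_dense by blast
      obtain n where "s < real n" using reals_Archimedean2 by blast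
      then show "u s = 0" using elim(1)[rule_format, of r n] r Zup[OF z(1), of "of_rat r"] by simp
    qed
  qed
qed

text \<open>After exchanging the integrals, 1/W(t) <= L/W(z) for z near t, while w integrates to
  W(z) over t < z. Without the restriction to near z the integral of w/W could diverge.\<close>

lemma nn_integral_near_average_le:
  fixes w X :: "real \<Rightarrow> ennreal"
  assumes [measurable]: "w \<in> borel_measurable borel" "X \<in> borel_measurable borel"
    and L: "L \<ge> (1::real)" and w0: "\<And>s. s \<le> 0 \<Longrightarrow> w s = 0"
  shows "(\<integral>\<^sup>+ t. w t * head w t \<up> (- 1) * tail (\<lambda>z. X z * indicator (near_set w L t) z) t \<partial>lborel)
    \<le> ennreal L * tail X 0"
proof -
  let ?f = "\<lambda>t z. w t * head w t \<up> (- 1) * (X z * indicator (near_set w L t) z * indicator {t<..} z)"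
  have "(\<integral>\<^sup>+ t. w t * head w t \<up> (- 1) * tail (\<lambda>z. X z * indicator (near_set w L t) z) t \<partial>lborel)
    = (\<integral>\<^sup>+ t. (\<integral>\<^sup>+ z. ?f t z \<partial>lborel) \<partial>lborel)"
    unfolding tail_def by (intro nn_integral_cong nn_integral_cmult[symmetric]) auto
  also have "\<dots> = (\<integral>\<^sup>+ z. (\<integral>\<^sup>+ t. ?f t z \<partial>lborel) \<partial>lborel)"
    by (rule lborel_pair.Fubini') (simp add: case_prod_beta indicator_def)
  also have "\<dots> \<le> (\<integral>\<^sup>+ z. ennreal L * (X z * indicator {0<..} z) \<partial>lborel)"
  proof (rule nn_integral_mono, goal_cases)
    case (1 z)
    have "(\<integral>\<^sup>+ t. ?f t z \<partial>lborel) \<le> (\<integral>\<^sup>+ t. (ennreal L * (X z * indicator {0<..} z) * head w z \<up> (- 1)) * (w t * indicator {..<z} t) \<partial>lborel)"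
    proof (rule nn_integral_mono, goal_cases)
      case (1 t)
      show ?case
      proof (cases "t > 0 \<and> t < z \<and> head w z \<le> ennreal L * head w t")
        case True
        then have "head w t \<up> (- 1) \<le> ennreal L * head w z \<up> (- 1)"
          using L by (intro epow_minus_one_le) auto
        then have "head w t \<up> (- 1) * (w t * X z) \<le> ennreal L * head w z \<up> (- 1) * (w t * X z)"
          by (rule mult_right_mono) simp
        then show ?thesis using True by (simp add: mult_ac)
      next
        case False
        then show ?thesis using w0[of t] by (auto simp: indicator_def not_less)
      qed
    qed
    also have "\<dots> = (ennreal L * (X z * indicator {0<..} z)) * (head w z \<up> (- 1) * head w z)"
      unfolding head_def[of w z] by (subst nn_integral_cmult) (auto simp: mult.assoc)
    also have "\<dots> \<le> (ennreal L * (X z * indicator {0<..} z)) * 1"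
      by (intro mult_left_mono epow_pow_minus_one) auto
    finally show ?case by simp
  qed
  also have "\<dots> = ennreal L * tail X 0"
    unfolding tail_def by (subst nn_integral_cmult) auto
  finally show ?thesis .
qed

text \<open>The inner Hoelder inequality is \<open>tail_Holder_kernel\<close>. In the outer one,
  with exponents q/p and (p-q)/p, the product W^(-q/p) W^(q/p) = 1 is inserted: the first factor
  leads to \<open>nn_integral_near_average_le\<close>, the second to the weight of
  \<open>A5\<close>. The product is 1 only for 0 < W < \<infinity>; w vanishes almost everywhere on
  W = 0, and the kernel vanishes where W is infinite.\<close>

lemma near_term_le:
  fixes P \<sigma> u w :: "real \<Rightarrow> ennreal"
  assumes m: "0 < m" "m < p" and q: "0 < q" "q < p" and L: "L \<ge> (1::real)"
    and [measurable]: "P \<in> borel_measurable borel" "\<sigma> \<in> borel_measurable borel"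
      "u \<in> borel_measurable borel" "w \<in> borel_measurable borel"
    and \<Phi>: "\<And>t. t > 0 \<Longrightarrow> head (\<lambda>s. w s * mid u s t \<up> (q / m)) t < \<infinity>"
    and w0: "\<And>s. s \<le> 0 \<Longrightarrow> w s = 0"
  shows "(\<integral>\<^sup>+ t. w t * tail (\<lambda>z. block m p P \<sigma> (near_set w L t) z * mid u t z) t \<up> (q / m) \<partial>lborel)
    \<le> (ennreal L * tail (\<lambda>z. P z * \<sigma> z) 0) \<up> (q / p)
      * (\<integral>\<^sup>+ t. head w t \<up> (q / (p - q)) * w t * kernel_tail m p u \<sigma> t \<up> (q * (p - m) / (m * (p - q))) \<partial>lborel) \<up> ((p - q) / p)"
proof -
  define E where "E = near_set w L"
  have [measurable]: "E t \<in> sets borel" for t unfolding E_def by measurable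
  define B where "B = (\<lambda>t. kernel_tail m p u \<sigma> t)"
  define Q where "Q = (\<lambda>t. tail (\<lambda>z. P z * \<sigma> z * indicator (E t) z) t)"
  have [measurable]: "B \<in> borel_measurable borel" unfolding B_def by (rule measurable_tail2) measurable
  have [measurable]: "Q \<in> borel_measurable borel"
    unfolding Q_def tail_def E_def indicator_def mem_Collect_eq greaterThan_iff by measurable
  have ex: "0 < q / p" "0 < (p - q) / p" "q / p + (p - q) / p = 1" using q by (auto simp: field_simps)
  have W0: "AE t in lborel. head w t = 0 \<longrightarrow> w t = 0"
  proof -
    have "(\<integral>\<^sup>+ t. w t * indicator {t. head w t \<le> 0} t \<partial>lborel) = 0"
      using nn_integral_head_sublevel[of w 0] by simp
    then have "AE t in lborel. w t * indicator {t. head w t \<le> 0} t = 0"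
      by (subst (asm) nn_integral_0_iff_AE) auto
    then show ?thesis by eventually_elim auto
  qed
  have B0: "B t = 0" if "head w t = \<infinity>" for t
  proof -
    have "t > 0"
    proof (rule ccontr)
      assume "\<not> t > 0"
      then have "head w t = head (\<lambda>_. 0) t" unfolding head_def
        using w0 by (intro nn_integral_cong) (auto simp: indicator_def)
      then show False using that by (simp add: head_def)
    qed
    have "B t = tail (\<lambda>_. 0) t" unfolding B_def
    proof (rule tail_cong)
      fix s assume "s > t"
      then have "mid u t s = 0"
        using that \<open>t > 0\<close> m q by (intro mid_eq_0_if_head_infinite[of u w "q / m"] \<Phi>) auto
      then show "mid u t s \<up> (p / (p - m)) * tail \<sigma> s \<up> (p * (m - 1) / (p - m)) * \<sigma> s = 0"
        using m by (simp add: epow_0_left)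
    qed
    then show ?thesis by (simp add: tail_def)
  qed
  let ?e = "q * (p - m) / (m * (p - q))"
  have "(\<integral>\<^sup>+ t. w t * tail (\<lambda>z. block m p P \<sigma> (E t) z * mid u t z) t \<up> (q / m) \<partial>lborel)
    \<le> (\<integral>\<^sup>+ t. (w t * head w t \<up> (- 1) * Q t) \<up> (q / p) * (head w t \<up> (q / (p - q)) * w t * B t \<up> ?e) \<up> ((p - q) / p) \<partial>lborel)"
  proof (rule nn_integral_mono_AE, goal_cases)
    case 1
    show ?case
      using W0
    proof eventually_elim
      case (elim t)
      have "tail (\<lambda>z. block m p P \<sigma> (E t) z * mid u t z) t \<up> (q / m)
        \<le> (Q t \<up> (m / p) * B t \<up> ((p - m) / p)) \<up> (q / m)"
        unfolding Q_def B_def using m q by (intro epow_mono tail_Holder_kernel) auto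
      also have "\<dots> = Q t \<up> (q / p) * B t \<up> (?e * ((p - q) / p))"
        using m q by (simp add: epow_mult epow_mult_exp[symmetric] mult.commute)
      finally have le: "w t * tail (\<lambda>z. block m p P \<sigma> (E t) z * mid u t z) t \<up> (q / m)
        \<le> w t * (Q t \<up> (q / p) * B t \<up> (?e * ((p - q) / p)))" by (rule mult_left_mono) simp
      show ?case
      proof (cases "head w t = 0 \<or> head w t = \<infinity>")
        case True
        then have zero: "w t * (Q t \<up> (q / p) * B t \<up> (?e * ((p - q) / p))) = 0"
          using elim B0[of t] m q by (auto simp: epow_0_left)
        show ?thesis by (rule order.trans[OF le[unfolded zero] zero_le])
      next
        case False
        have "(head w t \<up> (- 1)) \<up> (q / p) * (head w t \<up> (q / (p - q))) \<up> ((p - q) / p)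
            = head w t \<up> ((- 1) * (q / p) + q / (p - q) * ((p - q) / p))"
          unfolding epow_mult_exp[symmetric] using False
          by (intro epow_add_finite[symmetric]) (auto simp: zero_less_iff_neq_zero less_top)
        also have "(- 1) * (q / p) + q / (p - q) * ((p - q) / p) = 0" using q by (simp add: field_simps)
        finally have one: "(head w t \<up> (- 1)) \<up> (q / p) * (head w t \<up> (q / (p - q))) \<up> ((p - q) / p) = 1" by simp
        have w: "w t = w t \<up> (q / p) * w t \<up> ((p - q) / p)"
          using epow_add[of "q / p" "(p - q) / p" "w t"] ex by simp
        have "w t * (Q t \<up> (q / p) * B t \<up> (?e * ((p - q) / p)))
          = (w t \<up> (q / p) * w t \<up> ((p - q) / p)) * (Q t \<up> (q / p) * (B t \<up> ?e) \<up> ((p - q) / p))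
            * ((head w t \<up> (- 1)) \<up> (q / p) * (head w t \<up> (q / (p - q))) \<up> ((p - q) / p))"
          unfolding one epow_mult_exp using w by simp
        also have "\<dots> = (w t * head w t \<up> (- 1) * Q t) \<up> (q / p) * (head w t \<up> (q / (p - q)) * w t * B t \<up> ?e) \<up> ((p - q) / p)"
          using ex by (simp only: epow_mult less_imp_le mult_ac)
        finally show ?thesis using le by simp
      qed
    qed
  qed
  also have "\<dots> \<le> (\<integral>\<^sup>+ t. w t * head w t \<up> (- 1) * Q t \<partial>lborel) \<up> (q / p)
      * (\<integral>\<^sup>+ t. head w t \<up> (q / (p - q)) * w t * B t \<up> ?e \<partial>lborel) \<up> ((p - q) / p)"
    by (rule nn_integral_Holder) (use ex in auto)
  also have "\<dots> \<le> (ennreal L * tail (\<lambda>z. P z * \<sigma> z) 0) \<up> (q / p)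
      * (\<integral>\<^sup>+ t. head w t \<up> (q / (p - q)) * w t * B t \<up> ?e \<partial>lborel) \<up> ((p - q) / p)"
    unfolding Q_def E_def using ex L w0
    by (intro mult_right_mono epow_mono nn_integral_near_average_le) auto
  finally show ?thesis unfolding E_def B_def .
qed

text \<open>If z is not near t, then by monotonicity of W no point beyond z is near t either. So the
  u-mass of the near points is at most \<open>mid u t z\<close>, and for fixed z the integral over t
  < z is \<Phi>(z). Hoelder's inequality in z then separates P.\<close>

lemma far_term_le:
  fixes P \<sigma> u w :: "real \<Rightarrow> ennreal" and L :: real
  assumes m: "0 < m" and q: "0 < q" "q < p"
    and [measurable]: "P \<in> borel_measurable borel" "\<sigma> \<in> borel_measurable borel"
      "u \<in> borel_measurable borel" "w \<in> borel_measurable borel"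
    and w0: "\<And>s. s \<le> 0 \<Longrightarrow> w s = 0"
  defines "E \<equiv> \<lambda>t. near_set w L t"
  shows "(\<integral>\<^sup>+ t. w t * (tail (\<lambda>s. u s * indicator (E t) s) t \<up> (q / m)
       * tail (block q p P \<sigma> (- E t)) t) \<partial>lborel)
    \<le> tail (\<lambda>z. P z * \<sigma> z) 0 \<up> (q / p)
      * tail (\<lambda>t. head (\<lambda>s. w s * mid u s t \<up> (q / m)) t \<up> (p / (p - q))
          * tail \<sigma> t \<up> (p * (q - 1) / (p - q)) * \<sigma> t) 0 \<up> ((p - q) / p)"
proof -
  define \<Phi> where "\<Phi> = (\<lambda>t. head (\<lambda>s. w s * mid u s t \<up> (q / m)) t)"
  have [measurable]: "E t \<in> sets borel" for t unfolding E_def by measurable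
  have [measurable]: "\<Phi> \<in> borel_measurable borel"
    unfolding \<Phi>_def head_def by measurable
  have ex: "0 < q / p" "0 < (p - q) / p" "q / p + (p - q) / p = 1" using q by (auto simp: field_simps)
  define Y where "Y = (\<lambda>z. P z \<up> (q / p) * (tail \<sigma> z \<up> (q - 1) * \<sigma> z))"
  have [measurable]: "Y \<in> borel_measurable borel" unfolding Y_def by measurable
  let ?f = "\<lambda>t z. w t * (mid u t z \<up> (q / m) * (Y z * indicator {t<..} z * indicator {0<..} z))"
  have "(\<integral>\<^sup>+ t. w t * (tail (\<lambda>s. u s * indicator (E t) s) t \<up> (q / m)
       * tail (block q p P \<sigma> (- E t)) t) \<partial>lborel)
    \<le> (\<integral>\<^sup>+ t. (\<integral>\<^sup>+ z. ?f t z \<partial>lborel) \<partial>lborel)"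
  proof (rule nn_integral_mono, goal_cases)
    case (1 t)
    let ?U = "tail (\<lambda>s. u s * indicator (E t) s) t \<up> (q / m)"
    have U: "?U \<le> mid u t z \<up> (q / m)" if "z \<notin> E t" for z
      unfolding tail_def mid_def
    proof (intro epow_mono nn_integral_mono)
      fix s
      have "s < z" if "s \<in> E t"
      proof (rule ccontr)
        assume "\<not> s < z"
        then have "head w z \<le> head w s" by (intro head_mono) simp
        with that \<open>z \<notin> E t\<close> show False by (simp add: E_def)
      qed
      then show "u s * indicator (E t) s * indicator {t<..} s \<le> u s * indicator {t<..<z} s"
        by (auto simp: indicator_def)
    qed (use m q in auto)
    show ?case
    proof (cases "t > 0")
      case True
      have "w t * (?U * tail (block q p P \<sigma> (- E t)) t)
        = (\<integral>\<^sup>+ z. w t * (?U * (block q p P \<sigma> (- E t) z * indicator {t<..} z)) \<partial>lborel)"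
        unfolding tail_def[of _ t] by (subst nn_integral_cmult, simp, subst nn_integral_cmult) auto
      also have "\<dots> \<le> (\<integral>\<^sup>+ z. ?f t z \<partial>lborel)"
      proof (rule nn_integral_mono, goal_cases)
        case (1 z)
        show ?case
        proof (cases "z > t \<and> z \<notin> E t")
          case True
          then have "w t * (?U * Y z) \<le> w t * (mid u t z \<up> (q / m) * Y z)"
            using U[of z] by (intro mult_left_mono mult_right_mono) auto
          then show ?thesis using True \<open>t > 0\<close> by (simp add: Y_def)
        qed auto
      qed
      finally show ?thesis .
    qed (use w0 in simp)
  qed
  also have "\<dots> = (\<integral>\<^sup>+ z. (\<integral>\<^sup>+ t. ?f t z \<partial>lborel) \<partial>lborel)"
    by (rule lborel_pair.Fubini') (simp add: case_prod_beta)
  also have "\<dots> = (\<integral>\<^sup>+ z. (P z * \<sigma> z * indicator {0<..} z) \<up> (q / p)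
      * (\<Phi> z \<up> (p / (p - q)) * tail \<sigma> z \<up> (p * (q - 1) / (p - q)) * \<sigma> z * indicator {0<..} z) \<up> ((p - q) / p) \<partial>lborel)"
  proof (rule nn_integral_cong, goal_cases)
    case (1 z)
    have "(\<integral>\<^sup>+ t. ?f t z \<partial>lborel) = (\<integral>\<^sup>+ t. (Y z * indicator {0<..} z) * (w t * mid u t z \<up> (q / m) * indicator {..<z} t) \<partial>lborel)"
      by (intro nn_integral_cong) (auto simp: indicator_def mult_ac)
    also have "\<dots> = Y z * indicator {0<..} z * \<Phi> z"
      unfolding \<Phi>_def head_def by (subst nn_integral_cmult) auto
    also have "\<dots> = (P z * \<sigma> z * indicator {0<..} z) \<up> (q / p)
      * (\<Phi> z \<up> (p / (p - q)) * tail \<sigma> z \<up> (p * (q - 1) / (p - q)) * \<sigma> z * indicator {0<..} z) \<up> ((p - q) / p)"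
    proof (cases "z > 0")
      case True
      have s: "\<sigma> z = \<sigma> z \<up> (q / p) * \<sigma> z \<up> ((p - q) / p)"
        using epow_add[of "q / p" "(p - q) / p" "\<sigma> z"] ex by simp
      have "Y z * indicator {0<..} z * \<Phi> z
        = P z \<up> (q / p) * (tail \<sigma> z \<up> (q - 1) * (\<sigma> z \<up> (q / p) * \<sigma> z \<up> ((p - q) / p))) * \<Phi> z"
        using True s by (simp add: Y_def)
      then show ?thesis
        using True q ex by (simp add: epow_mult epow_mult_exp[symmetric] mult_ac)
    qed (use ex in \<open>simp add: epow_0_left\<close>)
    finally show ?case .
  qed
  also have "\<dots> \<le> tail (\<lambda>z. P z * \<sigma> z) 0 \<up> (q / p)
      * tail (\<lambda>t. \<Phi> t \<up> (p / (p - q)) * tail \<sigma> t \<up> (p * (q - 1) / (p - q)) * \<sigma> t) 0 \<up> ((p - q) / p)"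
    unfolding tail_def[of _ 0] by (rule nn_integral_Holder) (use ex in auto)
  finally show ?thesis unfolding \<Phi>_def .
qed

section \<open>Assembly of the upper bound\<close>

lemma Hardy_majorant_kernel:
  fixes u \<sigma> g h :: "real \<Rightarrow> ennreal"
  assumes m: "0 < m" and p: "1 < p"
    and [measurable]: "u \<in> borel_measurable borel" "\<sigma> \<in> borel_measurable borel"
      "g \<in> borel_measurable borel" "h \<in> borel_measurable borel"
    and fin: "\<And>t. t > 0 \<Longrightarrow> tail \<sigma> t < \<infinity>"
    and h: "AE s in lborel. s > 0 \<longrightarrow> h s \<le> g s \<up> (1 / p) * \<sigma> s \<up> (1 - 1 / p)"
  shows "\<exists>P\<in>borel_measurable borel. (\<forall>s t. 0 < s \<longrightarrow> s \<le> t \<longrightarrow> P s \<le> P t) \<and>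
    (\<forall>t>0. tail (\<lambda>s. tail h s \<up> m * u s) t
      \<le> ennreal ((2 powr (p - 1)) powr (m / p)) * tail (\<lambda>s. P s \<up> (m / p) * tail \<sigma> s \<up> m * u s) t) \<and>
    tail (\<lambda>s. P s * \<sigma> s) 0 \<le> ennreal (1 + 2 / (p - 1)) * tail g 0"
proof -
  obtain P where P_meas[measurable]: "P \<in> borel_measurable borel"
    and P_mono: "\<And>s t. 0 < s \<Longrightarrow> s \<le> t \<Longrightarrow> P s \<le> P t"
    and H: "\<And>t. t > 0 \<Longrightarrow> tail h t \<up> p \<le> ennreal (2 powr (p - 1)) * (tail \<sigma> t \<up> p * P t)"
    and P_int: "tail (\<lambda>s. P s * \<sigma> s) 0 \<le> ennreal (1 + 2 / (p - 1)) * tail g 0"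
    using Hardy_monotone_majorant[OF p assms(4,5,6) fin h] by blast
  define k0 where "k0 = (2 powr (p - 1) :: real)"
  have k0: "k0 > 0" by (simp add: k0_def)
  define f where "f = (\<lambda>s. P s \<up> (m / p) * tail \<sigma> s \<up> m * u s)"
  have [measurable]: "f \<in> borel_measurable borel" unfolding f_def by measurable
  have "tail (\<lambda>s. tail h s \<up> m * u s) t \<le> ennreal (k0 powr (m / p)) * tail f t" if "t > 0" for t
  proof -
    have "tail (\<lambda>s. tail h s \<up> m * u s) t \<le> tail (\<lambda>s. ennreal (k0 powr (m / p)) * f s) t"
    proof (rule tail_mono_fun, goal_cases)
      case (1 s)
      then have "(tail h s \<up> p) \<up> (m / p) \<le> (ennreal k0 * (tail \<sigma> s \<up> p * P s)) \<up> (m / p)"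
        unfolding k0_def using H[of s] that m p by (intro epow_mono) auto
      then have "tail h s \<up> m \<le> ennreal (k0 powr (m / p)) * (P s \<up> (m / p) * tail \<sigma> s \<up> m)"
        using m p k0 by (simp add: epow_mult epow_mult_exp[symmetric] epow_ennreal mult_ac)
      from mult_right_mono[OF this, of "u s"]
      show ?case
        by (simp add: f_def mult_ac)
    qed
    also have "\<dots> = ennreal (k0 powr (m / p)) * tail f t"
      unfolding tail_def by (simp add: nn_integral_cmult[symmetric] mult.assoc)
    finally show ?thesis .
  qed
  then show ?thesis using P_meas P_mono P_int unfolding f_def k0_def by blast
qed

text \<open>The factors stem, in this order, from the Hardy majorant, the absorption of the far
  points, the kernel split followed by (x+y)^a <= 2^a (x^a + y^a), and the near term combined with
  the bound on the integral of P \<sigma>.\<close>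

definition upper_const :: "real \<Rightarrow> real \<Rightarrow> real \<Rightarrow> real" where
  "upper_const m p q = (2 powr (p - 1)) powr (q / p) * (2 * 2 powr (q / m))
    * ((2 * split_const m q) powr (q / m) * (2 * 2 powr (q / m) * (1 + 2 / (p - 1))) powr (q / p))"

text \<open>The weight v enters only through \<sigma> and g. In the application g = h^p v, and the
  hypothesis on h relaxes the identity h = g^(1/p) \<sigma>^(1-1/p).\<close>

lemma upper_bound_borel:
  fixes u w \<sigma> g h :: "real \<Rightarrow> ennreal"
  assumes m: "0 < m" "m < p" and p: "1 < p" and q: "0 < q" "q < p"
    and [measurable]: "u \<in> borel_measurable borel" "w \<in> borel_measurable borel" "\<sigma> \<in> borel_measurable borel"
      "g \<in> borel_measurable borel" "h \<in> borel_measurable borel"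
    and w0: "\<And>s. s \<le> 0 \<Longrightarrow> w s = 0"
    and fin: "\<And>t. t > 0 \<Longrightarrow> tail \<sigma> t < \<infinity>"
    and \<Phi>: "\<And>t. t > 0 \<Longrightarrow> head (\<lambda>s. w s * mid u s t \<up> (q / m)) t < \<infinity>"
    and h: "AE s in lborel. s > 0 \<longrightarrow> h s \<le> g s \<up> (1 / p) * \<sigma> s \<up> (1 - 1 / p)"
  shows "(\<integral>\<^sup>+ t. w t * tail (\<lambda>s. tail h s \<up> m * u s) t \<up> (q / m) \<partial>lborel)
    \<le> ennreal (upper_const m p q) *
      (((\<integral>\<^sup>+ t. head w t \<up> (q / (p - q)) * w t * kernel_tail m p u \<sigma> t \<up> (q * (p - m) / (m * (p - q))) \<partial>lborel) \<up> ((p - q) / p)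
        + tail (\<lambda>t. head (\<lambda>s. w s * mid u s t \<up> (q / m)) t \<up> (p / (p - q))
          * tail \<sigma> t \<up> (p * (q - 1) / (p - q)) * \<sigma> t) 0 \<up> ((p - q) / p))
       * tail g 0 \<up> (q / p))"
    (is "_ \<le> _ * ((?A5 + ?A6) * ?G)")
proof -
  obtain P where P_meas[measurable]: "P \<in> borel_measurable borel"
    and P_mono: "\<And>s t. 0 < s \<Longrightarrow> s \<le> t \<Longrightarrow> P s \<le> P t"
    and H: "\<And>t. t > 0 \<Longrightarrow> tail (\<lambda>s. tail h s \<up> m * u s) t \<le> ennreal ((2 powr (p - 1)) powr (m / p))
      * tail (\<lambda>s. P s \<up> (m / p) * tail \<sigma> s \<up> m * u s) t"
    and P_int: "tail (\<lambda>s. P s * \<sigma> s) 0 \<le> ennreal (1 + 2 / (p - 1)) * tail g 0"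
    using Hardy_majorant_kernel[OF m(1) p assms(6,8,9,10) fin h] by blast
  define a where "a = q / m"
  have a: "a > 0" using m q by (simp add: a_def)
  define L where "L = 2 * 2 powr a"
  have L: "L \<ge> 1" using a ge_one_powr_ge_zero[of 2 a] by (simp add: L_def)
  define k0 where "k0 = (2 powr (p - 1) :: real)"
  have k0: "k0 > 0" by (simp add: k0_def)
  define c1 where "c1 = split_const m q"
  have c1: "c1 > 0" by (simp add: c1_def split_const_pos)
  define k2 where "k2 = 1 + 2 / (p - 1)"
  have k2: "k2 > 0" using p by (simp add: k2_def add_pos_pos)
  define f where "f = (\<lambda>s. P s \<up> (m / p) * tail \<sigma> s \<up> m * u s)"
  have [measurable]: "f \<in> borel_measurable borel" unfolding f_def by measurable
  define E where "E = near_set w L"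
  have [measurable]: "E t \<in> sets borel" for t unfolding E_def by measurable
  define X where "X = (\<lambda>t. tail (\<lambda>z. block m p P \<sigma> (E t) z * mid u t z) t)"
  define N where "N = (\<lambda>t. tail (\<lambda>s. u s * indicator (E t) s) t)"
  define Y where "Y = (\<lambda>t. tail (block q p P \<sigma> (- E t)) t)"
  have [measurable]: "X \<in> borel_measurable borel" "N \<in> borel_measurable borel" "Y \<in> borel_measurable borel"
    unfolding X_def N_def Y_def E_def indicator_def Compl_iff mem_Collect_eq by (rule measurable_tail2, measurable)+
  let ?near = "\<lambda>t. tail (\<lambda>s. f s * indicator {y. y \<le> ennreal L * head w t} (head w s)) t"
  have "(\<integral>\<^sup>+ t. w t * tail (\<lambda>s. tail h s \<up> m * u s) t \<up> a \<partial>lborel)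
      \<le> (\<integral>\<^sup>+ t. ennreal (k0 powr (q / p)) * (w t * tail f t \<up> a) \<partial>lborel)"
  proof (rule nn_integral_mono, goal_cases)
    case (1 t)
    show ?case
    proof (cases "t > 0")
      case True
      have "tail (\<lambda>s. tail h s \<up> m * u s) t \<up> a \<le> (ennreal (k0 powr (m / p)) * tail f t) \<up> a"
        unfolding k0_def f_def using a True by (intro epow_mono H) auto
      also have "\<dots> = ennreal (k0 powr (q / p)) * tail f t \<up> a"
        using a m k0 by (simp add: epow_mult epow_ennreal powr_powr a_def)
      finally have "w t * tail (\<lambda>s. tail h s \<up> m * u s) t \<up> a \<le> w t * (ennreal (k0 powr (q / p)) * tail f t \<up> a)"
        by (rule mult_left_mono) simp
      then show ?thesis by (simp add: mult_ac)
    qed (use w0 in simp)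
  qed
  also have "\<dots> = ennreal (k0 powr (q / p)) * (\<integral>\<^sup>+ t. w t * tail f t \<up> a \<partial>lborel)"
    by (rule nn_integral_cmult) measurable
  also have "(\<integral>\<^sup>+ t. w t * tail f t \<up> a \<partial>lborel) \<le> ennreal L * (\<integral>\<^sup>+ t. w t * ?near t \<up> a \<partial>lborel)"
    unfolding L_def
  proof (rule near_part_dominates)
    have "AE s in lborel. head w s = \<infinity> \<longrightarrow> u s = 0"
      using AE_eq_0_if_head_infinite[of u w a] a \<Phi> w0 by (simp add: a_def)
    then show "AE s in lborel. head w s = \<infinity> \<longrightarrow> f s = 0"
      by eventually_elim (auto simp: f_def)
  qed (use a in auto)
  also have "(\<integral>\<^sup>+ t. w t * ?near t \<up> a \<partial>lborel)
      \<le> (\<integral>\<^sup>+ t. ennreal ((2 * c1) powr a) * (w t * X t \<up> a + w t * (N t \<up> a * Y t)) \<partial>lborel)"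
  proof (rule nn_integral_mono, goal_cases)
    case (1 t)
    show ?case
    proof (cases "t > 0")
      case True
      have "?near t
        = tail (\<lambda>s. P s \<up> (m / p) * tail \<sigma> s \<up> m * u s * indicator (E t) s) t"
        by (simp add: f_def E_def indicator_def)
      also have "\<dots> \<le> ennreal c1 * (X t + N t * Y t \<up> (m / q))"
        unfolding X_def N_def Y_def c1_def using m p q True P_mono fin by (intro kernel_split) auto
      finally have "?near t \<up> a
          \<le> (ennreal c1 * (X t + N t * Y t \<up> (m / q))) \<up> a"
        using a by (intro epow_mono) auto
      also have "\<dots> = ennreal (c1 powr a) * (X t + N t * Y t \<up> (m / q)) \<up> a"
        using a c1 by (simp add: epow_mult[of a "ennreal c1"] epow_ennreal)
      also have "\<dots> \<le> ennreal (c1 powr a) * (2 \<up> a * (X t \<up> a + (N t * Y t \<up> (m / q)) \<up> a))"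
        by (intro mult_left_mono epow_add_le a) auto
      also have "(N t * Y t \<up> (m / q)) \<up> a = N t \<up> a * Y t"
        using a m q by (simp add: epow_mult epow_mult_exp[symmetric] a_def)
      also have "2 \<up> a = ennreal (2 powr a)" using epow_ennreal[of 2 a] by simp
      finally have "w t * ?near t \<up> a
        \<le> w t * (ennreal (c1 powr a) * (ennreal (2 powr a) * (X t \<up> a + N t \<up> a * Y t)))"
        by (rule mult_left_mono) simp
      also have "\<dots> = ennreal (c1 powr a) * ennreal (2 powr a) * (w t * X t \<up> a + w t * (N t \<up> a * Y t))"
        by (simp add: distrib_left mult_ac)
      also have "ennreal (c1 powr a) * ennreal (2 powr a) = ennreal ((2 * c1) powr a)"
        using c1 by (simp add: ennreal_mult[symmetric] powr_mult mult.commute)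
      finally show ?thesis .
    qed (use w0 in simp)
  qed
  also have "\<dots> = ennreal ((2 * c1) powr a) * ((\<integral>\<^sup>+ t. w t * X t \<up> a \<partial>lborel) + (\<integral>\<^sup>+ t. w t * (N t \<up> a * Y t) \<partial>lborel))"
    by (simp add: nn_integral_cmult nn_integral_add)
  also have "(\<integral>\<^sup>+ t. w t * X t \<up> a \<partial>lborel) \<le> ennreal ((L * k2) powr (q / p)) * (?A5 * ?G)"
  proof -
    have "(\<integral>\<^sup>+ t. w t * X t \<up> a \<partial>lborel) \<le> (ennreal L * tail (\<lambda>z. P z * \<sigma> z) 0) \<up> (q / p) * ?A5"
      unfolding X_def E_def a_def by (rule near_term_le) (use m q L \<Phi> w0 in auto)
    also have "\<dots> \<le> (ennreal L * (ennreal k2 * tail g 0)) \<up> (q / p) * ?A5"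
      unfolding k2_def using P_int p q by (intro mult_right_mono epow_mono mult_left_mono) auto
    also have "\<dots> = ennreal ((L * k2) powr (q / p)) * (?A5 * ?G)"
      using p q L k2 by (simp add: epow_mult epow_ennreal powr_mult ennreal_mult mult_ac)
    finally show ?thesis .
  qed
  also have "(\<integral>\<^sup>+ t. w t * (N t \<up> a * Y t) \<partial>lborel) \<le> ennreal ((L * k2) powr (q / p)) * (?A6 * ?G)"
  proof -
    have "(\<integral>\<^sup>+ t. w t * (N t \<up> a * Y t) \<partial>lborel) \<le> tail (\<lambda>z. P z * \<sigma> z) 0 \<up> (q / p) * ?A6"
      unfolding N_def Y_def E_def a_def by (rule far_term_le) (use m q w0 in auto)
    also have "\<dots> \<le> (ennreal k2 * tail g 0) \<up> (q / p) * ?A6"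
      unfolding k2_def using P_int p q by (intro mult_right_mono epow_mono) auto
    also have "\<dots> = ennreal (k2 powr (q / p)) * (?A6 * ?G)"
      using p q k2 by (simp add: epow_mult epow_ennreal mult_ac)
    also have "\<dots> \<le> ennreal ((L * k2) powr (q / p)) * (?A6 * ?G)"
      using p q k2 L by (intro mult_right_mono ennreal_leI powr_mono2) auto
    finally show ?thesis .
  qed
  finally have "(\<integral>\<^sup>+ t. w t * tail (\<lambda>s. tail h s \<up> m * u s) t \<up> a \<partial>lborel)
    \<le> ennreal (k0 powr (q / p)) * (ennreal L * (ennreal ((2 * c1) powr a)
      * (ennreal ((L * k2) powr (q / p)) * (?A5 * ?G) + ennreal ((L * k2) powr (q / p)) * (?A6 * ?G))))"
    by (simp add: mult_left_mono add_mono)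
  also have "\<dots> = ennreal (upper_const m p q) * ((?A5 + ?A6) * ?G)"
  proof -
    have "upper_const m p q = k0 powr (q / p) * L * ((2 * c1) powr a * (L * k2) powr (q / p))"
      by (simp add: upper_const_def k0_def L_def c1_def k2_def a_def)
    then have "ennreal (upper_const m p q) = ennreal (k0 powr (q / p)) * ennreal L
        * (ennreal ((2 * c1) powr a) * ennreal ((L * k2) powr (q / p)))"
      using L by (simp add: ennreal_mult)
    then show ?thesis by (simp add: distrib_left distrib_right mult_ac)
  qed
  finally show ?thesis unfolding a_def .
qed

text \<open>The same argument at a fixed t with E the whole line and q replaced by m: the complement
  is empty, so only the kernel of \<open>A5\<close> remains. This serves to bound C from above in
  the counterexample.\<close>

lemma tail_bound_borel:
  fixes u \<sigma> g h :: "real \<Rightarrow> ennreal"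
  assumes m: "0 < m" "m < p" and p: "1 < p"
    and [measurable]: "u \<in> borel_measurable borel" "\<sigma> \<in> borel_measurable borel"
      "g \<in> borel_measurable borel" "h \<in> borel_measurable borel"
    and fin: "\<And>t. t > 0 \<Longrightarrow> tail \<sigma> t < \<infinity>"
    and h: "AE s in lborel. s > 0 \<longrightarrow> h s \<le> g s \<up> (1 / p) * \<sigma> s \<up> (1 - 1 / p)"
    and t: "t > 0"
  shows "tail (\<lambda>s. tail h s \<up> m * u s) t
    \<le> ennreal ((2 powr (p - 1)) powr (m / p) * split_const m m * (1 + 2 / (p - 1)) powr (m / p)) *
      (tail g 0 \<up> (m / p) * kernel_tail m p u \<sigma> t \<up> ((p - m) / p))"
    (is "_ \<le> _ * (?G * ?D)")
proof -
  obtain P where P_meas[measurable]: "P \<in> borel_measurable borel"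
    and P_mono: "\<And>s t. 0 < s \<Longrightarrow> s \<le> t \<Longrightarrow> P s \<le> P t"
    and H: "\<And>t. t > 0 \<Longrightarrow> tail (\<lambda>s. tail h s \<up> m * u s) t \<le> ennreal ((2 powr (p - 1)) powr (m / p))
      * tail (\<lambda>s. P s \<up> (m / p) * tail \<sigma> s \<up> m * u s) t"
    and P_int: "tail (\<lambda>s. P s * \<sigma> s) 0 \<le> ennreal (1 + 2 / (p - 1)) * tail g 0"
    using Hardy_majorant_kernel[OF m(1) p assms(4,5,6,7) fin h] by blast
  define k0 where "k0 = (2 powr (p - 1) :: real)"
  have k0: "k0 > 0" by (simp add: k0_def)
  define k2 where "k2 = 1 + 2 / (p - 1)"
  have k2: "k2 > 0" using p by (simp add: k2_def add_pos_pos)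
  let ?X = "tail (\<lambda>z. block m p P \<sigma> UNIV z * mid u t z) t"
  have "tail (\<lambda>s. tail h s \<up> m * u s) t \<le> ennreal (k0 powr (m / p))
      * tail (\<lambda>s. P s \<up> (m / p) * tail \<sigma> s \<up> m * u s * indicator UNIV s) t"
    using H[OF t] by (simp add: k0_def)
  also have "tail (\<lambda>s. P s \<up> (m / p) * tail \<sigma> s \<up> m * u s * indicator UNIV s) t \<le> ennreal (split_const m m) * (?X + tail (\<lambda>s. u s * indicator UNIV s) t
       * tail (block m p P \<sigma> (- UNIV)) t \<up> (m / m))"
    using m p t P_mono fin by (intro kernel_split) auto
  also have "tail (block m p P \<sigma> (- UNIV)) t \<up> (m / m) = 0"
    using m by (simp add: tail_def)
  also have "?X + tail (\<lambda>s. u s * indicator UNIV s) t * 0 = ?X" by simp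
  also have "?X \<le> tail (\<lambda>z. P z * \<sigma> z * indicator UNIV z) t \<up> (m / p) * ?D"
    using m by (intro tail_Holder_kernel) auto
  also have "\<dots> \<le> (ennreal k2 * tail g 0) \<up> (m / p) * ?D"
    using order.trans[OF tail_antimono P_int, of t] t m p unfolding k2_def
    by (intro mult_right_mono epow_mono) auto
  also have "\<dots> = ennreal (k2 powr (m / p)) * (?G * ?D)"
    using k2 m p by (simp add: epow_mult epow_ennreal mult_ac)
  finally have "tail (\<lambda>s. tail h s \<up> m * u s) t
    \<le> ennreal (k0 powr (m / p)) * (ennreal (split_const m m) * (ennreal (k2 powr (m / p)) * (?G * ?D)))"
    by (simp add: mult_left_mono)
  then show ?thesis
    using split_const_pos[of m m] by (simp add: k0_def k2_def ennreal_mult mult.assoc)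
qed

section \<open>Passage to Borel weights\<close>

text \<open>Weights are only Lebesgue measurable, with arbitrary values off (0,\<infinity>). Borel
  representatives vanishing on the nonpositive axis make product measurability and integrals over
  the whole line available.\<close>

definition borel_version :: "(real \<Rightarrow> ennreal) \<Rightarrow> (real \<Rightarrow> ennreal) \<Rightarrow> bool" where
  "borel_version f f' \<longleftrightarrow> f' \<in> borel_measurable borel \<and> (\<forall>s\<le>0. f' s = 0)
    \<and> (AE s in lborel. s > 0 \<longrightarrow> f s = f' s)"

lemma M_plus_borel_version:
  assumes "f \<in> M_plus"
  obtains f' where "borel_version f f'"
proof -
  have "(\<lambda>x. f x * indicator {0<..} x) \<in> borel_measurable lebesgue"
    using assms unfolding M_plus_def by (subst (asm) borel_measurable_restrict_space_iff_ennreal) auto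
  then obtain g where g: "g \<in> borel_measurable lborel" "AE x in lborel. f x * indicator {0<..} x = g x"
    using completion_ex_borel_measurable by blast
  have "borel_version f (\<lambda>x. g x * indicator {0<..} x)"
    unfolding borel_version_def
  proof (intro conjI)
    show "(\<lambda>x. g x * indicator {0<..} x) \<in> borel_measurable borel" using g by measurable
    show "AE s in lborel. 0 < s \<longrightarrow> f s = g s * indicator {0<..} s"
      using g(2) by eventually_elim auto
  qed auto
  then show ?thesis by (rule that)
qed

lemma borel_measurable_M_plus:
  assumes "f \<in> borel_measurable borel"
  shows "f \<in> M_plus"
  unfolding M_plus_def
  by (intro measurable_restrict_space1 measurable_completion) (use assms in auto)

lemma set_nn_integral_version:
  assumes "AE s in lborel. s > 0 \<longrightarrow> f s = f' s" "S \<subseteq> {0<..}"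
  shows "(\<integral>\<^sup>+ s\<in>S. f s \<partial>lebesgue) = (\<integral>\<^sup>+ s. f' s * indicator S s \<partial>lborel)"
  unfolding nn_integral_completion
proof (rule nn_integral_cong_AE, goal_cases)
  case 1
  show ?case
    using assms(1) by eventually_elim (use assms(2) in \<open>auto simp: indicator_def\<close>)
qed

lemma tail_version:
  assumes "AE s in lborel. s > 0 \<longrightarrow> f s = f' s" "t \<ge> 0"
  shows "(\<integral>\<^sup>+ s\<in>{t<..}. f s \<partial>lebesgue) = tail f' t"
  unfolding tail_def by (rule set_nn_integral_version) (use assms in auto)

lemma mid_version:
  assumes "AE s in lborel. s > 0 \<longrightarrow> f s = f' s" "t \<ge> 0"
  shows "(\<integral>\<^sup>+ s\<in>{t<..<x}. f s \<partial>lebesgue) = mid f' t x"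
  unfolding mid_def by (rule set_nn_integral_version) (use assms in auto)

lemma head_version:
  assumes "AE s in lborel. s > 0 \<longrightarrow> f s = f' s" "\<And>s. s \<le> 0 \<Longrightarrow> f' s = 0"
  shows "(\<integral>\<^sup>+ s\<in>{0<..<x}. f s \<partial>lebesgue) = head f' x"
  using head_eq_mid[OF assms(2)] mid_version[OF assms(1), of 0 x] by simp

lemma tail_0_eq_nn_integral: "tail f 0 = (\<integral>\<^sup>+ t. f t \<partial>lborel)" if "\<And>s. s \<le> 0 \<Longrightarrow> f s = 0"
  unfolding tail_def using that by (intro nn_integral_cong) (auto simp: indicator_def not_less)

lemma upper_const_pos:
  assumes "p > 1"
  shows "upper_const m p q > 0"
proof -
  have "1 + 2 / (p - 1) > 0" using assms by (simp add: add_pos_pos)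
  then show ?thesis
    using split_const_pos[of m q] by (auto simp: upper_const_def intro!: mult_pos_pos)
qed

text \<open>An infinite denominator gives the quotient 0; for a zero denominator the hypothesis
  makes the numerator 0, and 0/0 = 0.\<close>

lemma C_opt_least:
  assumes le: "\<And>h. h \<in> M_plus \<Longrightarrow> denom p v h < \<infinity> \<Longrightarrow> numer m q u w h \<le> K * denom p v h"
  shows "C_opt m p q u w v \<le> K"
  unfolding C_opt_def
proof (rule SUP_least)
  fix h assume h: "h \<in> M_plus"
  consider "denom p v h = 0" | "denom p v h = top" | "denom p v h \<noteq> 0" "denom p v h < \<infinity>"
    unfolding infinity_ennreal_def using top.not_eq_extremum by blast
  then show "numer m q u w h / denom p v h \<le> K"
  proof cases
    case 3
    then show ?thesis
      using divide_right_mono_ennreal[OF le[OF h], of "denom p v h"] by (simp add: mult_divide_eq_ennreal)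
  qed (use le[OF h] in auto)
qed

section \<open>The constants A1, A5, A6 and C in terms of Borel representatives\<close>

locale weights =
  fixes m p q :: real and u w v u' w' v' :: "real \<Rightarrow> ennreal"
  assumes m: "0 < m" "m < p" and p: "1 < p" and q: "0 < q" "q < p"
    and versions: "borel_version u u'" "borel_version w w'" "borel_version v v'"
begin

definition \<sigma> :: "real \<Rightarrow> ennreal" where
  "\<sigma> = (\<lambda>s. v' s \<up> (1 - conj_exp p) * indicator {0<..} s)"

definition \<Phi> :: "real \<Rightarrow> ennreal" where
  "\<Phi> = (\<lambda>t. head (\<lambda>s. w' s * mid u' s t \<up> (q / m)) t)"

lemma measurable_weights [measurable]:
  "u' \<in> borel_measurable borel" "w' \<in> borel_measurable borel" "v' \<in> borel_measurable borel"
  "\<sigma> \<in> borel_measurable borel" "\<Phi> \<in> borel_measurable borel"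
proof -
  show [measurable]: "u' \<in> borel_measurable borel" "w' \<in> borel_measurable borel" "v' \<in> borel_measurable borel"
    using versions by (auto simp: borel_version_def)
  show "\<sigma> \<in> borel_measurable borel" unfolding \<sigma>_def by measurable
  show "\<Phi> \<in> borel_measurable borel" unfolding \<Phi>_def by (rule measurable_head2) measurable
qed

lemma weights_eq_0: "s \<le> 0 \<Longrightarrow> u' s = 0" "s \<le> 0 \<Longrightarrow> w' s = 0" "s \<le> 0 \<Longrightarrow> \<sigma> s = 0"
  using versions by (auto simp: borel_version_def \<sigma>_def)

lemma AE_u: "AE s in lborel. s > 0 \<longrightarrow> u s = u' s"
  and AE_w: "AE s in lborel. s > 0 \<longrightarrow> w s = w' s"
  and AE_v: "AE s in lborel. s > 0 \<longrightarrow> v s = v' s"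
  using versions by (auto simp: borel_version_def)

lemma AE_\<sigma>: "AE s in lborel. s > 0 \<longrightarrow> v s \<up> (1 - conj_exp p) = \<sigma> s"
  using AE_v by eventually_elim (auto simp: \<sigma>_def)

text \<open>The convention r/q' = 0 for q = 1 agrees with p (q-1) / (p-q), so a single formula
  covers all q.\<close>

lemma exponents:
  "1 / conj_exp p = 1 - 1 / p" "1 - conj_exp p = - (1 / (p - 1))"
  "r_exp p q / p = q / (p - q)" "r_exp p q / q = p / (p - q)"
  "r_over_conj p q = p * (q - 1) / (p - q)" "1 / r_exp p q = (p - q) / (p * q)"
  using p q by (auto simp: conj_exp_def r_exp_def r_over_conj_def field_simps)

lemma phi_eq:
  assumes "t > 0"
  shows "phi m q u w t = \<Phi> t \<up> (1 / q)"
proof -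
  have "AE s in lborel. s > 0 \<longrightarrow> (\<integral>\<^sup>+ y\<in>{s<..<t}. u y \<partial>lebesgue) \<up> (q / m) * w s = w' s * mid u' s t \<up> (q / m)"
    using AE_w by eventually_elim (auto simp: mid_version[OF AE_u] mult.commute)
  then show ?thesis
    unfolding phi_def \<Phi>_def by (subst head_version) (auto simp: weights_eq_0)
qed

end

locale weighted_inequality = weights +
  assumes admissible: "admissible m q u w"
begin

lemma \<Phi>_finite:
  assumes "t > 0"
  shows "\<Phi> t < \<infinity>" "\<Phi> t \<noteq> 0"
proof -
  have "0 < \<Phi> t \<up> (1 / q)" "\<Phi> t \<up> (1 / q) < \<infinity>"
    using admissible assms unfolding admissible_def by (simp_all add: phi_eq)
  then show "\<Phi> t < \<infinity>" "\<Phi> t \<noteq> 0"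
    using q epow_eq_top_iff[of "1 / q" "\<Phi> t"] by (auto simp: epow_0_left less_top)
qed

lemma numer_eq:
  assumes h: "borel_version h h'"
  shows "numer m q u w h = (\<integral>\<^sup>+ t. w' t * tail (\<lambda>s. tail h' s \<up> m * u' s) t \<up> (q / m) \<partial>lborel) \<up> (1 / q)"
proof -
  have AE_h: "AE s in lborel. s > 0 \<longrightarrow> h s = h' s" using h by (simp add: borel_version_def)
  have "AE s in lborel. s > 0 \<longrightarrow> (\<integral>\<^sup>+ y\<in>{s<..}. h y \<partial>lebesgue) \<up> m * u s = tail h' s \<up> m * u' s"
    using AE_u by eventually_elim (auto simp: tail_version[OF AE_h])
  note inner = tail_version[OF this]
  have "AE t in lborel. t > 0 \<longrightarrow> (\<integral>\<^sup>+ s\<in>{t<..}. (\<integral>\<^sup>+ y\<in>{s<..}. h y \<partial>lebesgue) \<up> m * u s \<partial>lebesgue) \<up> (q / m) * w t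
      = w' t * tail (\<lambda>s. tail h' s \<up> m * u' s) t \<up> (q / m)"
    using AE_w by eventually_elim (auto simp: inner mult.commute[of _ "w' _"])
  from tail_version[OF this, of 0] show ?thesis
    unfolding numer_def by (simp add: tail_0_eq_nn_integral weights_eq_0)
qed

lemma denom_eq:
  assumes h: "borel_version h h'"
  shows "denom p v h = tail (\<lambda>s. h' s \<up> p * v' s) 0 \<up> (1 / p)"
proof -
  have "AE s in lborel. s > 0 \<longrightarrow> h s \<up> p * v s = h' s \<up> p * v' s"
    using h AE_v unfolding borel_version_def by auto
  from tail_version[OF this, of 0] show ?thesis unfolding denom_def by simp
qed

lemma A1_ge:
  assumes "t > 0"
  shows "\<Phi> t \<up> (1 / q) * tail \<sigma> t \<up> (1 - 1 / p) \<le> A1 m p q u w v"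
proof -
  have "AE s in lborel. s > 0 \<longrightarrow> w s * (\<integral>\<^sup>+ y\<in>{s<..<t}. u y \<partial>lebesgue) \<up> (q / m) = w' s * mid u' s t \<up> (q / m)"
    using AE_w by eventually_elim (auto simp: mid_version[OF AE_u])
  then have "(\<integral>\<^sup>+ s\<in>{0<..<t}. w s * (\<integral>\<^sup>+ y\<in>{s<..<t}. u y \<partial>lebesgue) \<up> (q / m) \<partial>lebesgue) = \<Phi> t"
    unfolding \<Phi>_def by (subst head_version) (auto simp: weights_eq_0)
  moreover have "(\<integral>\<^sup>+ s\<in>{t<..}. v s \<up> (1 - conj_exp p) \<partial>lebesgue) = tail \<sigma> t"
    using AE_\<sigma> assms by (intro tail_version) auto
  ultimately show ?thesis
    unfolding A1_def exponents using assms by (intro SUP_upper2[of t]) auto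
qed

lemma A5_eq:
  "A5 m p q u w v = (\<integral>\<^sup>+ t. head w' t \<up> (q / (p - q)) * w' t * kernel_tail m p u' \<sigma> t \<up> (q * (p - m) / (m * (p - q))) \<partial>lborel) \<up> ((p - q) / (p * q))"
proof -
  let ?I = "\<lambda>t s. (\<integral>\<^sup>+ y\<in>{t<..<s}. u y \<partial>lebesgue) \<up> (p / (p - m))
            * (\<integral>\<^sup>+ z\<in>{s<..}. v z \<up> (1 - conj_exp p) \<partial>lebesgue) \<up> (p * (m - 1) / (p - m))
            * v s \<up> (1 - conj_exp p)"
  have 1: "AE s in lborel. s > 0 \<longrightarrow> ?I t s
      = mid u' t s \<up> (p / (p - m)) * tail \<sigma> s \<up> (p * (m - 1) / (p - m)) * \<sigma> s" if "t > 0" for t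
    using AE_\<sigma> by eventually_elim (use that in \<open>auto simp: mid_version[OF AE_u] tail_version[OF AE_\<sigma>]\<close>)
  have 2: "(\<integral>\<^sup>+ s\<in>{0<..<t}. w s \<partial>lebesgue) = head w' t" for t
    using AE_w weights_eq_0 by (intro head_version) auto
  have "AE t in lborel. t > 0 \<longrightarrow> (\<integral>\<^sup>+ s\<in>{0<..<t}. w s \<partial>lebesgue) \<up> (q / (p - q)) * w t
       * (\<integral>\<^sup>+ s\<in>{t<..}. ?I t s \<partial>lebesgue) \<up> (q * (p - m) / (m * (p - q)))
     = head w' t \<up> (q / (p - q)) * w' t * kernel_tail m p u' \<sigma> t \<up> (q * (p - m) / (m * (p - q)))"
    using AE_w by eventually_elim (use 2 in \<open>auto simp: tail_version[OF 1]\<close>)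
  from tail_version[OF this, of 0] show ?thesis
    unfolding A5_def exponents by (simp add: tail_0_eq_nn_integral weights_eq_0)
qed

lemma A6_eq:
  "A6 m p q u w v = tail (\<lambda>t. \<Phi> t \<up> (p / (p - q)) * tail \<sigma> t \<up> (p * (q - 1) / (p - q)) * \<sigma> t) 0 \<up> ((p - q) / (p * q))"
proof -
  have 1: "(\<integral>\<^sup>+ s\<in>{0<..<t}. w s * (\<integral>\<^sup>+ y\<in>{s<..<t}. u y \<partial>lebesgue) \<up> (q / m) \<partial>lebesgue) = \<Phi> t" for t
  proof -
    have "AE s in lborel. s > 0 \<longrightarrow> w s * (\<integral>\<^sup>+ y\<in>{s<..<t}. u y \<partial>lebesgue) \<up> (q / m) = w' s * mid u' s t \<up> (q / m)"
      using AE_w by eventually_elim (auto simp: mid_version[OF AE_u])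
    then show ?thesis
      unfolding \<Phi>_def by (subst head_version) (auto simp: weights_eq_0)
  qed
  have "AE t in lborel. t > 0 \<longrightarrow>
       (\<integral>\<^sup>+ s\<in>{0<..<t}. w s * (\<integral>\<^sup>+ y\<in>{s<..<t}. u y \<partial>lebesgue) \<up> (q / m) \<partial>lebesgue) \<up> (p / (p - q))
       * (\<integral>\<^sup>+ y\<in>{t<..}. v y \<up> (1 - conj_exp p) \<partial>lebesgue) \<up> (p * (q - 1) / (p - q)) * v t \<up> (1 - conj_exp p)
     = \<Phi> t \<up> (p / (p - q)) * tail \<sigma> t \<up> (p * (q - 1) / (p - q)) * \<sigma> t"
    using AE_\<sigma> by eventually_elim (auto simp: 1 tail_version[OF AE_\<sigma>])
  from tail_version[OF this, of 0] show ?thesis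
    unfolding A6_def exponents by simp
qed

text \<open>For 0 < v < \<infinity> both sides agree. Where v = 0 one has \<sigma> = \<infinity>,
  which the finite tails of \<sigma> exclude almost everywhere. Where v = \<infinity> one has
  \<sigma> = 0, and there finiteness of h^p v forces h = 0.\<close>

lemma Holder_density:
  assumes [measurable]: "h' \<in> borel_measurable borel"
    and fin: "\<And>t. t > 0 \<Longrightarrow> tail \<sigma> t < \<infinity>"
    and g: "tail (\<lambda>s. h' s \<up> p * v' s) 0 < \<infinity>"
  shows "AE s in lborel. s > 0 \<longrightarrow> h' s \<le> (h' s \<up> p * v' s) \<up> (1 / p) * \<sigma> s \<up> (1 - 1 / p)"
proof -
  have "AE s in lborel. \<sigma> s * indicator {1 / real (Suc n)<..} s \<noteq> \<infinity>" for n
    using fin[of "1 / real (Suc n)"] unfolding tail_def by (intro nn_integral_PInf_AE) auto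
  then have "AE s in lborel. \<forall>n. \<sigma> s * indicator {1 / real (Suc n)<..} s \<noteq> \<infinity>"
    by (simp add: AE_all_countable)
  moreover have "AE s in lborel. h' s \<up> p * v' s * indicator {0<..} s \<noteq> \<infinity>"
    using g unfolding tail_def by (intro nn_integral_PInf_AE) auto
  ultimately show ?thesis
  proof eventually_elim
    case (elim s)
    show ?case
    proof
      assume s: "s > 0"
      then obtain n where "1 / real (Suc n) < s" using nat_approx_posE by blast
      then have \<sigma>: "\<sigma> s \<noteq> \<infinity>" using elim(1)[rule_format, of n] by simp
      have g: "h' s \<up> p * v' s \<noteq> \<infinity>" using elim(2) s by simp
      have e: "(1 - conj_exp p) * (1 - 1 / p) = - (1 / p)" "conj_exp p > 1"
        using p by (auto simp: conj_exp_def field_simps)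
      show "h' s \<le> (h' s \<up> p * v' s) \<up> (1 / p) * \<sigma> s \<up> (1 - 1 / p)"
      proof (cases "v' s" rule: ennreal_cases3)
        case zero
        then have "\<sigma> s = \<infinity>" using s e(2) by (simp add: \<sigma>_def epow_def)
        then show ?thesis using \<sigma> by simp
      next
        case top
        then have "h' s \<up> p = 0" using g by (auto simp: ennreal_mult_eq_top_iff)
        then show ?thesis using p epow_eq_0_iff[of p "h' s"] by simp
      next
        case (real r)
        have "(h' s \<up> p * v' s) \<up> (1 / p) * \<sigma> s \<up> (1 - 1 / p)
            = h' s * (v' s \<up> (1 / p) * v' s \<up> ((1 - conj_exp p) * (1 - 1 / p)))"
          using p s by (simp add: \<sigma>_def epow_mult epow_inverse epow_mult_exp mult.assoc)
        also have "v' s \<up> (1 / p) * v' s \<up> ((1 - conj_exp p) * (1 - 1 / p)) = v' s \<up> (1 / p + - (1 / p))"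
          unfolding e(1) using real by (intro epow_add_finite[symmetric]) auto
        finally show ?thesis by simp
      qed
    qed
  qed
qed

text \<open>Admissibility gives \<Phi>(t) > 0, so an infinite tail would make the expression under
  the supremum of \<open>A1\<close> infinite at t.\<close>

lemma tail_\<sigma>_finite:
  assumes "A1 m p q u w v < \<infinity>" "t > 0"
  shows "tail \<sigma> t < \<infinity>"
proof (rule ccontr)
  assume "\<not> tail \<sigma> t < \<infinity>"
  then have "tail \<sigma> t \<up> (1 - 1 / p) = \<infinity>" using p by (simp add: less_top[symmetric] epow_top)
  moreover have "\<Phi> t \<up> (1 / q) \<noteq> 0" using \<Phi>_finite[OF assms(2)] q by (simp add: epow_eq_0_iff)
  ultimately have "\<Phi> t \<up> (1 / q) * tail \<sigma> t \<up> (1 - 1 / p) = \<infinity>" by (simp add: ennreal_mult_top)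
  then show False using A1_ge[OF assms(2)] assms(1) by (simp add: top_unique)
qed

theorem C_opt_upper:
  "C_opt m p q u w v \<le> ennreal ((2 * upper_const m p q) powr (1 / q) * 2)
    * (A1 m p q u w v + A5 m p q u w v + A6 m p q u w v)"
  (is "_ \<le> ennreal ?c * (?A1 + ?A5 + ?A6)")
proof (cases "?A1 = \<infinity>")
  case True
  have "upper_const m p q > 0" using p by (rule upper_const_pos)
  then have "?c > 0" by simp
  then show ?thesis using True by (simp add: ennreal_mult_top)
next
  case False
  have pos: "upper_const m p q > 0" using p by (rule upper_const_pos)
  have fin: "tail \<sigma> t < \<infinity>" if "t > 0" for t
    using tail_\<sigma>_finite[OF _ that] False by (simp add: less_top[symmetric])
  show ?thesis
  proof (rule C_opt_least)
    fix h assume "h \<in> M_plus" and den_fin: "denom p v h < \<infinity>"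
    then obtain h' where h': "borel_version h h'" using M_plus_borel_version by blast
    then have [measurable]: "h' \<in> borel_measurable borel" by (simp add: borel_version_def)
    define G where "G = tail (\<lambda>s. h' s \<up> p * v' s) 0"
    have den: "denom p v h = G \<up> (1 / p)" using denom_eq[OF h'] by (simp add: G_def)
    have G_fin: "G < \<infinity>" using den_fin p by (simp add: den epow_eq_top_iff less_top[symmetric])
    have 5: "?A5 \<up> q = (\<integral>\<^sup>+ t. head w' t \<up> (q / (p - q)) * w' t * kernel_tail m p u' \<sigma> t \<up> (q * (p - m) / (m * (p - q))) \<partial>lborel) \<up> ((p - q) / p)"
      unfolding A5_eq epow_mult_exp[symmetric] using q by simp
    have 6: "?A6 \<up> q = tail (\<lambda>t. \<Phi> t \<up> (p / (p - q)) * tail \<sigma> t \<up> (p * (q - 1) / (p - q)) * \<sigma> t) 0 \<up> ((p - q) / p)"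
      unfolding A6_eq epow_mult_exp[symmetric] using q by simp
    have "(\<integral>\<^sup>+ t. w' t * tail (\<lambda>s. tail h' s \<up> m * u' s) t \<up> (q / m) \<partial>lborel)
      \<le> ennreal (upper_const m p q) * ((?A5 \<up> q + ?A6 \<up> q) * G \<up> (q / p))"
      unfolding 5 6 G_def \<Phi>_def
      by (rule upper_bound_borel[OF m p q])
        (use fin \<Phi>_finite weights_eq_0 Holder_density G_fin in \<open>auto simp: G_def \<Phi>_def\<close>)
    \<comment> \<open>Both q-th powers are at most the q-th power of the whole sum, which holds for
      every q > 0; this yields the factor 2 inside the power 1/q.\<close>
    also have "\<dots> \<le> ennreal (upper_const m p q) * ((2 * (?A1 + ?A5 + ?A6) \<up> q) * G \<up> (q / p))"
    proof -
      have "?A5 \<le> ?A1 + ?A5 + ?A6"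
        unfolding le_iff_add by (intro exI[of _ "?A1 + ?A6"]) (simp add: ac_simps)
      moreover have "?A6 \<le> ?A1 + ?A5 + ?A6"
        unfolding le_iff_add by (intro exI[of _ "?A1 + ?A5"]) (simp add: ac_simps)
      ultimately have "?A5 \<up> q \<le> (?A1 + ?A5 + ?A6) \<up> q" "?A6 \<up> q \<le> (?A1 + ?A5 + ?A6) \<up> q"
        using q by (auto intro!: epow_mono)
      from add_mono[OF this] have "?A5 \<up> q + ?A6 \<up> q \<le> 2 * (?A1 + ?A5 + ?A6) \<up> q" by (simp add: mult_2)
      then show ?thesis by (intro mult_left_mono mult_right_mono) auto
    qed
    finally have "numer m q u w h
      \<le> (ennreal (upper_const m p q) * ((2 * (?A1 + ?A5 + ?A6) \<up> q) * G \<up> (q / p))) \<up> (1 / q)"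
      unfolding numer_eq[OF h'] using q by (intro epow_mono) auto
    also have "\<dots> = (ennreal (2 * upper_const m p q)) \<up> (1 / q) * (?A1 + ?A5 + ?A6) * G \<up> (1 / p)"
      using q p pos by (simp add: epow_mult epow_mult_exp[symmetric] ennreal_mult mult_ac)
    also have "\<dots> \<le> ennreal ?c * (?A1 + ?A5 + ?A6) * G \<up> (1 / p)"
      using pos by (intro mult_right_mono) (auto simp: epow_ennreal intro!: ennreal_leI)
    finally show "numer m q u w h \<le> ennreal ?c * (?A1 + ?A5 + ?A6) * denom p v h" by (simp add: den)
  qed
qed

end

section \<open>The case \<open>m \<le> q\<close>\<close>

text \<open>With e = p/(p-q) and b = q(p-1)/(p-q) this is e (1/b) (b/q)^q (q/m). The factors come
  from differentiating \<Phi>^e, from integrating V^(b-1) against the density, from the lower bound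
  for H^q, and from \<open>\<rho>_H_le\<close>.\<close>

definition lower_const :: "real \<Rightarrow> real \<Rightarrow> real \<Rightarrow> real" where
  "lower_const m p q = (p / (p - q)) * ((p - q) / (q * (p - 1))) * ((p - 1) / (p - q)) powr q * (q / m)"

lemma lower_const_pos: "0 < m \<Longrightarrow> m < p \<Longrightarrow> 1 < p \<Longrightarrow> 0 < q \<Longrightarrow> q < p \<Longrightarrow> lower_const m p q > 0"
  unfolding lower_const_def by (intro mult_pos_pos) auto

lemma ennreal_const_cancel:
  assumes "c > 0"
  shows "ennreal (1 / c) * (ennreal c * x) = x" "ennreal c * (ennreal (1 / c) * x) = x"
  using assms by (simp_all add: mult.assoc[symmetric] ennreal_mult[symmetric])

context weighted_inequality
begin

lemma \<Phi>_mono: "s \<le> t \<Longrightarrow> \<Phi> s \<le> \<Phi> t"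
  unfolding \<Phi>_def head_def using m q
  by (intro nn_integral_mono) (auto simp: indicator_def intro!: mult_left_mono epow_mono mid_mono)

text \<open>If the denominator is 0, a positive numerator would make the quotient, and hence C,
  infinite.\<close>

lemma C_opt_bound:
  assumes "h \<in> M_plus" "denom p v h < \<infinity>" "C_opt m p q u w v < \<infinity>"
  shows "numer m q u w h \<le> C_opt m p q u w v * denom p v h"
proof -
  have le: "numer m q u w h / denom p v h \<le> C_opt m p q u w v"
    unfolding C_opt_def using assms(1) by (rule SUP_upper)
  show ?thesis
  proof (cases "denom p v h = 0")
    case True
    then have "numer m q u w h = 0" using le assms(3) by (auto simp: top_unique split: if_splits)
    then show ?thesis by simp
  next
    case False
    then have "numer m q u w h = numer m q u w h / denom p v h * denom p v h"
      using assms(2) by (simp add: ennreal_divide_times[symmetric] mult_divide_eq_ennreal ennreal_times_divide mult.commute)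
    also have "\<dots> \<le> C_opt m p q u w v * denom p v h" using le by (rule mult_right_mono) simp
    finally show ?thesis .
  qed
qed

text \<open>Formally \<rho> is the derivative of \<Phi>: differentiation of U(t,x)^(q/m) in x under
  the integral against w.\<close>

context
  fixes \<rho> :: "real \<Rightarrow> ennreal"
  defines "\<rho> \<equiv> \<lambda>x. u' x * head (\<lambda>t. ennreal (q / m) * mid u' t x \<up> (q / m - 1) * w' t) x"
begin

lemma measurable_\<rho> [measurable]: "\<rho> \<in> borel_measurable borel"
  unfolding \<rho>_def by (intro borel_measurable_times_ennreal measurable_head2) measurable

lemma \<rho>_integral:
  assumes [measurable]: "X \<in> borel_measurable borel"
  shows "(\<integral>\<^sup>+ x. \<rho> x * X x \<partial>lborel)
    = (\<integral>\<^sup>+ t. w' t * (ennreal (q / m) * tail (\<lambda>x. mid u' t x \<up> (q / m - 1) * u' x * X x) t) \<partial>lborel)"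
proof -
  let ?f = "\<lambda>x t. u' x * (ennreal (q / m) * mid u' t x \<up> (q / m - 1) * w' t * indicator {..<x} t) * X x"
  have "(\<integral>\<^sup>+ x. \<rho> x * X x \<partial>lborel) = (\<integral>\<^sup>+ x. (\<integral>\<^sup>+ t. ?f x t \<partial>lborel) \<partial>lborel)"
    unfolding \<rho>_def head_def by (intro nn_integral_cong) (simp add: nn_integral_cmult nn_integral_multc)
  also have "\<dots> = (\<integral>\<^sup>+ t. (\<integral>\<^sup>+ x. ?f x t \<partial>lborel) \<partial>lborel)"
    by (rule lborel_pair.Fubini') (simp add: case_prod_beta)
  also have "\<dots> = (\<integral>\<^sup>+ t. w' t * (ennreal (q / m) * tail (\<lambda>x. mid u' t x \<up> (q / m - 1) * u' x * X x) t) \<partial>lborel)"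
  proof (rule nn_integral_cong, goal_cases)
    case (1 t)
    have "(\<integral>\<^sup>+ x. ?f x t \<partial>lborel)
      = (\<integral>\<^sup>+ x. (w' t * ennreal (q / m)) * (mid u' t x \<up> (q / m - 1) * u' x * X x * indicator {t<..} x) \<partial>lborel)"
      by (intro nn_integral_cong) (auto simp: indicator_def mult_ac)
    also have "\<dots> = w' t * (ennreal (q / m) * tail (\<lambda>x. mid u' t x \<up> (q / m - 1) * u' x * X x) t)"
      unfolding tail_def[of _ t] by (subst nn_integral_cmult) (auto simp: mult.assoc)
    finally show ?case .
  qed
  finally show ?thesis .
qed

text \<open>For fixed t the density is integrated by \<open>mid_power\<close>, which needs U(t,s)
  finite. Since \<Phi>(s) is finite, this holds for almost every t with w(t) > 0.\<close>

lemma head_\<rho>: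
  assumes s: "s > 0"
  shows "head \<rho> s = \<Phi> s"
proof -
  have a: "q / m > 0" using m q by simp
  have "head \<rho> s = (\<integral>\<^sup>+ t. w' t * (ennreal (q / m) * tail (\<lambda>x. mid u' t x \<up> (q / m - 1) * u' x * indicator {..<s} x) t) \<partial>lborel)"
    unfolding head_def[of \<rho>] by (rule \<rho>_integral) measurable
  also have "\<dots> = (\<integral>\<^sup>+ t. w' t * mid u' t s \<up> (q / m) * indicator {..<s} t \<partial>lborel)"
  proof (rule nn_integral_cong_AE)
    have "AE t in lborel. w' t * mid u' t s \<up> (q / m) * indicator {..<s} t \<noteq> \<infinity>"
      using \<Phi>_finite(1)[OF s] unfolding \<Phi>_def head_def by (intro nn_integral_PInf_AE) auto
    then show "AE t in lborel. w' t * (ennreal (q / m) * tail (\<lambda>x. mid u' t x \<up> (q / m - 1) * u' x * indicator {..<s} x) t)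
      = w' t * mid u' t s \<up> (q / m) * indicator {..<s} t"
    proof eventually_elim
      case (elim t)
      show ?case
      proof (cases "t < s \<and> w' t \<noteq> 0")
        case False
        have "tail (\<lambda>x. mid u' t x \<up> (q / m - 1) * u' x * indicator {..<s} x) t = tail (\<lambda>_. 0) t" if "\<not> t < s"
          using that by (intro tail_cong) auto
        then show ?thesis using False by (auto simp: tail_def)
      next
        case True
        then have fin: "mid u' t s < \<infinity>"
          using elim a by (auto simp: ennreal_mult_eq_top_iff epow_eq_top_iff less_top)
        have "tail (\<lambda>x. mid u' t x \<up> (q / m - 1) * u' x * indicator {..<s} x) t
            = mid (\<lambda>x. mid u' t x \<up> (q / m - 1) * u' x) t s"
          unfolding tail_def[of _ t] mid_def[of _ t s]
          by (intro nn_integral_cong) (auto simp: indicator_def)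
        also have "\<dots> = ennreal (1 / (q / m)) * mid u' t s \<up> (q / m)"
          by (rule mid_power) (use fin a in auto)
        finally show ?thesis
          using True ennreal_const_cancel(2)[OF a, of "mid u' t s \<up> (q / m)"] by simp
      qed
    qed
  qed
  also have "\<dots> = \<Phi> s" by (simp add: \<Phi>_def head_def)
  finally show ?thesis .
qed

lemma \<Phi>_power:
  assumes s: "s > 0" and e: "e > 0"
  shows "\<Phi> s \<up> e = ennreal e * head (\<lambda>x. \<Phi> x \<up> (e - 1) * \<rho> x) s"
proof -
  have "head (\<lambda>x. \<Phi> x \<up> (e - 1) * \<rho> x) s = head (\<lambda>x. head \<rho> x \<up> (e - 1) * \<rho> x) s"
    unfolding head_def[of _ s]
  proof (rule nn_integral_cong, goal_cases)
    case (1 x)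
    show ?case
      using head_\<rho>[of x] weights_eq_0(1)[of x] by (cases "x > 0") (auto simp: \<rho>_def)
  qed
  also have "\<dots> = ennreal (1 / e) * head \<rho> s \<up> e"
    by (rule head_power) (use head_\<rho>[OF s] \<Phi>_finite[OF s] e in auto)
  finally show ?thesis
    using ennreal_const_cancel(2)[OF e] by (simp add: head_\<rho>[OF s])
qed

text \<open>Split H^q = (H^m)^(q/m-1) H^m. Since H is nonincreasing, U(t,x) H(x)^m is at most Y(t),
  so the first factor together with the power of U is at most Y(t)^(q/m-1), and H^m u integrates to
  one more factor Y(t). Here m <= q enters: the exponent q/m - 1 must not be negative.\<close>

lemma \<rho>_H_le:
  assumes mq: "m \<le> q" and [measurable]: "H \<in> borel_measurable borel"
    and H: "\<And>s t. s \<le> t \<Longrightarrow> H t \<le> H s"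
  shows "(\<integral>\<^sup>+ x. \<rho> x * H x \<up> q \<partial>lborel)
    \<le> ennreal (q / m) * (\<integral>\<^sup>+ t. w' t * tail (\<lambda>s. H s \<up> m * u' s) t \<up> (q / m) \<partial>lborel)"
proof -
  have a: "q / m - 1 \<ge> 0" using mq m by simp
  define Y where "Y = (\<lambda>t. tail (\<lambda>s. H s \<up> m * u' s) t)"
  have [measurable]: "Y \<in> borel_measurable borel" unfolding Y_def by measurable
  have "(\<integral>\<^sup>+ x. \<rho> x * H x \<up> q \<partial>lborel)
      = (\<integral>\<^sup>+ t. w' t * (ennreal (q / m) * tail (\<lambda>x. mid u' t x \<up> (q / m - 1) * u' x * H x \<up> q) t) \<partial>lborel)"
    by (rule \<rho>_integral) measurable
  also have "\<dots> \<le> (\<integral>\<^sup>+ t. w' t * (ennreal (q / m) * Y t \<up> (q / m)) \<partial>lborel)"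
  proof (intro nn_integral_mono mult_left_mono)
    fix t :: real
    have "tail (\<lambda>x. mid u' t x \<up> (q / m - 1) * u' x * H x \<up> q) t
        \<le> tail (\<lambda>x. Y t \<up> (q / m - 1) * (H x \<up> m * u' x)) t"
    proof (rule tail_mono_fun, goal_cases)
      case (1 x)
      have "mid u' t x * H x \<up> m = (\<integral>\<^sup>+ y. u' y * indicator {t<..<x} y * H x \<up> m \<partial>lborel)"
        unfolding mid_def by (subst nn_integral_multc) auto
      also have "\<dots> \<le> Y t"
        unfolding Y_def tail_def using m H
        by (intro nn_integral_mono) (auto simp: indicator_def mult.commute intro!: mult_left_mono epow_mono)
      finally have "(mid u' t x * H x \<up> m) \<up> (q / m - 1) \<le> Y t \<up> (q / m - 1)"
        using a by (rule epow_mono)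
      then have "(mid u' t x * H x \<up> m) \<up> (q / m - 1) * (H x \<up> m * u' x) \<le> Y t \<up> (q / m - 1) * (H x \<up> m * u' x)"
        by (rule mult_right_mono) simp
      moreover have "H x \<up> q = (H x \<up> m) \<up> (q / m - 1) * H x \<up> m"
        using epow_add[OF a, of 1 "H x \<up> m"] m by (simp add: epow_mult_exp[symmetric])
      ultimately show ?case
        using a by (simp add: epow_mult mult_ac)
    qed
    also have "\<dots> = Y t \<up> (q / m - 1) * Y t"
      unfolding Y_def tail_def[of _ t] by (subst nn_integral_cmult[symmetric]) (auto simp: mult.assoc)
    also have "\<dots> = Y t \<up> (q / m)"
      using epow_add[OF a, of 1 "Y t"] by simp
    finally show "tail (\<lambda>x. mid u' t x \<up> (q / m - 1) * u' x * H x \<up> q) t \<le> Y t \<up> (q / m)" .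
  qed auto
  also have "\<dots> = ennreal (q / m) * (\<integral>\<^sup>+ t. w' t * Y t \<up> (q / m) \<partial>lborel)"
    by (subst nn_integral_cmult[symmetric]) (auto simp: mult_ac)
  finally show ?thesis unfolding Y_def .
qed

end

text \<open>Let D be the left side. The test function satisfies h^p v <= integrand of D, and D is at
  most K times the numerator to the power q. So D^(1/q) <= K^(1/q) C D^(1/p), and division by
  D^(1/p) leaves D^(1/r). Truncating \<sigma> in value and support makes D finite, so that the
  division is legitimate.\<close>

lemma A6_truncated_le:
  fixes n :: nat
  assumes mq: "m \<le> q" and Cfin: "C_opt m p q u w v < \<infinity>"
  defines "\<tau> \<equiv> \<lambda>s. min (\<sigma> s) (of_nat n) * indicator {0<..<real n} s"
  defines "K \<equiv> lower_const m p q"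
  shows "tail (\<lambda>t. \<Phi> t \<up> (p / (p - q)) * tail \<tau> t \<up> (p * (q - 1) / (p - q)) * \<tau> t) 0
    \<le> (ennreal (K powr (1 / q)) * C_opt m p q u w v) \<up> (p * q / (p - q))"
proof -
  define e where "e = p / (p - q)"
  \<comment> \<open>This b satisfies (b/q - 1) p = b - 1, so that h^p v has the power of V required
    in D, while integrating h produces V^(b/q), whose q-th power is V^b.\<close>
  define b where "b = q * (p - 1) / (p - q)"
  have eb: "e > 0" "b > 0" "e - 1 = q / (p - q)" "b - 1 = p * (q - 1) / (p - q)"
      "b / q - 1 = (q - 1) / (p - q)" "b / q > 0"
    using p q by (auto simp: e_def b_def field_simps)
  have [measurable]: "\<tau> \<in> borel_measurable borel" unfolding \<tau>_def by measurable
  have \<tau>_le: "\<tau> s \<le> \<sigma> s" "\<tau> s \<le> of_nat n * indicator {0<..<real n} s" for s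
    by (auto simp: \<tau>_def indicator_def)
  have V_fin: "tail \<tau> x < \<infinity>" for x
  proof -
    have "tail \<tau> x \<le> (\<integral>\<^sup>+ s. of_nat n * indicator {0<..<real n} s \<partial>lborel)"
      unfolding tail_def using \<tau>_le by (intro nn_integral_mono) (auto simp: \<tau>_def indicator_def)
    also have "\<dots> = of_nat n * ennreal (real n)" by (subst nn_integral_cmult) auto
    also have "\<dots> < \<infinity>" by (simp add: ennreal_mult_less_top of_nat_less_top)
    finally show ?thesis .
  qed
  define D where "D = tail (\<lambda>t. \<Phi> t \<up> e * tail \<tau> t \<up> (b - 1) * \<tau> t) 0"
  define h where "h = (\<lambda>s. \<tau> s * tail \<tau> s \<up> (b / q - 1) * \<Phi> s \<up> (1 / (p - q)))"
  have h_meas[measurable]: "h \<in> borel_measurable borel" unfolding h_def by measurable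
  have h_version: "borel_version h h" using h_meas by (auto simp: borel_version_def h_def \<tau>_def)
  have "tail (\<lambda>s. h s \<up> p * v' s) 0 \<le> D"
    unfolding D_def
  proof (rule tail_mono_fun, goal_cases)
    case (1 s)
    note s = 1
    have ex: "(b / q - 1) * p = b - 1" "1 / (p - q) * p = e"
      by (simp_all add: eb e_def)
    \<comment> \<open>From \<tau> <= \<sigma> and \<sigma>^(p-1) = 1/v follows \<tau>^(p-1) v <=
      1.\<close>
    have "\<tau> s \<up> p * v' s = \<tau> s * (\<tau> s \<up> (p - 1) * v' s)"
      using epow_add[of 1 "p - 1" "\<tau> s"] p by (simp add: mult.assoc)
    also have "\<dots> \<le> \<tau> s * ((v' s \<up> (1 - conj_exp p)) \<up> (p - 1) * v' s)"
      using p \<tau>_le(1)[of s] s by (intro mult_left_mono mult_right_mono epow_mono) (auto simp: \<sigma>_def)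
    also have "(v' s \<up> (1 - conj_exp p)) \<up> (p - 1) = v' s \<up> (- 1)"
      using p by (simp add: epow_mult_exp[symmetric] exponents)
    also have "v' s \<up> (- 1) * v' s \<le> 1" by (rule epow_pow_minus_one)
    finally have "\<tau> s \<up> p * v' s \<le> \<tau> s" by (simp add: mult_left_mono)
    then have "\<Phi> s \<up> e * tail \<tau> s \<up> (b - 1) * (\<tau> s \<up> p * v' s) \<le> \<Phi> s \<up> e * tail \<tau> s \<up> (b - 1) * \<tau> s"
      by (rule mult_left_mono) simp
    moreover have "h s \<up> p = \<tau> s \<up> p * tail \<tau> s \<up> (b - 1) * \<Phi> s \<up> e"
      using p by (simp add: h_def epow_mult epow_mult_exp[symmetric] ex(1) e_def)
    ultimately show ?case
      by (simp add: mult_ac)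
  qed
  then have den: "denom p v h \<le> D \<up> (1 / p)"
    unfolding denom_eq[OF h_version] using p by (intro epow_mono) auto
  have "D \<le> (\<integral>\<^sup>+ s. \<Phi> (real n + 1) \<up> e * (tail \<tau> s \<up> (b - 1) * \<tau> s * indicator {0<..} s) \<partial>lborel)"
    unfolding D_def tail_def[of _ 0]
  proof (rule nn_integral_mono, goal_cases)
    case (1 s)
    show ?case
    proof (cases "s < real n")
      case True
      then have "\<Phi> s \<up> e \<le> \<Phi> (real n + 1) \<up> e" using eb by (intro epow_mono \<Phi>_mono) auto
      then show ?thesis unfolding mult.assoc by (rule mult_right_mono) simp
    qed (simp add: \<tau>_def)
  qed
  also have "\<dots> = \<Phi> (real n + 1) \<up> e * tail (\<lambda>s. tail \<tau> s \<up> (b - 1) * \<tau> s) 0"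
    unfolding tail_def[of _ 0] by (rule nn_integral_cmult) measurable
  also have "\<dots> = \<Phi> (real n + 1) \<up> e * (ennreal (1 / b) * tail \<tau> 0 \<up> b)"
    using V_fin eb by (subst tail_power) auto
  also have "\<dots> < \<infinity>"
    using eb \<Phi>_finite(1)[of "real n + 1"] V_fin by (auto simp: ennreal_mult_less_top intro!: epow_less_top[unfolded infinity_ennreal_def])
  finally have D_fin: "D < \<infinity>" .
  define H where "H = tail h"
  have [measurable]: "H \<in> borel_measurable borel" unfolding H_def by measurable
  define \<rho> where "\<rho> = (\<lambda>x. u' x * head (\<lambda>t. ennreal (q / m) * mid u' t x \<up> (q / m - 1) * w' t) x)"
  have [measurable]: "\<rho> \<in> borel_measurable borel" unfolding \<rho>_def by (rule measurable_\<rho>)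
  \<comment> \<open>\<Phi> is nondecreasing, so its value at x can be taken out of the integral of h
    over the points beyond x; the rest is integrated by \<open>tail_power\<close>.\<close>
  have H_low: "\<Phi> x \<up> (q / (p - q)) * tail \<tau> x \<up> b \<le> ennreal ((b / q) powr q) * H x \<up> q" for x
  proof -
    have "\<Phi> x \<up> (1 / (p - q)) * tail (\<lambda>s. tail \<tau> s \<up> (b / q - 1) * \<tau> s) x
        = tail (\<lambda>s. \<Phi> x \<up> (1 / (p - q)) * (tail \<tau> s \<up> (b / q - 1) * \<tau> s)) x"
      unfolding tail_def[of _ x] by (subst nn_integral_cmult[symmetric]) (auto simp: mult.assoc)
    also have "\<dots> \<le> H x"
      unfolding H_def
    proof (rule tail_mono_fun, goal_cases)
      case (1 s)
      then have "\<Phi> x \<up> (1 / (p - q)) \<le> \<Phi> s \<up> (1 / (p - q))" using q by (intro epow_mono \<Phi>_mono) auto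
      from mult_right_mono[OF this, of "tail \<tau> s \<up> (b / q - 1) * \<tau> s"]
      show ?case
        by (simp add: h_def mult_ac)
    qed
    also have "tail (\<lambda>s. tail \<tau> s \<up> (b / q - 1) * \<tau> s) x = ennreal (1 / (b / q)) * tail \<tau> x \<up> (b / q)"
      using V_fin eb by (intro tail_power) auto
    finally have "\<Phi> x \<up> (1 / (p - q)) * (ennreal (1 / (b / q)) * tail \<tau> x \<up> (b / q)) \<le> H x" .
    from mult_left_mono[OF this, of "ennreal (b / q)"]
    have "\<Phi> x \<up> (1 / (p - q)) * tail \<tau> x \<up> (b / q) \<le> ennreal (b / q) * H x"
      using ennreal_const_cancel(2)[OF eb(6)] by (simp add: mult.left_commute)
    then have "(\<Phi> x \<up> (1 / (p - q)) * tail \<tau> x \<up> (b / q)) \<up> q \<le> (ennreal (b / q) * H x) \<up> q"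
      using q by (intro epow_mono) auto
    then show ?thesis using q eb by (simp add: epow_mult epow_mult_exp[symmetric] epow_ennreal)
  qed
  \<comment> \<open>\<Phi>^e is replaced by the integral of e \<Phi>^(e-1) \<rho>. After the
    exchange the inner integral over s > x is V^b / b, and \<open>H_low\<close> applies because e -
    1 = q/(p-q).\<close>
  let ?F = "\<lambda>x s. ennreal e * (\<Phi> x \<up> (e - 1) * \<rho> x * indicator {..<s} x) * (tail \<tau> s \<up> (b - 1) * \<tau> s * indicator {0<..} s)"
  have "D = (\<integral>\<^sup>+ s. (\<integral>\<^sup>+ x. ?F x s \<partial>lborel) \<partial>lborel)"
    unfolding D_def tail_def[of _ 0]
  proof (rule nn_integral_cong, goal_cases)
    case (1 s)
    show ?case
    proof (cases "s > 0")
      case True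
      then have "\<Phi> s \<up> e = ennreal e * head (\<lambda>x. \<Phi> x \<up> (e - 1) * \<rho> x) s"
        unfolding \<rho>_def using eb by (intro \<Phi>_power) auto
      then show ?thesis using True
        unfolding head_def by (subst nn_integral_multc, simp, subst nn_integral_cmult) (auto simp: mult.assoc)
    qed simp
  qed
  also have "\<dots> = (\<integral>\<^sup>+ x. (\<integral>\<^sup>+ s. ?F x s \<partial>lborel) \<partial>lborel)"
    by (rule lborel_pair.Fubini') (simp add: case_prod_beta)
  also have "\<dots> \<le> (\<integral>\<^sup>+ x. ennreal (e * (1 / b) * (b / q) powr q) * (\<rho> x * H x \<up> q) \<partial>lborel)"
  proof (rule nn_integral_mono, goal_cases)
    case (1 x)
    have "(\<integral>\<^sup>+ s. ?F x s \<partial>lborel)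
        \<le> (\<integral>\<^sup>+ s. ennreal e * (\<Phi> x \<up> (e - 1) * \<rho> x) * (tail \<tau> s \<up> (b - 1) * \<tau> s * indicator {x<..} s) \<partial>lborel)"
      by (intro nn_integral_mono) (auto simp: indicator_def)
    also have "\<dots> = ennreal e * (\<Phi> x \<up> (e - 1) * \<rho> x) * tail (\<lambda>s. tail \<tau> s \<up> (b - 1) * \<tau> s) x"
      unfolding tail_def[of _ x] by (rule nn_integral_cmult) measurable
    also have "\<dots> = ennreal e * (\<Phi> x \<up> (e - 1) * \<rho> x) * (ennreal (1 / b) * tail \<tau> x \<up> b)"
      using V_fin eb by (subst tail_power) auto
    also have "\<dots> = ennreal e * ennreal (1 / b) * \<rho> x * (\<Phi> x \<up> (q / (p - q)) * tail \<tau> x \<up> b)"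
      by (simp add: eb(3) mult_ac)
    also have "\<dots> \<le> ennreal e * ennreal (1 / b) * \<rho> x * (ennreal ((b / q) powr q) * H x \<up> q)"
      by (intro mult_left_mono H_low) auto
    also have "\<dots> = ennreal e * ennreal (1 / b) * ennreal ((b / q) powr q) * (\<rho> x * H x \<up> q)"
      by (simp only: mult_ac)
    also have "ennreal e * ennreal (1 / b) * ennreal ((b / q) powr q) = ennreal (e * (1 / b) * (b / q) powr q)"
      using eb by (simp add: ennreal_mult[symmetric])
    finally show ?case .
  qed
  also have "\<dots> = ennreal (e * (1 / b) * (b / q) powr q) * (\<integral>\<^sup>+ x. \<rho> x * H x \<up> q \<partial>lborel)"
    by (rule nn_integral_cmult) measurable
  also have "(\<integral>\<^sup>+ x. \<rho> x * H x \<up> q \<partial>lborel)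
    \<le> ennreal (q / m) * (\<integral>\<^sup>+ t. w' t * tail (\<lambda>s. H s \<up> m * u' s) t \<up> (q / m) \<partial>lborel)"
    unfolding \<rho>_def by (rule \<rho>_H_le[OF mq]) (auto simp: H_def tail_antimono)
  also have "(\<integral>\<^sup>+ t. w' t * tail (\<lambda>s. H s \<up> m * u' s) t \<up> (q / m) \<partial>lborel) = numer m q u w h \<up> q"
    unfolding numer_eq[OF h_version] H_def using q by (simp add: epow_inverse)
  finally have "D \<le> ennreal (e * (1 / b) * (b / q) powr q) * (ennreal (q / m) * numer m q u w h \<up> q)"
    by (simp add: mult_left_mono)
  also have "\<dots> = ennreal K * numer m q u w h \<up> q"
  proof -
    have "K = e * (1 / b) * (b / q) powr q * (q / m)"
      using q by (simp add: K_def lower_const_def e_def b_def)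
    then have "ennreal K = ennreal (e * (1 / b) * (b / q) powr q) * ennreal (q / m)"
      using eb m q by (simp add: ennreal_mult[symmetric])
    then show ?thesis by (simp only: mult.assoc)
  qed
  finally have "D \<up> (1 / q) \<le> (ennreal K * numer m q u w h \<up> q) \<up> (1 / q)"
    using q by (intro epow_mono) auto
  also have "\<dots> = ennreal (K powr (1 / q)) * numer m q u w h"
  proof -
    have "K > 0" unfolding K_def using m p q by (rule lower_const_pos)
    then show ?thesis using q by (simp add: epow_mult epow_ennreal epow_inverse)
  qed
  also have "numer m q u w h \<le> C_opt m p q u w v * denom p v h"
  proof (rule C_opt_bound[OF borel_measurable_M_plus[OF h_meas] _ Cfin])
    show "denom p v h < \<infinity>"
      using den D_fin p by (intro le_less_trans[OF den] epow_less_top) auto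
  qed
  also have "\<dots> \<le> C_opt m p q u w v * D \<up> (1 / p)" by (rule mult_left_mono[OF den]) simp
  finally have le: "D \<up> (1 / q) \<le> ennreal (K powr (1 / q)) * C_opt m p q u w v * D \<up> (1 / p)"
    by (simp add: mult_left_mono mult.assoc)
  have "D \<up> (1 / (p * q / (p - q))) \<le> ennreal (K powr (1 / q)) * C_opt m p q u w v"
  proof (cases "D = 0")
    case True
    then show ?thesis using p q by (simp add: epow_0_left)
  next
    case False
    have "D \<up> (1 / p) * D \<up> (1 / (p * q / (p - q))) = D \<up> (1 / p + 1 / (p * q / (p - q)))"
      using p q by (intro epow_add[symmetric]) auto
    also have "1 / p + 1 / (p * q / (p - q)) = 1 / q" using p q by (simp add: field_simps)
    finally have "D \<up> (1 / p) * D \<up> (1 / (p * q / (p - q)))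
        \<le> D \<up> (1 / p) * (ennreal (K powr (1 / q)) * C_opt m p q u w v)"
      using le by (simp add: mult.commute)
    moreover have "D \<up> (1 / p) \<noteq> 0" "D \<up> (1 / p) \<noteq> top"
      using False D_fin p by (simp_all add: epow_eq_0_iff epow_eq_top_iff less_top)
    ultimately show ?thesis by (simp add: ennreal_mult_le_mult_iff)
  qed
  then have "(D \<up> (1 / (p * q / (p - q)))) \<up> (p * q / (p - q))
      \<le> (ennreal (K powr (1 / q)) * C_opt m p q u w v) \<up> (p * q / (p - q))"
    using p q by (intro epow_mono) auto
  also have "(D \<up> (1 / (p * q / (p - q)))) \<up> (p * q / (p - q)) = D"
    using p q by (intro epow_inverse) auto
  finally show ?thesis unfolding D_def eb(4) e_def .
qed

theorem A6_le:
  assumes mq: "m \<le> q"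
  defines "K \<equiv> lower_const m p q"
  shows "A6 m p q u w v \<le> ennreal (K powr (1 / q)) * C_opt m p q u w v"
proof (cases "C_opt m p q u w v < \<infinity>")
  case False
  have "K > 0" unfolding K_def using m p q by (rule lower_const_pos)
  then have "ennreal (K powr (1 / q)) \<noteq> 0" by simp
  then show ?thesis using False by (simp add: less_top[symmetric] ennreal_mult_top)
next
  case True
  define \<tau> where "\<tau> = (\<lambda>n s. min (\<sigma> s) (of_nat n) * indicator {0<..<real n} s)"
  define b where "b = p * (q - 1) / (p - q)"
  define e where "e = p / (p - q)"
  define X where "X = (ennreal (K powr (1 / q)) * C_opt m p q u w v) \<up> (p * q / (p - q))"
  have [measurable]: "\<tau> n \<in> borel_measurable borel" for n unfolding \<tau>_def by measurable
  have \<tau>_mono: "\<tau> k s \<le> \<tau> n s" if "k \<le> n" for k n s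
    unfolding \<tau>_def using that by (intro mult_mono min.mono) (auto simp: indicator_def)
  have \<tau>_SUP: "(SUP n. \<tau> n s) = \<sigma> s" for s
  proof (cases "s > 0")
    case True
    obtain k where "s < real k" using reals_Archimedean2 by blast
    then have "eventually (\<lambda>n. 0 < s \<and> s < real n) sequentially"
      unfolding eventually_sequentially using True by (intro exI[of _ k]) auto
    from SUP_min_of_nat[OF this, of "\<sigma> s"] show ?thesis by (simp add: \<tau>_def indicator_def)
  qed (simp add: \<tau>_def weights_eq_0)
  have \<tau>_le: "\<tau> n s \<le> \<sigma> s" for n s by (auto simp: \<tau>_def indicator_def)
  have bound: "tail (\<lambda>t. \<Phi> t \<up> e * tail (\<tau> n) t \<up> b * \<tau> n t) 0 \<le> X" for n
    unfolding X_def K_def \<tau>_def b_def e_def by (rule A6_truncated_le[OF mq True])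
  \<comment> \<open>For b < 0 the powers of the truncated tails decrease in n, so the integrands
    need not be monotone in n. Then the power of the full tail serves as lower bound; otherwise the
    powers of the truncated tails increase. In both cases Z k is increasing in k and lies below the
    n-th power for n >= k, so the limits in n and in k can be taken one after the other.\<close>
  define Z where "Z = (\<lambda>k t. if b < 0 then tail \<sigma> t \<up> b else tail (\<tau> k) t \<up> b)"
  have [measurable]: "Z k \<in> borel_measurable borel" for k unfolding Z_def by measurable
  have Z_le: "Z k t \<le> tail (\<tau> n) t \<up> b" if "k \<le> n" for k n t
  proof (cases "b < 0")
    case True
    then show ?thesis using \<tau>_le by (simp add: Z_def epow_antimono tail_mono_fun)
  next
    case False
    then show ?thesis using \<tau>_mono[OF that] by (simp add: Z_def epow_mono tail_mono_fun)
  qed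
  have Z_mono: "Z k t \<le> Z n t" if "k \<le> n" for k n t
    using Z_le[OF that] by (auto simp: Z_def)
  have V_SUP: "(SUP n. tail (\<tau> n) t) = tail \<sigma> t" for t
  proof -
    have "tail \<sigma> t = (\<integral>\<^sup>+ s. (SUP n. \<tau> n s * indicator {t<..} s) \<partial>lborel)"
      unfolding tail_def by (simp add: \<tau>_SUP[symmetric] SUP_mult_right_ennreal)
    also have "\<dots> = (SUP n. tail (\<tau> n) t)"
      unfolding tail_def using \<tau>_mono
      by (intro nn_integral_monotone_convergence_SUP) (auto intro!: incseq_SucI le_funI mult_right_mono)
    finally show ?thesis by simp
  qed
  have Z_SUP: "(SUP k. Z k t) = tail \<sigma> t \<up> b" for t
  proof -
    consider "b < 0" | "b = 0" | "b > 0" by linarith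
    then show ?thesis
      by cases (simp_all add: Z_def V_SUP[symmetric] epow_SUP)
  qed
  have "tail (\<lambda>t. \<Phi> t \<up> e * Z k t * \<sigma> t) 0 \<le> X" for k
  proof -
    have "tail (\<lambda>t. \<Phi> t \<up> e * Z k t * \<sigma> t) 0
        = (\<integral>\<^sup>+ t. (SUP n. \<Phi> t \<up> e * Z k t * \<tau> n t * indicator {0<..} t) \<partial>lborel)"
      unfolding tail_def[of _ 0]
      by (simp add: \<tau>_SUP[symmetric] SUP_mult_left_ennreal SUP_mult_right_ennreal)
    also have "\<dots> = (SUP n. tail (\<lambda>t. \<Phi> t \<up> e * Z k t * \<tau> n t) 0)"
      unfolding tail_def[of _ 0] using \<tau>_mono
      by (intro nn_integral_monotone_convergence_SUP) (auto intro!: incseq_SucI le_funI mult_right_mono mult_left_mono)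
    also have "\<dots> \<le> X"
    proof (rule SUP_least)
      fix n
      have "tail (\<lambda>t. \<Phi> t \<up> e * Z k t * \<tau> n t) 0
          \<le> tail (\<lambda>t. \<Phi> t \<up> e * tail (\<tau> (max k n)) t \<up> b * \<tau> (max k n) t) 0"
        by (intro tail_mono_fun mult_mono Z_le \<tau>_mono) auto
      also have "\<dots> \<le> X" by (rule bound)
      finally show "tail (\<lambda>t. \<Phi> t \<up> e * Z k t * \<tau> n t) 0 \<le> X" .
    qed
    finally show ?thesis .
  qed
  moreover have "tail (\<lambda>t. \<Phi> t \<up> e * tail \<sigma> t \<up> b * \<sigma> t) 0 = (SUP k. tail (\<lambda>t. \<Phi> t \<up> e * Z k t * \<sigma> t) 0)"
  proof -
    have "tail (\<lambda>t. \<Phi> t \<up> e * tail \<sigma> t \<up> b * \<sigma> t) 0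
        = (\<integral>\<^sup>+ t. (SUP k. \<Phi> t \<up> e * Z k t * \<sigma> t * indicator {0<..} t) \<partial>lborel)"
      unfolding tail_def[of _ 0]
      by (simp add: Z_SUP[symmetric] SUP_mult_left_ennreal SUP_mult_right_ennreal)
    also have "\<dots> = (SUP k. tail (\<lambda>t. \<Phi> t \<up> e * Z k t * \<sigma> t) 0)"
      unfolding tail_def[of _ 0] using Z_mono
      by (intro nn_integral_monotone_convergence_SUP) (auto intro!: incseq_SucI le_funI mult_right_mono mult_left_mono)
    finally show ?thesis .
  qed
  ultimately have "tail (\<lambda>t. \<Phi> t \<up> e * tail \<sigma> t \<up> b * \<sigma> t) 0 \<le> X"
    by (auto intro: SUP_least)
  then have "A6 m p q u w v \<le> X \<up> ((p - q) / (p * q))"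
    unfolding A6_eq e_def b_def using p q by (intro epow_mono) auto
  also have "\<dots> = ennreal (K powr (1 / q)) * C_opt m p q u w v"
    unfolding X_def epow_mult_exp[symmetric] using p q by simp
  finally show ?thesis .
qed

end

section \<open>The case \<open>q < m\<close>\<close>

lemma tail_exp:
  assumes "c > 0"
  shows "tail (\<lambda>s. ennreal (exp (- c * s))) t = ennreal (exp (- c * t) / c)"
proof -
  have "tail (\<lambda>s. ennreal (exp (- c * s))) t = (\<integral>\<^sup>+ s. ennreal (exp (- c * s)) * indicator {t..} s \<partial>lborel)"
    unfolding tail_def
  proof (rule nn_integral_cong_AE, goal_cases)
    case 1
    show ?case
      using AE_lborel_singleton[of t] by eventually_elim (auto simp: indicator_def)
  qed
  also have "\<dots> = ennreal (0 - (- exp (- c * t) / c))"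
  proof (rule nn_integral_FTC_atLeast)
    show "((\<lambda>s. - exp (- c * s) / c) has_real_derivative exp (- c * s)) (at s)" for s
      using assms by (auto intro!: derivative_eq_intros)
    have "((\<lambda>s. exp (- (c * s))) \<longlongrightarrow> 0) at_top"
      using assms by (intro filterlim_compose[OF exp_at_bot] filterlim_uminus_at_bot_at_top[THEN filterlim_compose]
        filterlim_tendsto_pos_mult_at_top[OF tendsto_const _ filterlim_ident])
    then have "((\<lambda>s. - exp (- c * s) / c) \<longlongrightarrow> - 0 / c) at_top"
      using assms by (intro tendsto_intros) auto
    then show "((\<lambda>s. - exp (- c * s) / c) \<longlongrightarrow> 0) at_top" by simp
  qed auto
  finally show ?thesis by simp
qed

lemma head_exp:
  assumes "c > 0"
  shows "head (\<lambda>s. ennreal (exp (c * s))) t = ennreal (exp (c * t) / c)"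
proof -
  have "head (\<lambda>s. ennreal (exp (c * s))) t = tail (\<lambda>s. ennreal (exp (- c * s))) (- t)"
    unfolding head_def tail_def
    by (subst nn_integral_real_affine[where c="-1" and t=0]) (auto intro!: nn_integral_cong simp: indicator_def)
  then show ?thesis using tail_exp[OF assms, of "- t"] by simp
qed

section \<open>The weights of the counterexample\<close>

locale counterexample =
  fixes m p q :: real and N :: nat
  assumes m: "0 < m" "m < p" and p: "1 < p" and q: "0 < q" "q < p" and N: "3 \<le> N"
begin

text \<open>The rate m/p' makes \<Phi>^(p/(p-q)) grow exactly as fast as the remaining factors of
  \<open>A6\<close> decay; the same rate balances the kernel of \<open>A5\<close>.\<close>

definition \<kappa> where "\<kappa> = m * (1 - 1 / p)"

definition u :: "real \<Rightarrow> ennreal" where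
  "u = (\<lambda>y. ennreal (exp (\<kappa> * y)) * indicator {0<..<real N} y)"

definition w :: "real \<Rightarrow> ennreal" where
  "w = indicator {0<..<1}"

definition v :: "real \<Rightarrow> ennreal" where
  "v = (\<lambda>s. ennreal (exp ((p - 1) * s)) * indicator {0<..} s)"

lemma measurable_uwv [measurable]:
  "u \<in> borel_measurable borel" "w \<in> borel_measurable borel" "v \<in> borel_measurable borel"
  unfolding u_def w_def v_def by measurable

lemma weights_uwv: "weights m p q u w v u w v"
  using m p q by unfold_locales (auto simp: borel_version_def u_def w_def v_def indicator_def)

lemma \<kappa>_pos: "\<kappa> > 0"
  using m p by (simp add: \<kappa>_def)

lemma \<sigma>_eq: "weights.\<sigma> p v s = ennreal (exp (- 1 * s)) * indicator {0<..} s"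
proof -
  interpret weights m p q u w v u w v by (rule weights_uwv)
  show ?thesis
    unfolding \<sigma>_def using p by (auto simp: v_def indicator_def epow_ennreal exp_powr_real exponents)
qed

lemma tail_\<sigma>: "t \<ge> 0 \<Longrightarrow> tail (weights.\<sigma> p v) t = ennreal (exp (- t))"
  using tail_exp[of 1 t] tail_cong[of t "weights.\<sigma> p v" "\<lambda>s. ennreal (exp (- 1 * s))"] by (simp add: \<sigma>_eq)

lemma mid_u_le: "mid u t s \<le> ennreal (exp (\<kappa> * min s (real N)) / \<kappa>)"
proof -
  have "mid u t s \<le> head (\<lambda>s. ennreal (exp (\<kappa> * s))) (min s (real N))"
    unfolding mid_def head_def u_def by (intro nn_integral_mono) (auto simp: indicator_def)
  then show ?thesis unfolding head_exp[OF \<kappa>_pos] .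
qed

lemma mid_u_ge:
  assumes "0 \<le> s" "s \<le> x" "x \<le> t" "t \<le> real N"
  shows "mid u s t \<ge> ennreal (exp (\<kappa> * x) * (t - x))"
proof -
  have "ennreal (exp (\<kappa> * x) * (t - x)) = (\<integral>\<^sup>+ y. ennreal (exp (\<kappa> * x)) * indicator {x<..<t} y \<partial>lborel)"
    using assms by (subst nn_integral_cmult) (auto simp: ennreal_mult)
  also have "\<dots> \<le> mid u s t"
    unfolding mid_def u_def using assms \<kappa>_pos by (intro nn_integral_mono) (auto simp: indicator_def intro!: ennreal_leI)
  finally show ?thesis .
qed

lemma admissible_uw: "admissible m q u w"
  unfolding admissible_def
proof (intro allI impI conjI)
  interpret weights m p q u w v u w v by (rule weights_uwv)
  fix t :: real assume t: "t > 0"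
  have a: "q / m > 0" using m q by simp
  \<comment> \<open>For s < c the interval (c, 2c) lies inside (s,t) and (0,N), so
    \<open>mid u s t\<close> >= c, and w = 1 on (0,c).\<close>
  define c where "c = min t 1 / 2"
  have c: "c > 0" "2 * c \<le> t" "2 * c \<le> 1" using t by (auto simp: c_def)
  have "ennreal c \<up> (q / m) * ennreal c = (\<integral>\<^sup>+ s. ennreal c \<up> (q / m) * indicator {0<..<c} s \<partial>lborel)"
    using c by (subst nn_integral_cmult) auto
  also have "\<dots> \<le> \<Phi> t"
    unfolding \<Phi>_def head_def
  proof (rule nn_integral_mono, goal_cases)
    case (1 s)
    show ?case
    proof (cases "0 < s \<and> s < c")
      case True
      have "ennreal c \<le> ennreal (exp (\<kappa> * c) * (2 * c - c))"
        using c \<kappa>_pos by (intro ennreal_leI) (auto simp: mult_le_cancel_right1)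
      also have "\<dots> \<le> mid u s (2 * c)" using True c N by (intro mid_u_ge) auto
      also have "\<dots> \<le> mid u s t" using c by (intro mid_mono) auto
      finally have "ennreal c \<up> (q / m) \<le> mid u s t \<up> (q / m)" using a by (intro epow_mono) auto
      then show ?thesis using True c by (simp add: w_def)
    qed simp
  qed
  finally have "ennreal c \<up> (q / m) * ennreal c \<le> \<Phi> t" .
  moreover have "ennreal c \<up> (q / m) * ennreal c > 0"
    using c by (simp add: epow_ennreal ennreal_mult[symmetric])
  ultimately have "\<Phi> t > 0" by (rule less_le_trans[rotated])
  then show "0 < phi m q u w t"
    using q by (simp add: phi_eq[OF t] zero_less_iff_neq_zero epow_eq_0_iff)
  have "\<Phi> t \<le> (\<integral>\<^sup>+ (s :: real). ennreal (exp (\<kappa> * min t (real N)) / \<kappa>) \<up> (q / m) * indicator {0<..<1} s \<partial>lborel)"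
    unfolding \<Phi>_def head_def using mid_u_le a
    by (intro nn_integral_mono) (auto simp: w_def indicator_def intro!: epow_mono)
  also have "\<dots> = ennreal (exp (\<kappa> * min t (real N)) / \<kappa>) \<up> (q / m)"
    by (subst nn_integral_cmult) auto
  also have "\<dots> < \<infinity>" using a by (intro epow_less_top) auto
  finally show "phi m q u w t < \<infinity>"
    unfolding phi_eq[OF t] using q by (intro epow_less_top) auto
qed

lemma weighted_inequality_uwv: "weighted_inequality m p q u w v u w v"
  using weights_uwv admissible_uw by (simp add: weighted_inequality_def weighted_inequality_axioms_def)

text \<open>Put b = q(p-1)/(p-q). For 2 < t < N the interval (t-1,t) lies to the right of the
  support (0,1) of w, which gives \<Phi>(t)^(p/(p-q)) >= e^(b(t-1)). As V^(b-1) \<sigma> = e^(-bt),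
  the integrand is at least e^(-b) on an interval of length N - 2.\<close>

lemma A6_lower:
  "ennreal (exp (- (q * (p - 1) / (p - q))) * (real N - 2)) \<up> ((p - q) / (p * q)) \<le> A6 m p q u w v"
  unfolding weighted_inequality.A6_eq[OF weighted_inequality_uwv]
proof (rule epow_mono)
  interpret weighted_inequality m p q u w v u w v by (rule weighted_inequality_uwv)
  define b where "b = q * (p - 1) / (p - q)"
  have b1: "p * (q - 1) / (p - q) = b - 1" using p q by (simp add: b_def field_simps)
  have a: "q / m > 0" using m q by simp
  have "ennreal (exp (- b) * (real N - 2)) = (\<integral>\<^sup>+ t. ennreal (exp (- b)) * indicator {2<..<real N} t \<partial>lborel)"
    using N by (subst nn_integral_cmult) (auto simp: ennreal_mult)
  also have "\<dots> \<le> tail (\<lambda>t. \<Phi> t \<up> (p / (p - q)) * tail \<sigma> t \<up> (b - 1) * \<sigma> t) 0"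
    unfolding tail_def[of _ 0]
  proof (rule nn_integral_mono, goal_cases)
    case (1 t)
    show ?case
    proof (cases "2 < t \<and> t < real N")
      case True
      have "ennreal (exp (\<kappa> * (t - 1))) \<up> (q / m)
          = (\<integral>\<^sup>+ (s :: real). ennreal (exp (\<kappa> * (t - 1))) \<up> (q / m) * indicator {0<..<1} s \<partial>lborel)"
        by (subst nn_integral_cmult) auto
      also have "\<dots> \<le> \<Phi> t"
        unfolding \<Phi>_def head_def
      proof (rule nn_integral_mono, goal_cases)
        case (1 s)
        show ?case
        proof (cases "0 < s \<and> s < 1")
          case s: True
          have "ennreal (exp (\<kappa> * (t - 1)) * (t - (t - 1))) \<le> mid u s t"
            using s True by (intro mid_u_ge) auto
          then have "ennreal (exp (\<kappa> * (t - 1))) \<up> (q / m) \<le> mid u s t \<up> (q / m)"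
            using a by (intro epow_mono) auto
          then show ?thesis using s True by (simp add: w_def)
        qed simp
      qed
      finally have "(ennreal (exp (\<kappa> * (t - 1))) \<up> (q / m)) \<up> (p / (p - q)) \<le> \<Phi> t \<up> (p / (p - q))"
        using p q by (intro epow_mono) auto
      moreover have "(ennreal (exp (\<kappa> * (t - 1))) \<up> (q / m)) \<up> (p / (p - q)) = ennreal (exp (b * (t - 1)))"
      proof -
        have "(ennreal (exp (\<kappa> * (t - 1))) \<up> (q / m)) \<up> (p / (p - q))
            = ennreal (exp (\<kappa> * (t - 1) * (q / m * (p / (p - q)))))"
          by (simp add: epow_mult_exp[symmetric] epow_ennreal exp_powr_real)
        also have "\<kappa> * (t - 1) * (q / m * (p / (p - q))) = b * (t - 1)"
          using m p q by (simp add: \<kappa>_def b_def field_simps)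
        finally show ?thesis .
      qed
      ultimately have "ennreal (exp (b * (t - 1))) * (tail \<sigma> t \<up> (b - 1) * \<sigma> t)
          \<le> \<Phi> t \<up> (p / (p - q)) * (tail \<sigma> t \<up> (b - 1) * \<sigma> t)"
        by (intro mult_right_mono) auto
      moreover have "ennreal (exp (b * (t - 1))) * (tail \<sigma> t \<up> (b - 1) * \<sigma> t) = ennreal (exp (- b))"
        using True by (simp add: tail_\<sigma> \<sigma>_eq epow_ennreal exp_powr_real ennreal_mult[symmetric]
            exp_add[symmetric] algebra_simps)
      ultimately show ?thesis using True by (simp add: mult.assoc)
    qed simp
  qed
  finally show "ennreal (exp (- (q * (p - 1) / (p - q))) * (real N - 2))
    \<le> tail (\<lambda>t. \<Phi> t \<up> (p / (p - q)) * tail \<sigma> t \<up> (p * (q - 1) / (p - q)) * \<sigma> t) 0"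
    unfolding b1 by (simp add: b_def)
qed (use p q in simp)

text \<open>With \<eta> = m(p-1)/(p-m) the integrand is at most a constant times e^(\<eta> (min(s,N)
  - s)): bounded on (0,N), which contributes N, and decaying beyond N, which contributes
  1/\<eta>.\<close>

lemma kernel_integral_le:
  assumes t: "t > 0"
  shows "kernel_tail m p u (weights.\<sigma> p v) t
    \<le> ennreal ((1 / \<kappa>) powr (p / (p - m)) * (real N + (p - m) / (m * (p - 1))))"
proof -
  interpret weights m p q u w v u w v by (rule weights_uwv)
  define \<eta> where "\<eta> = m * (p - 1) / (p - m)"
  have \<eta>: "\<eta> > 0" using m p by (simp add: \<eta>_def)
  have e1: "\<kappa> * (p / (p - m)) = \<eta>" "p * (m - 1) / (p - m) + 1 = \<eta>"
    using m p by (simp_all add: \<kappa>_def \<eta>_def field_simps)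
  define c where "c = (1 / \<kappa>) powr (p / (p - m))"
  have c: "c \<ge> 0" by (simp add: c_def)
  have pt: "mid u t s \<up> (p / (p - m)) * tail \<sigma> s \<up> (p * (m - 1) / (p - m)) * \<sigma> s
      \<le> ennreal c * ennreal (exp (\<eta> * min s (real N) - \<eta> * s))" if "s > 0" for s
  proof -
    have "mid u t s \<up> (p / (p - m)) \<le> ennreal (exp (\<kappa> * min s (real N)) / \<kappa>) \<up> (p / (p - m))"
      using m by (intro epow_mono mid_u_le) auto
    also have "\<dots> = ennreal ((1 / \<kappa> * exp (\<kappa> * min s (real N))) powr (p / (p - m)))"
      using \<kappa>_pos by (simp add: epow_ennreal)
    also have "(1 / \<kappa> * exp (\<kappa> * min s (real N))) powr (p / (p - m)) = c * exp (\<kappa> * min s (real N)) powr (p / (p - m))"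
      unfolding c_def by (rule powr_mult)
    also have "exp (\<kappa> * min s (real N)) powr (p / (p - m)) = exp (\<eta> * min s (real N))"
      by (simp add: exp_powr_real e1(1)[symmetric] mult_ac)
    finally have 1: "mid u t s \<up> (p / (p - m)) \<le> ennreal (c * exp (\<eta> * min s (real N)))" .
    have "tail \<sigma> s \<up> (p * (m - 1) / (p - m)) * \<sigma> s = ennreal (exp (- s * (p * (m - 1) / (p - m) + 1)))"
      using that by (simp add: tail_\<sigma> \<sigma>_eq epow_ennreal exp_powr_real ennreal_mult[symmetric]
          exp_add[symmetric] distrib_left del: times_divide_eq_right)
    then have "tail \<sigma> s \<up> (p * (m - 1) / (p - m)) * \<sigma> s = ennreal (exp (- \<eta> * s))"
      by (simp add: e1(2) mult.commute)
    then have "mid u t s \<up> (p / (p - m)) * tail \<sigma> s \<up> (p * (m - 1) / (p - m)) * \<sigma> s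
        \<le> ennreal (c * exp (\<eta> * min s (real N))) * ennreal (exp (- \<eta> * s))"
      unfolding mult.assoc using 1 by (intro mult_mono) auto
    also have "\<dots> = ennreal c * ennreal (exp (\<eta> * min s (real N) - \<eta> * s))"
      using c by (simp add: ennreal_mult[symmetric] exp_diff exp_minus divide_inverse mult_ac)
    finally show ?thesis .
  qed
  have "kernel_tail m p u \<sigma> t
    \<le> (\<integral>\<^sup>+ s. ennreal c * (indicator {0<..<real N} s + ennreal (exp (\<eta> * real N)) * (ennreal (exp (- \<eta> * s)) * indicator {real N<..} s)) \<partial>lborel)"
    unfolding tail_def[of _ t]
  proof (rule nn_integral_mono_AE, goal_cases)
    case 1
    show ?case
      using AE_lborel_singleton[of "real N"]
    proof eventually_elim
      case (elim s)
      consider "s \<le> t" | "s > t" "s < real N" | "s > t" "s > real N" using elim by linarith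
      then show ?case
      proof cases
        case 2
        then show ?thesis using pt[of s] t by simp
      next
        case 3
        then show ?thesis using pt[of s] t by (simp add: exp_diff exp_minus divide_inverse ennreal_mult)
      qed simp
    qed
  qed
  also have "\<dots> = ennreal c * (ennreal (real N) + ennreal (exp (\<eta> * real N)) * tail (\<lambda>s. ennreal (exp (- \<eta> * s))) (real N))"
    unfolding tail_def by (simp add: nn_integral_cmult nn_integral_add)
  also have "\<dots> = ennreal c * (ennreal (real N) + ennreal (exp (\<eta> * real N)) * ennreal (exp (- \<eta> * real N) / \<eta>))"
    unfolding tail_exp[OF \<eta>] ..
  also have "\<dots> = ennreal (c * (real N + 1 / \<eta>))"
  proof -
    have "ennreal (exp (\<eta> * real N)) * ennreal (exp (- \<eta> * real N) / \<eta>) = ennreal (1 / \<eta>)"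
      using \<eta> by (simp add: ennreal_mult[symmetric] exp_minus)
    then show ?thesis using \<eta> c by (simp add: ennreal_mult)
  qed
  also have "1 / \<eta> = (p - m) / (m * (p - 1))" by (simp add: \<eta>_def)
  finally show ?thesis unfolding c_def .
qed

text \<open>The bound of \<open>tail_bound_borel\<close> becomes uniform in t, and w has mass 1. So
  it passes through the outer norm unchanged, q drops out, and N appears with the exponent 1/m -
  1/p.\<close>

lemma C_opt_le:
  "C_opt m p q u w v \<le> ennreal (((2 powr (p - 1)) powr (m / p) * split_const m m * (1 + 2 / (p - 1)) powr (m / p)) powr (1 / m)
    * ((1 / \<kappa>) powr (p / (p - m)) * (real N + (p - m) / (m * (p - 1)))) powr ((p - m) / (p * m)))"
    (is "_ \<le> ennreal (?K powr _ * ?D powr _)")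
proof (rule C_opt_least)
  interpret weighted_inequality m p q u w v u w v by (rule weighted_inequality_uwv)
  fix h assume "h \<in> M_plus" and den_fin: "denom p v h < \<infinity>"
  then obtain h' where h': "borel_version h h'" using M_plus_borel_version by blast
  then have [measurable]: "h' \<in> borel_measurable borel" by (simp add: borel_version_def)
  define G where "G = tail (\<lambda>s. h' s \<up> p * v s) 0"
  have den: "denom p v h = G \<up> (1 / p)" using denom_eq[OF h'] by (simp add: G_def)
  have K: "?K > 0" using split_const_pos[of m m] add_pos_pos[of 1 "2 / (p - 1)"] p by simp
  have D: "?D > 0" using \<kappa>_pos m p N by (auto intro!: mult_pos_pos add_pos_pos)
  define B where "B = ?K powr (1 / m) * ?D powr ((p - m) / (p * m))"
  have G_fin: "G < \<infinity>" using den_fin p by (simp add: den epow_eq_top_iff less_top[symmetric])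
  have fin: "tail \<sigma> t < \<infinity>" if "t > 0" for t using that by (simp add: tail_\<sigma>)
  have bound: "tail (\<lambda>s. tail h' s \<up> m * u s) t \<le> ennreal ?K * (G \<up> (m / p) * ennreal ?D \<up> ((p - m) / p))" if t: "t > 0" for t
  proof -
    have "tail (\<lambda>s. tail h' s \<up> m * u s) t \<le> ennreal ?K * (G \<up> (m / p) *
      kernel_tail m p u \<sigma> t \<up> ((p - m) / p))"
      unfolding G_def
      by (rule tail_bound_borel[OF m p]) (use fin t G_fin Holder_density in \<open>auto simp: G_def\<close>)
    also have "\<dots> \<le> ennreal ?K * (G \<up> (m / p) * ennreal ?D \<up> ((p - m) / p))"
      using m p by (intro mult_left_mono epow_mono kernel_integral_le t) auto
    finally show ?thesis .
  qed
  have "(\<integral>\<^sup>+ t. w t * tail (\<lambda>s. tail h' s \<up> m * u s) t \<up> (q / m) \<partial>lborel)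
    \<le> (\<integral>\<^sup>+ (t :: real). (ennreal ?K * (G \<up> (m / p) * ennreal ?D \<up> ((p - m) / p))) \<up> (q / m) * indicator {0<..<1} t \<partial>lborel)"
    using bound m q by (intro nn_integral_mono) (auto simp: w_def indicator_def intro!: epow_mono)
  also have "\<dots> = (ennreal ?K * (G \<up> (m / p) * ennreal ?D \<up> ((p - m) / p))) \<up> (q / m)"
    by (subst nn_integral_cmult) auto
  finally have "numer m q u w h \<le> ((ennreal ?K * (G \<up> (m / p) * ennreal ?D \<up> ((p - m) / p))) \<up> (q / m)) \<up> (1 / q)"
    unfolding numer_eq[OF h'] using q by (intro epow_mono) auto
  also have "\<dots> = (ennreal ?K * (G \<up> (m / p) * ennreal ?D \<up> ((p - m) / p))) \<up> (1 / m)"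
    using q by (simp only: epow_mult_exp[symmetric]) simp
  also have "\<dots> = ennreal ?K \<up> (1 / m) * (G \<up> (1 / p) * ennreal ?D \<up> ((p - m) / (p * m)))"
  proof -
    have "m / p * (1 / m) = 1 / p" "(p - m) / p * (1 / m) = (p - m) / (p * m)" using m by auto
    then show ?thesis using m by (simp only: epow_mult epow_mult_exp[symmetric] zero_le_divide_1_iff less_imp_le)
  qed
  also have "\<dots> = ennreal B * denom p v h"
    using K D unfolding den B_def by (simp only: epow_ennreal ennreal_mult powr_ge_zero mult_ac)
  finally show "numer m q u w h \<le> ennreal (?K powr (1 / m) * ?D powr ((p - m) / (p * m))) * denom p v h"
    unfolding B_def .
qed

end

text \<open>For N >= 3 one has N + c <= (3+c)(N-2), with equality at N = 3. Both sides thus become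
  powers of N + c, and (N+c)^(R-S) would be bounded.\<close>

lemma powr_growth_contradiction:
  fixes a B c R S :: real
  assumes a: "a > 0" and c: "c > 0" and R: "R > S" "R > 0"
    and le: "\<And>N :: nat. 3 \<le> N \<Longrightarrow> (a * (real N - 2)) powr R \<le> B * (real N + c) powr S"
  shows False
proof -
  define d where "d = (a / (3 + c)) powr R"
  have d: "d > 0" using a c by (simp add: d_def)
  define M where "M = max 0 (B / d)"
  have bound: "(real N + c) powr (R - S) \<le> M" if N: "3 \<le> N" for N :: nat
  proof -
    have "0 \<le> (2 + c) * (real N - 3)" using N c by simp
    then have "(real N + c) \<le> (3 + c) * (real N - 2)" by (simp add: algebra_simps)
    then have "a / (3 + c) * (real N + c) \<le> a / (3 + c) * ((3 + c) * (real N - 2))"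
      using a c by (intro mult_left_mono) auto
    also have "\<dots> = a * (real N - 2)" using c by simp
    finally have "(a / (3 + c) * (real N + c)) powr R \<le> (a * (real N - 2)) powr R"
      using a c R by (intro powr_mono2) auto
    also have "\<dots> \<le> B * (real N + c) powr S" using le[OF N] .
    finally have "d * (real N + c) powr R \<le> B * (real N + c) powr S"
      unfolding d_def powr_mult .
    then have "d * (real N + c) powr (R - S) \<le> B"
      using c N by (simp add: powr_diff field_simps)
    then have "(real N + c) powr (R - S) \<le> B / d" using d by (simp add: field_simps)
    then show ?thesis by (simp add: M_def)
  qed
  obtain k :: nat where k: "(M + 1) powr (1 / (R - S)) < real k" using reals_Archimedean2 by blast
  have "M + 1 = ((M + 1) powr (1 / (R - S))) powr (R - S)"
    using R by (simp add: powr_powr M_def)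
  also have "\<dots> \<le> (real (max 3 k) + c) powr (R - S)"
    using R k c by (intro powr_mono2) auto
  also have "\<dots> \<le> M" by (rule bound) simp
  finally show False by simp
qed

theorem proposition1p2:
  fixes m p q :: real
  assumes "0 < m" "m < p" "1 < p" "0 < q" "q < p"
  shows "(\<exists>c::real. 0 < c \<and>
            (\<forall>u w v. weight u \<longrightarrow> weight w \<longrightarrow> weight v \<longrightarrow> admissible m q u w \<longrightarrow>
               C_opt m p q u w v
                 \<le> ennreal c * (A1 m p q u w v + A5 m p q u w v + A6 m p q u w v))) \<and>
         ((\<exists>\<beta>::real. 0 < \<beta> \<and>
            (\<forall>u w v. weight u \<longrightarrow> weight w \<longrightarrow> weight v \<longrightarrow> admissible m q u w \<longrightarrow>
               A6 m p q u w v \<le> ennreal \<beta> * C_opt m p q u w v))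
          \<longleftrightarrow> m \<le> q)"
    (is "?upper \<and> (?lower \<longleftrightarrow> _)")
proof (intro conjI iffI)
  have locale_intro: "\<exists>u' w' v'. weighted_inequality m p q u w v u' w' v'"
    if uwv: "weight u" "weight w" "weight v" "admissible m q u w" for u w v
  proof -
    obtain u' where "borel_version u u'" using uwv(1) M_plus_borel_version by (auto simp: weight_def)
    moreover obtain w' where "borel_version w w'" using uwv(2) M_plus_borel_version by (auto simp: weight_def)
    moreover obtain v' where "borel_version v v'" using uwv(3) M_plus_borel_version by (auto simp: weight_def)
    ultimately have "weighted_inequality m p q u w v u' w' v'"
      using assms uwv(4) by unfold_locales auto
    then show ?thesis by blast
  qed
  show ?upper
  proof (intro exI conjI allI impI)
    show "0 < (2 * upper_const m p q) powr (1 / q) * 2"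
      using upper_const_pos[of p m q] assms by simp
    fix u w v assume "weight u" "weight w" "weight v" "admissible m q u w"
    then obtain u' w' v' where "weighted_inequality m p q u w v u' w' v'" using locale_intro by blast
    then show "C_opt m p q u w v \<le> ennreal ((2 * upper_const m p q) powr (1 / q) * 2)
        * (A1 m p q u w v + A5 m p q u w v + A6 m p q u w v)"
      by (rule weighted_inequality.C_opt_upper)
  qed
  show ?lower if mq: "m \<le> q"
  proof (intro exI conjI allI impI)
    let ?K = "lower_const m p q"
    have "?K > 0" using assms by (rule lower_const_pos)
    then have "?K \<noteq> 0" by (rule less_imp_neq[THEN not_sym])
    then show "0 < ?K powr (1 / q)" unfolding powr_gt_zero .
    fix u w v assume "weight u" "weight w" "weight v" "admissible m q u w"
    then obtain u' w' v' where "weighted_inequality m p q u w v u' w' v'" using locale_intro by blast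
    then show "A6 m p q u w v \<le> ennreal (?K powr (1 / q)) * C_opt m p q u w v"
      using mq by (rule weighted_inequality.A6_le)
  qed
next
  assume ?lower
  then obtain \<beta> where \<beta>: "0 < \<beta>" and A6_le_C: "\<And>u w v. weight u \<Longrightarrow> weight w \<Longrightarrow> weight v \<Longrightarrow>
      admissible m q u w \<Longrightarrow> A6 m p q u w v \<le> ennreal \<beta> * C_opt m p q u w v" by blast
  show "m \<le> q"
  proof (rule ccontr)
    assume "\<not> m \<le> q"
    define a where "a = exp (- (q * (p - 1) / (p - q)))"
    define K where "K = (2 powr (p - 1)) powr (m / p) * split_const m m * (1 + 2 / (p - 1)) powr (m / p)"
    define d where "d = (1 / (m * (1 - 1 / p))) powr (p / (p - m))"
    define c where "c = (p - m) / (m * (p - 1))"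
    define R where "R = (p - q) / (p * q)"
    define S where "S = (p - m) / (p * m)"
    have c: "c > 0" using assms by (simp add: c_def)
    have d: "d \<ge> 0" by (simp add: d_def)
    \<comment> \<open>The growth exponents of the lower bound for \<open>A6\<close> and of the upper
      bound for C; q < m makes the first one larger.\<close>
    have "R = 1 / q - 1 / p" "S = 1 / m - 1 / p" using assms by (simp_all add: R_def S_def field_simps)
    moreover have "1 / m < 1 / q" using assms \<open>\<not> m \<le> q\<close> by (simp add: frac_less2)
    ultimately have "R > S" by simp
    moreover have "R > 0" using assms by (simp add: R_def)
    moreover have "(a * (real N - 2)) powr R \<le> \<beta> * K powr (1 / m) * d powr S * (real N + c) powr S"
      if N: "3 \<le> N" for N :: nat
    proof -
      interpret X: counterexample m p q N using assms N by unfold_locales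
      have "ennreal ((a * (real N - 2)) powr R) = ennreal (a * (real N - 2)) \<up> R"
        using N by (simp add: epow_ennreal a_def)
      also have "\<dots> \<le> A6 m p q X.u X.w X.v"
        using X.A6_lower by (simp add: a_def R_def)
      also have "\<dots> \<le> ennreal \<beta> * C_opt m p q X.u X.w X.v"
        by (intro A6_le_C X.admissible_uw) (auto simp: weight_def intro!: borel_measurable_M_plus)
      also have "\<dots> \<le> ennreal \<beta> * ennreal (K powr (1 / m) * (d * (real N + c)) powr S)"
        using X.C_opt_le unfolding K_def d_def c_def S_def X.\<kappa>_def by (intro mult_left_mono) auto
      also have "\<dots> = ennreal (\<beta> * K powr (1 / m) * d powr S * (real N + c) powr S)"
        using \<beta> by (simp add: ennreal_mult[symmetric] powr_mult mult.assoc)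
      finally show ?thesis using \<beta> by (simp add: ennreal_le_iff)
    qed
    ultimately show False
      using c by (intro powr_growth_contradiction[of a c S R "\<beta> * K powr (1 / m) * d powr S"]) (auto simp: a_def)
  qed
qed

end
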